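(* Let $(X,\mathcal W)$ be a balayage space, let $U$ be an open set in $X$, let $s\in\mathcal W\cap\mathcal C(X)$, and let $$\mathcal H_s(U):=\{h\in\mathcal H(U)\colon |h|\le s\}.$$ Then the set $\mathcal H_s(U)$ is (locally) equicontinuous on $U$, that is, for every $x\in U$ and every $\delta>0$ there is a neighborhood $N$ of $x$ in $U$ such that $|h(y)-h(x)|<\delta$ for all $y\in N$ and all $h\in\mathcal H_s(U)$.
   Context: $X$ is a locally compact space with countable base. For an open set $U\subset X$, $\mathcal B(U)$ is the set of all Borel measurable numerical (i.e. $[-\infty,\infty]$-valued) functions on $U$, $\mathcal C(U)$ is the set of all continuous real functions on $U$, and $\mathcal C_0(U)$ is the set of functions in $\mathcal C(U)$ vanishing at infinity with respect to $U$. "Positive" means $\ge 0$. Balayage space: $(X,\mathcal W)$ is a balayage space if $\mathcal W$ is a convex cone of positive numerical functions on $X$ such that: (B$_0$) (C) every $w\in\mathcal W$ is the supremum of its minorants in $\mathcal W\cap\mathcal C(X)$; (S) for all $x\ne y$ in $X$ and $\gamma>0$ there is $v\in\mathcal W$ with $v(x)\neq\gamma v(y)$; (T) there are strictly positive $u,v\in\mathcal W\cap\mathcal C(X)$ with $u/v\in\mathcal C_0(X)$. (B$_1$) If $v_n\in\mathcal W$ and $v_n\uparrow v$, then $v\in\mathcal W$. (B$_2$) If $\mathcal V\subset\mathcal W$, then $\widehat{\inf\mathcal V}^f\in\mathcal W$, where $\hat g^f$ is the greatest finely lower semicontinuous minorant of $g$ and the fine topology is the coarsest topology on $X$ for which all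 functions in $\mathcal W$ are continuous. (B$_3$) If $u,v',v''\in\mathcal W$ and $u\le v'+v''$, then there exist $u',u''\in\mathcal W$ with $u=u'+u''$, $u'\le v'$, $u''\le v''$. Continuous real potentials: $\mathcal P(X)$ is the set of all $p\in\mathcal W\cap\mathcal C(X)$ for which there is a strictly positive $w\in\mathcal W\cap\mathcal C(X)$ with $p/w\in\mathcal C_0(X)$. Harmonic kernels: for every open $V\subset X$, $H_V$ denotes the (unique) kernel on $X$ such that $H_Vp=\inf\{w\in\mathcal W\colon w\ge p\text{ on }X\setminus V\}$ for every $p\in\mathcal P(X)$; $H_Vf(x)=\int f\,dH_V(x,\cdot)$. Harmonic functions: $\mathcal U(U)$ is the set of all open sets $V$ whose closure is compact and contained in $U$. $\mathcal H(U)$ is the set of functions harmonic on $U$: $\mathcal H(U)=\{h\in\mathcal B(X)\colon h|_U\in\mathcal C(U),\ H_Vh=h\text{ for every }V\in\mathcal U(U)\}$ (in particular the integrals $H_Vh$ are well defined). Note that elements of $\mathcal H(U)$ are functions on all of $X$, and $|h|\le s$ is meant on $X$. *)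

theory Defs
  imports "HOL-Analysis.Analysis"
begin

text \<open>
  Numerical functions are functions into \<^typ>\<open>ereal\<close>.  A real function is a numerical function
  all of whose values are finite; the topology of \<^typ>\<open>ereal\<close> induces the usual one on the reals.
\<close>

definition cont_real :: "'a::topological_space set \<Rightarrow> ('a \<Rightarrow> ereal) set"
  where "cont_real U = {f. continuous_on U f \<and> (\<forall>x\<in>U. \<bar>f x\<bar> \<noteq> \<infinity>)}"

definition cont_real_vanishing :: "'a::topological_space set \<Rightarrow> ('a \<Rightarrow> ereal) set"
  where "cont_real_vanishing U =
    {f \<in> cont_real U. \<forall>e>0. \<exists>K. compact K \<and> K \<subseteq> U \<and> (\<forall>x\<in>U - K. \<bar>f x\<bar> < ereal e)}"

text \<open>
  The coarsest topology making all members of \<open>W\<close> continuous.  Its carrier is the whole type as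
  soon as \<open>W\<close> is nonempty.
\<close>

definition fine_topology :: "('a \<Rightarrow> ereal) set \<Rightarrow> 'a topology"
  where "fine_topology W = topology_generated_by {w -` G |w G. w \<in> W \<and> open G}"

definition lower_semicontinuous :: "'a topology \<Rightarrow> ('a \<Rightarrow> ereal) \<Rightarrow> bool"
  where "lower_semicontinuous T g \<longleftrightarrow> (\<forall>a. openin T {x \<in> topspace T. a < g x})"

definition lsc_regularization :: "'a topology \<Rightarrow> ('a \<Rightarrow> ereal) \<Rightarrow> 'a \<Rightarrow> ereal"
  where "lsc_regularization T g = Sup {h. lower_semicontinuous T h \<and> h \<le> g}"

text \<open>The supremum is attained, so this is indeed the greatest lower semicontinuous minorant.\<close>

lemma lower_semicontinuous_Sup:
  assumes "\<And>h. h \<in> F \<Longrightarrow> lower_semicontinuous T h"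
  shows "lower_semicontinuous T (Sup F)"
  unfolding lower_semicontinuous_def
proof
  fix a
  have "{x \<in> topspace T. a < Sup F x} = (\<Union>h\<in>F. {x \<in> topspace T. a < h x})"
    by (auto simp: less_SUP_iff)
  with assms show "openin T {x \<in> topspace T. a < Sup F x}"
    by (auto simp: lower_semicontinuous_def)
qed

lemma lsc_regularization_greatest:
  "lower_semicontinuous T (lsc_regularization T g)"
  "lsc_regularization T g \<le> g"
  "lower_semicontinuous T h \<Longrightarrow> h \<le> g \<Longrightarrow> h \<le> lsc_regularization T g"
  unfolding lsc_regularization_def
  by (auto intro!: lower_semicontinuous_Sup Sup_least Sup_upper)

locale balayage_space =
  fixes W :: "('a::{t2_space, second_countable_topology} \<Rightarrow> ereal) set"
  assumes locally_compact: "locally compact (UNIV :: 'a set)"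
    and positive: "\<And>w x. w \<in> W \<Longrightarrow> 0 \<le> w x"
    and cone_add: "\<And>u v. u \<in> W \<Longrightarrow> v \<in> W \<Longrightarrow> (\<lambda>x. u x + v x) \<in> W"
    and cone_scale: "\<And>c w. 0 \<le> c \<Longrightarrow> w \<in> W \<Longrightarrow> (\<lambda>x. ereal c * w x) \<in> W"
    and B0_C: "\<And>w x. w \<in> W \<Longrightarrow> w x = (SUP v\<in>{v \<in> W \<inter> cont_real UNIV. v \<le> w}. v x)"
    and B0_S: "\<And>x y c. x \<noteq> y \<Longrightarrow> 0 < c \<Longrightarrow> \<exists>v\<in>W. v x \<noteq> ereal c * v y"
    and B0_T: "\<exists>u\<in>W \<inter> cont_real UNIV. \<exists>v\<in>W \<inter> cont_real UNIV.
      (\<forall>x. 0 < u x) \<and> (\<forall>x. 0 < v x) \<and> (\<lambda>x. u x / v x) \<in> cont_real_vanishing UNIV"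
    and B1: "\<And>v. (\<And>n. v n \<in> W) \<Longrightarrow> incseq v \<Longrightarrow> (\<lambda>x. SUP n. v n x) \<in> W"
    and B2: "\<And>\<V>. \<V> \<subseteq> W \<Longrightarrow>
      lsc_regularization (fine_topology W) (\<lambda>x. INF v\<in>\<V>. v x) \<in> W"
    and B3: "\<And>u v' v''. u \<in> W \<Longrightarrow> v' \<in> W \<Longrightarrow> v'' \<in> W \<Longrightarrow> (\<And>x. u x \<le> v' x + v'' x) \<Longrightarrow>
      \<exists>u'\<in>W. \<exists>u''\<in>W. (\<forall>x. u x = u' x + u'' x) \<and> u' \<le> v' \<and> u'' \<le> v''"

definition cont_potentials :: "('a::topological_space \<Rightarrow> ereal) set \<Rightarrow> ('a \<Rightarrow> ereal) set"
  where "cont_potentials W = {p \<in> W \<inter> cont_real UNIV.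
    \<exists>w\<in>W \<inter> cont_real UNIV. (\<forall>x. 0 < w x) \<and> (\<lambda>x. p x / w x) \<in> cont_real_vanishing UNIV}"

text \<open>
  Integral of a numerical function: \<^const>\<open>e2ennreal\<close> maps negative values to 0, so the two
  nonnegative integrals are those of the positive and the negative part.  The integral is well
  defined if they are not both infinite.
\<close>

definition has_numerical_integral :: "'a measure \<Rightarrow> ('a \<Rightarrow> ereal) \<Rightarrow> ereal \<Rightarrow> bool"
  where "has_numerical_integral M f r \<longleftrightarrow>
    f \<in> borel_measurable M \<and>
    ((\<integral>\<^sup>+y. e2ennreal (f y) \<partial>M) < \<infinity> \<or> (\<integral>\<^sup>+y. e2ennreal (- f y) \<partial>M) < \<infinity>) \<and>
    r = enn2ereal (\<integral>\<^sup>+y. e2ennreal (f y) \<partial>M) - enn2ereal (\<integral>\<^sup>+y. e2ennreal (- f y) \<partial>M)"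

definition borel_kernel :: "('a::topological_space \<Rightarrow> 'a measure) \<Rightarrow> bool"
  where "borel_kernel K \<longleftrightarrow>
    (\<forall>x. sets (K x) = sets borel) \<and>
    (\<forall>A\<in>sets borel. (\<lambda>x. emeasure (K x) A) \<in> borel_measurable borel)"

text \<open>For a balayage space and open \<open>V\<close> there is exactly one such kernel \<open>K\<close>, namely \<open>H\<^sub>V\<close>.\<close>

definition is_harmonic_kernel ::
  "('a::topological_space \<Rightarrow> ereal) set \<Rightarrow> 'a set \<Rightarrow> ('a \<Rightarrow> 'a measure) \<Rightarrow> bool"
  where "is_harmonic_kernel W V K \<longleftrightarrow> borel_kernel K \<and>
    (\<forall>p\<in>cont_potentials W. \<forall>x.
      has_numerical_integral (K x) p (INF w\<in>{w \<in> W. \<forall>y\<in>- V. p y \<le> w y}. w x))"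

definition rel_compact_open :: "'a::topological_space set \<Rightarrow> 'a set set"
  where "rel_compact_open U = {V. open V \<and> compact (closure V) \<and> closure V \<subseteq> U}"

definition harmonic_functions ::
  "('a::topological_space set \<Rightarrow> 'a \<Rightarrow> 'a measure) \<Rightarrow> 'a set \<Rightarrow> ('a \<Rightarrow> ereal) set"
  where "harmonic_functions H U =
    {h \<in> borel_measurable borel. h \<in> cont_real U \<and>
      (\<forall>V\<in>rel_compact_open U. \<forall>x. has_numerical_integral (H V x) h (h x))}"

definition harmonic_functions_bounded_by ::
  "('a::topological_space set \<Rightarrow> 'a \<Rightarrow> 'a measure) \<Rightarrow> ('a \<Rightarrow> ereal) \<Rightarrow> 'a set \<Rightarrow> ('a \<Rightarrow> ereal) set"
  where "harmonic_functions_bounded_by H s U = {h \<in> harmonic_functions H U. \<forall>x. \<bar>h x\<bar> \<le> s x}"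

end

theory Submission
  imports Defs "HOL-Complex_Analysis.Great_Picard"
begin

text \<open>
  The potential-theoretic core is Bauer's convergence property \<open>continuous_on_monotone_limit\<close>:
  functions harmonic on \<open>V\<close> agree locally, up to a fixed summand, with members of \<open>W\<close>, and so does
  their difference to a fixed \<open>c\<close>; since increasing limits in \<open>W\<close> are finely continuous, (B2) makes
  monotone limits of such functions continuous.  Hence \<open>x \<mapsto> H\<^sub>V(1\<^sub>A s)(x)\<close> is continuous on \<open>V\<close> for
  every Borel set \<open>A\<close>.

  Consequently the measures \<open>s H\<^sub>V(z, \<cdot>)\<close>, \<open>z \<in> V\<close>, are absolutely continuous with respect to a single
  finite measure, and every sequence of harmonic functions bounded by \<open>s\<close> has a subsequence that
  converges pointwise on \<open>V\<close>.  This does not control the functions outside \<open>U\<close>, to which \<open>H\<^sub>V\<close> may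
  jump.  If \<open>H\<^sub>V(x, \<cdot>)\<close> tends to the unit mass at \<open>x\<close> as \<open>V\<close> shrinks to \<open>x\<close>, that part is small
  for a suitable \<open>V\<close>.  Otherwise \<open>x\<close> is finely isolated, and the harmonic measures of a punctured
  neighbourhood of \<open>x\<close> concentrate at \<open>x\<close>.
\<close>

section \<open>Sequences of integrals\<close>

text \<open>The axioms speak only of functions on all of X, and \<open>H V\<close> is prescribed
  only on continuous potentials. So local statements have to be turned into global ones, and
  statements about integrals have to start from potentials. The bridge in both directions is the
  class \<open>pot_diffs\<close> of differences of potentials. It is a vector lattice that separates
  points, so it contains bumps and cutoffs; each of its members has a continuous least majorant in
  W; and every nonnegative lower semicontinuous function is an increasing limit of such differences.
  The last two facts combine to a membership test, \<open>W_if_reduced\<close>: a nonnegative lower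
  semicontinuous function lies in W once it dominates the least majorant of every difference below
  it. This is what allows a superharmonic function on an open set to be glued into W.

  Continuity of new functions is obtained by writing a continuous function as a sum of two lower
  semicontinuous ones. This is why functions enter in complementary pairs, such as h and s -
  h.\<close>

lemma convergent_if_uniformly_approx:
  fixes a :: "nat \<Rightarrow> real"
  assumes "\<And>e. e > 0 \<Longrightarrow> \<exists>c. convergent c \<and> (\<forall>n. \<bar>a n - c n\<bar> \<le> e)"
  shows "convergent a"
proof -
  have "Cauchy a"
  proof (rule metric_CauchyI)
    fix e :: real assume "e > 0"
    then obtain c where c: "convergent c" "\<And>n. \<bar>a n - c n\<bar> \<le> e / 4"
      using assms[of "e / 4"] by auto
    have "Cauchy c" using c(1) by (rule convergent_Cauchy)
    then obtain N where N: "\<And>m n. m \<ge> N \<Longrightarrow> n \<ge> N \<Longrightarrow> dist (c m) (c n) < e / 4"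
      using metric_CauchyD[of c "e / 4"] \<open>e > 0\<close> by auto
    have "dist (a m) (a n) < e" if "m \<ge> N" "n \<ge> N" for m n
      using N[OF that] c(2)[of m] c(2)[of n] \<open>e > 0\<close> unfolding dist_real_def by linarith
    then show "\<exists>N. \<forall>m\<ge>N. \<forall>n\<ge>N. dist (a m) (a n) < e" by blast
  qed
  then show ?thesis by (rule Cauchy_convergent)
qed

text \<open>Countability allows a diagonal extraction over the generators, and stability under
  intersection lets convergence spread from them to all Borel sets by a Dynkin argument.
  \<open>UNIV\<close>, the intersection of the empty family, belongs to \<open>E\<close> because the
  step to complements subtracts from the integral over the whole space.\<close>

lemma ex_countable_Int_stable_borel:
  obtains E :: "'a::second_countable_topology set set"
  where "countable E" "Int_stable E" "UNIV \<in> E" "E \<subseteq> sets borel" "sets borel = sigma_sets UNIV E"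
proof -
  obtain B :: "'a set set" where B: "countable B" "topological_basis B"
    using ex_countable_basis by blast
  define E where "E = Inter ` {F. finite F \<and> F \<subseteq> B}"
  have B_open: "open b" if "b \<in> B" for b by (rule topological_basis_open[OF B(2) that])
  have 1: "countable E"
    unfolding E_def using countable_Collect_finite_subset[OF B(1)] by (intro countable_image) (simp add: conj_commute)
  have 2: "Int_stable E"
  proof (rule Int_stableI)
    fix a b assume "a \<in> E" "b \<in> E"
    then obtain F G where FG: "finite F" "F \<subseteq> B" "a = \<Inter>F" "finite G" "G \<subseteq> B" "b = \<Inter>G" by (auto simp: E_def)
    then have "a \<inter> b = \<Inter>(F \<union> G)" by (simp add: Inter_Un_distrib)
    moreover have "F \<union> G \<in> {F. finite F \<and> F \<subseteq> B}" using FG by simp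
    ultimately show "a \<inter> b \<in> E" unfolding E_def by (intro image_eqI[of _ _ "F \<union> G"])
  qed
  have 3: "UNIV \<in> E" unfolding E_def by (intro image_eqI[of _ _ "{}"]) auto
  have E_open: "open e" if e: "e \<in> E" for e
  proof -
    obtain F where "finite F" "F \<subseteq> B" "e = \<Inter>F" using e by (auto simp: E_def)
    then show ?thesis using B_open by (auto intro!: open_Inter)
  qed
  have 4: "E \<subseteq> sets borel" using E_open by auto
  have BE: "B \<subseteq> E"
  proof
    fix b assume "b \<in> B"
    then show "b \<in> E" unfolding E_def by (intro image_eqI[of _ _ "{b}"]) auto
  qed
  have "sets (borel :: 'a measure) = sigma_sets UNIV B"
    unfolding borel_eq_countable_basis[OF B] by simp
  also have "\<dots> \<subseteq> sigma_sets UNIV E" using BE by (rule sigma_sets_mono')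
  finally have "sets borel \<subseteq> sigma_sets UNIV E" .
  moreover have "sigma_sets UNIV E \<subseteq> sets borel"
    using sets.sigma_sets_subset[of E "borel :: 'a measure"] 4 by simp
  ultimately show ?thesis using that[OF 1 2 3 4] by blast
qed

text \<open>Weak sequential compactness of the unit ball of \<open>L\<^sup>\<infinity>\<close>, stated without the limit function.\<close>

lemma ex_weakly_convergent_subsequence:
  fixes f :: "nat \<Rightarrow> 'a::second_countable_topology \<Rightarrow> real"
  assumes M: "finite_measure M" "sets M = sets borel"
    and f: "\<And>n. f n \<in> borel_measurable M" "\<And>n x. \<bar>f n x\<bar> \<le> 1"
  obtains r where "strict_mono (r :: nat \<Rightarrow> nat)"
    "\<And>k. integrable M k \<Longrightarrow> convergent (\<lambda>n. \<integral>x. k x * f (r n) x \<partial>M)"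
proof -
  interpret finite_measure M by (rule M)
  have space: "space M = UNIV" using sets_eq_imp_space_eq[OF M(2)] by simp
  have int_kf: "integrable M (\<lambda>x. k x * f n x)" if "integrable M k" for k n
  proof (rule Bochner_Integration.integrable_bound[OF that])
    show "AE x in M. norm (k x * f n x) \<le> norm (k x)"
      using f(2)[of n] by (auto simp: abs_mult intro!: AE_I2 mult_left_le)
  qed (use f(1) that in simp)
  have ind: "integrable M (indicator A :: 'a \<Rightarrow> real)" if "A \<in> sets M" for A
    using that by (simp add: emeasure_eq_measure)
  have bound: "\<bar>\<integral>x. k x * f n x \<partial>M\<bar> \<le> (\<integral>x. \<bar>k x\<bar> \<partial>M)" if k: "integrable M k" for k n
  proof -
    have "\<bar>\<integral>x. k x * f n x \<partial>M\<bar> \<le> (\<integral>x. \<bar>k x * f n x\<bar> \<partial>M)" by (rule integral_abs_bound)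
    also have "\<dots> \<le> (\<integral>x. \<bar>k x\<bar> \<partial>M)"
    proof (rule integral_mono[OF integrable_abs[OF int_kf[OF k]] integrable_abs[OF k]])
      show "\<bar>k x * f n x\<bar> \<le> \<bar>k x\<bar>" for x using f(2)[of n x] by (simp add: abs_mult mult_left_le)
    qed
    finally show ?thesis .
  qed
  obtain E :: "'a set set" where E: "countable E" "Int_stable E" "UNIV \<in> E" "E \<subseteq> sets borel"
    "sets borel = sigma_sets UNIV E" by (rule ex_countable_Int_stable_borel)
  have "norm (\<integral>x. indicator A x * f n x \<partial>M) \<le> measure M UNIV" if "A \<in> E" for A n
  proof -
    have A: "A \<in> sets M" using that E(4) M(2) by auto
    have "\<bar>\<integral>x. indicator A x * f n x \<partial>M\<bar> \<le> (\<integral>x. \<bar>indicator A x\<bar> \<partial>M)" by (rule bound[OF ind[OF A]])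
    also have "\<dots> = measure M A" using A by (simp add: space)
    also have "\<dots> \<le> measure M UNIV" using bounded_measure[of A] by (simp add: space)
    finally show ?thesis by simp
  qed
  \<comment> \<open>Diagonal extraction: for each of the countably many sets in \<open>E\<close> the
    integrals form a bounded sequence.\<close>
  then obtain r where r: "strict_mono (r :: nat \<Rightarrow> nat)"
    "\<And>A. A \<in> E \<Longrightarrow> \<exists>l. (\<lambda>n. \<integral>x. indicator A x * f (r n) x \<partial>M) \<longlonglongrightarrow> l"
    by (rule function_convergent_subsequence[OF E(1), of "\<lambda>n A. \<integral>x. indicator A x * f n x \<partial>M"])
      (assumption, rule that)
  have sets_conv: "convergent (\<lambda>n. \<integral>x. indicator A x * f (r n) x \<partial>M)" if "A \<in> sets M" for A
  proof -
    have "A \<in> sigma_sets UNIV E" using that M(2) E(5) by simp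
    then show ?thesis
    proof (induction rule: sigma_sets_induct_disjoint[rotated 2, consumes 1, case_names basic empty compl union int pow])
      case (basic A)
      then show ?case using r(2) by (simp add: convergent_def)
    next
      case empty
      show ?case by (simp add: convergent_const)
    next
      case (compl A)
      have A: "A \<in> sets M" using compl(1) E(5) M(2) by simp
      have "(\<integral>x. indicator (UNIV - A) x * f (r n) x \<partial>M) =
          (\<integral>x. indicator UNIV x * f (r n) x \<partial>M) - (\<integral>x. indicator A x * f (r n) x \<partial>M)" for n
      proof -
        have "UNIV \<in> sets M" using M(2) by simp
        from Bochner_Integration.integral_diff[OF int_kf[OF ind[OF this]] int_kf[OF ind[OF A]], of "r n" "r n"]
        moreover have "indicator (UNIV - A) x * f (r n) x = indicator UNIV x * f (r n) x - indicator A x * f (r n) x" for x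
          by (simp add: indicator_def)
        ultimately show ?thesis by (simp only:)
      qed
      moreover have "convergent (\<lambda>n. \<integral>x. indicator UNIV x * f (r n) x \<partial>M)"
        using r(2)[OF E(3)] by (simp add: convergent_def)
      ultimately show ?case using compl(2) by (simp only: convergent_diff)
    next
      case (union A)
      have A: "A i \<in> sets M" for i using union(2) E(5) M(2) by auto
      let ?U = "\<lambda>m. \<Union>i<m. A i"
      have U: "?U m \<in> sets M" "(\<Union>i. A i) \<in> sets M" for m using A by auto
      have partial: "convergent (\<lambda>n. \<integral>x. indicator (?U m) x * f (r n) x \<partial>M)" for m
      proof (induction m)
        case 0
        show ?case by (simp add: convergent_const)
      next
        case (Suc m)
        have disj: "A i \<inter> A m = {}" if "i < m" for i
          using disjoint_family_onD[OF union(1), of i m] that by simp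
        have "indicator (?U (Suc m)) x = (indicator (?U m) x + indicator (A m) x :: real)" for x
          using disj by (auto simp: indicator_def less_Suc_eq split: if_splits)
        then have "(\<integral>x. indicator (?U (Suc m)) x * f (r n) x \<partial>M) =
            (\<integral>x. indicator (?U m) x * f (r n) x \<partial>M) + (\<integral>x. indicator (A m) x * f (r n) x \<partial>M)" for n
          using Bochner_Integration.integral_add[OF int_kf[OF ind[OF U(1)[of m]]] int_kf[OF ind[OF A[of m]]], of "r n" "r n"]
          by (simp only: distrib_right)
        then show ?case using Suc union(3)[of m] by (simp only: convergent_add)
      qed
      \<comment> \<open>As \<open>f\<close> is bounded by 1, replacing the whole union by
        \<open>?U m\<close> costs at most the measure of the rest, uniformly in
        \<open>n\<close>.\<close>
      have meas: "(\<lambda>m. measure M (?U m)) \<longlonglongrightarrow> measure M (\<Union>m. ?U m)"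
        using U by (intro finite_Lim_measure_incseq incseq_SucI) (auto simp: less_Suc_eq)
      have UU: "(\<Union>m. ?U m) = (\<Union>i. A i)" by auto
      show ?case
      proof (rule convergent_if_uniformly_approx)
        fix e :: real assume "e > 0"
        then obtain m where m: "\<bar>measure M (?U m) - measure M (\<Union>i. A i)\<bar> < e"
          using LIMSEQ_D[OF meas] unfolding UU by fastforce
        have "\<bar>(\<integral>x. indicator (\<Union>i. A i) x * f (r n) x \<partial>M) - (\<integral>x. indicator (?U m) x * f (r n) x \<partial>M)\<bar> \<le> e" for n
        proof -
          have sub: "?U m \<subseteq> (\<Union>i. A i)" by auto
          have "(\<integral>x. indicator (\<Union>i. A i) x * f (r n) x \<partial>M) - (\<integral>x. indicator (?U m) x * f (r n) x \<partial>M)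
              = (\<integral>x. indicator (\<Union>i. A i) x * f (r n) x - indicator (?U m) x * f (r n) x \<partial>M)"
            by (rule Bochner_Integration.integral_diff[symmetric, OF int_kf[OF ind[OF U(2)]] int_kf[OF ind[OF U(1)]]])
          also have "\<dots> = (\<integral>x. indicator ((\<Union>i. A i) - ?U m) x * f (r n) x \<partial>M)"
            using sub by (intro Bochner_Integration.integral_cong) (auto simp: indicator_def)
          finally have "\<bar>(\<integral>x. indicator (\<Union>i. A i) x * f (r n) x \<partial>M) - (\<integral>x. indicator (?U m) x * f (r n) x \<partial>M)\<bar>
              \<le> (\<integral>x. \<bar>indicator ((\<Union>i. A i) - ?U m) x\<bar> \<partial>M)"
            using bound[OF ind[OF sets.Diff[OF U(2) U(1)[of m]]], of "r n"] by (simp only:)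
          also have "\<dots> = measure M ((\<Union>i. A i) - ?U m)" using U by (simp add: space)
          also have "\<dots> = measure M (\<Union>i. A i) - measure M (?U m)"
            by (rule finite_measure_Diff[OF U(2) U(1) sub])
          finally show ?thesis using m by linarith
        qed
        then show "\<exists>c. convergent c \<and> (\<forall>n. \<bar>(\<integral>x. indicator (\<Union>i. A i) x * f (r n) x \<partial>M) - c n\<bar> \<le> e)"
          using partial[of m] by blast
      qed
    qed (use E(2) in auto)
  qed
  have "convergent (\<lambda>n. \<integral>x. k x * f (r n) x \<partial>M)" if "integrable M k" for k
    using that
  proof (induction rule: integrable_induct)
    case (base A c)
    have "(\<integral>x. indicator A x *\<^sub>R c * f (r n) x \<partial>M) = c * (\<integral>x. indicator A x * f (r n) x \<partial>M)" for n
      by (simp add: mult.assoc mult.left_commute)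
    then show ?case using sets_conv[OF base(1)] by (simp add: convergent_mult convergent_const)
  next
    case (add g h)
    have "(\<integral>x. (g x + h x) * f (r n) x \<partial>M) = (\<integral>x. g x * f (r n) x \<partial>M) + (\<integral>x. h x * f (r n) x \<partial>M)" for n
      using int_kf[OF add.hyps(1)] int_kf[OF add.hyps(2)] by (simp add: distrib_right)
    then show ?case using add.IH by (simp add: convergent_add)
  next
    case (lim g s)
    \<comment> \<open>The factor 3 in the dominating function comes from the approximants
      \<open>s i\<close>, whose absolute value is at most twice that of \<open>g\<close>.\<close>
    have "(\<lambda>i. \<integral>x. \<bar>g x - s i x\<bar> \<partial>M) \<longlonglongrightarrow> (\<integral>x. 0 \<partial>M)"
    proof (rule integral_dominated_convergence[where w="\<lambda>x. 3 * \<bar>g x\<bar>"])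
      show "AE x in M. (\<lambda>i. \<bar>g x - s i x\<bar>) \<longlonglongrightarrow> 0"
      proof (rule AE_I2)
        fix x assume "x \<in> space M"
        from tendsto_rabs[OF tendsto_diff[OF tendsto_const[of "g x"] lim.hyps(2)[OF this]]]
        show "(\<lambda>i. \<bar>g x - s i x\<bar>) \<longlonglongrightarrow> 0" by simp
      qed
      show "AE x in M. norm \<bar>g x - s i x\<bar> \<le> 3 * \<bar>g x\<bar>" for i
      proof (rule AE_I2)
        fix x assume "x \<in> space M"
        then have "\<bar>s i x\<bar> \<le> 2 * \<bar>g x\<bar>" using lim.hyps(3)[of x i] by simp
        then show "norm \<bar>g x - s i x\<bar> \<le> 3 * \<bar>g x\<bar>" by simp
      qed
    qed (use lim.hyps(1,4) in auto)
    then have L1: "(\<lambda>i. \<integral>x. \<bar>g x - s i x\<bar> \<partial>M) \<longlonglongrightarrow> 0" by simp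
    show ?case
    proof (rule convergent_if_uniformly_approx)
      fix e :: real assume "e > 0"
      then obtain i where i: "\<bar>\<integral>x. \<bar>g x - s i x\<bar> \<partial>M\<bar> < e"
        using LIMSEQ_D[OF L1] by fastforce
      have "\<bar>(\<integral>x. g x * f (r n) x \<partial>M) - (\<integral>x. s i x * f (r n) x \<partial>M)\<bar> \<le> e" for n
      proof -
        have "(\<integral>x. g x * f (r n) x \<partial>M) - (\<integral>x. s i x * f (r n) x \<partial>M) = (\<integral>x. (g x - s i x) * f (r n) x \<partial>M)"
          using int_kf[OF lim.hyps(4), of "r n"] int_kf[OF lim.hyps(1), of i "r n"] by (simp add: left_diff_distrib)
        then show ?thesis
          using bound[OF Bochner_Integration.integrable_diff[OF lim.hyps(4) lim.hyps(1)[of i]], of "r n"] i by linarith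
      qed
      then show "\<exists>c. convergent c \<and> (\<forall>n. \<bar>(\<integral>x. g x * f (r n) x \<partial>M) - c n\<bar> \<le> e)"
        using lim.IH[of i] by blast
    qed
  qed
  then show ?thesis using r(1) that by blast
qed

text \<open>A weighted sum of the \<open>N k\<close>: the weight \<open>c k\<close> gives the k-th
  term total mass at most \<open>(1 / 2) ^ Suc k\<close>, so the sum has mass at most 1. Writing the
  sum as an integral over the counting measure reduces countable additivity to an interchange of sum
  and integral.\<close>

lemma ex_dominating_finite_measure:
  fixes N :: "nat \<Rightarrow> 'a measure"
  assumes N: "\<And>k. finite_measure (N k)" "\<And>k. sets (N k) = sets B"
  obtains M where "finite_measure M" "sets M = sets B"
    "\<And>A k. A \<in> sets M \<Longrightarrow> emeasure M A = 0 \<Longrightarrow> emeasure (N k) A = 0"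
proof -
  define c where "c k = (1 / 2) ^ Suc k / (1 + measure (N k) (space B))" for k :: nat
  have c: "0 < c k" for k by (simp add: c_def add_pos_nonneg)
  define \<mu> where "\<mu> A = (\<integral>\<^sup>+k. ennreal (c k) * emeasure (N k) A \<partial>count_space UNIV)" for A
  define M where "M = measure_of (space B) (sets B) \<mu>"
  have sets_M: "sets M = sets B" by (simp add: M_def sets.sigma_sets_eq sets.space_closed)
  have space_M: "space M = space B" using sets_eq_imp_space_eq[OF sets_M] .
  have em: "emeasure M A = \<mu> A" if "A \<in> sets B" for A
  proof (rule emeasure_measure_of[OF M_def sets.space_closed])
    show "positive (sets M) \<mu>" by (simp add: positive_def \<mu>_def)
    show "countably_additive (sets M) \<mu>"
    proof (rule countably_additiveI)
      fix A :: "nat \<Rightarrow> 'a set" assume A: "range A \<subseteq> sets M" "disjoint_family A"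
      have "(\<Sum>i. \<mu> (A i)) = (\<integral>\<^sup>+k. (\<Sum>i. ennreal (c k) * emeasure (N k) (A i)) \<partial>count_space UNIV)"
        unfolding \<mu>_def by (rule nn_integral_suminf[symmetric]) simp
      also have "\<dots> = \<mu> (\<Union>i. A i)"
        unfolding \<mu>_def
      proof (rule nn_integral_cong)
        fix k
        have "(\<Sum>i. emeasure (N k) (A i)) = emeasure (N k) (\<Union>i. A i)"
          using A by (intro suminf_emeasure) (simp_all add: N(2) sets_M)
        then show "(\<Sum>i. ennreal (c k) * emeasure (N k) (A i)) = ennreal (c k) * emeasure (N k) (\<Union>i. A i)"
          by (simp add: ennreal_suminf_cmult)
      qed
      finally show "(\<Sum>i. \<mu> (A i)) = \<mu> (\<Union>i. A i)" .
    qed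
    show "A \<in> sets M" using that sets_M by simp
  qed
  have "\<mu> (space B) \<le> (\<integral>\<^sup>+k. ennreal ((1 / 2) ^ Suc k) \<partial>count_space UNIV)"
    unfolding \<mu>_def
  proof (rule nn_integral_mono)
    fix k :: nat
    have "c k * measure (N k) (space B) \<le> (1 / 2) ^ Suc k"
      unfolding c_def by (simp add: divide_simps add_pos_nonneg)
    then show "ennreal (c k) * emeasure (N k) (space B) \<le> ennreal ((1 / 2) ^ Suc k)"
      using c[of k] by (simp add: finite_measure.emeasure_eq_measure[OF N(1)] ennreal_mult[symmetric] ennreal_leI)
  qed
  also have "\<dots> = (\<Sum>k. ennreal ((1 / 2) ^ Suc k))" by (rule nn_integral_count_space_nat)
  also have "\<dots> = ennreal 1" using power_half_series by (intro suminf_ennreal_eq) auto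
  finally have "emeasure M (space M) \<noteq> \<infinity>" using em[of "space B"] by (auto simp: space_M top_unique)
  then have "finite_measure M" by (rule finite_measureI)
  moreover have "emeasure (N k) A = 0" if "A \<in> sets M" "emeasure M A = 0" for A k
  proof -
    have "\<mu> A = 0" using that em sets_M by simp
    then have "ennreal (c k) * emeasure (N k) A = 0"
      unfolding \<mu>_def by (subst (asm) nn_integral_0_iff_AE) (auto simp: AE_count_space)
    then show ?thesis using c[of k] by simp
  qed
  ultimately show ?thesis using sets_M that by blast
qed

text \<open>The Radon-Nikodym density of \<open>N\<close> is integrable because \<open>N\<close> is
  finite, so it is one of the admissible test functions \<open>k\<close>.\<close>

lemma convergent_integral_absolutely_continuous:
  fixes f :: "nat \<Rightarrow> 'a \<Rightarrow> real"
  assumes M: "finite_measure M" and N: "finite_measure N" "sets N = sets M" "absolutely_continuous M N"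
    and f: "\<And>n. f n \<in> borel_measurable M"
    and conv: "\<And>k. integrable M k \<Longrightarrow> convergent (\<lambda>n. \<integral>x. k x * f n x \<partial>M)"
  shows "convergent (\<lambda>n. \<integral>x. f n x \<partial>N)"
proof -
  interpret M: finite_measure M by (rule M)
  interpret N: finite_measure N by (rule N)
  obtain D where D: "D \<in> borel_measurable M" "AE x in M. RN_deriv M N x = ennreal (D x)" "\<And>x. 0 \<le> D x"
    using M.real_RN_deriv[OF N(1,3,2)] by metis
  have "density M (\<lambda>x. ennreal (D x)) = density M (RN_deriv M N)"
    using D by (intro density_cong) auto
  also have "\<dots> = N" by (rule M.density_RN_deriv[OF N(3,2)])
  finally have dens: "density M (\<lambda>x. ennreal (D x)) = N" .
  have "(\<integral>\<^sup>+x. ennreal (D x) \<partial>M) = emeasure N (space N)"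
    using D(1) sets_eq_imp_space_eq[OF N(2)] unfolding dens[symmetric]
    by (simp add: emeasure_density cong: nn_integral_cong)
  also have "\<dots> < \<infinity>" by (simp add: less_top[symmetric])
  finally have "integrable M D" using D(1,3) by (intro integrableI_nonneg) auto
  from conv[OF this] show ?thesis
    unfolding dens[symmetric] using D f by (simp add: integral_density)
qed

section \<open>Continuous members and potentials\<close>

text \<open>\<open>f\<close> is also upper semicontinuous, being the continuous \<open>a\<close>
  minus the lower semicontinuous \<open>a - f\<close>. The hypotheses suit members of W, whose
  strict superlevel sets are open.\<close>

lemma continuous_on_if_lsc_split:
  fixes f a :: "'a::t2_space \<Rightarrow> real"
  assumes S: "open S" and a: "continuous_on S a"
    and f: "\<And>c. open {x \<in> S. c < f x}" and af: "\<And>c. open {x \<in> S. c < a x - f x}"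
  shows "continuous_on S f"
proof -
  have less: "open {x \<in> S. f x < c}" for c
  proof -
    have eq: "{x \<in> S. f x < c} = (\<Union>d. (a -` {..<d} \<inter> S) \<inter> {x \<in> S. d - c < a x - f x})" (is "?L = ?R")
    proof
      show "?R \<subseteq> ?L" by auto
      show "?L \<subseteq> ?R"
      proof
        fix x assume x: "x \<in> ?L"
        then have "a x < c + (a x - f x)" by simp
        then obtain d where "a x < d" "d < c + (a x - f x)" using dense by blast
        then show "x \<in> ?R" using x by (auto intro!: exI[of _ d])
      qed
    qed
    have *: "open (a -` {..<d} \<inter> S)" for d
      using continuous_on_open_vimage[OF S, of a] a by (simp add: open_lessThan)
    show ?thesis unfolding eq by (intro open_UN ballI open_Int[OF * af])
  qed
  have "(f \<longlongrightarrow> f x) (at x)" if x: "x \<in> S" for x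
  proof (rule order_tendstoI)
    show "eventually (\<lambda>y. c < f y) (at x)" if "c < f x" for c
      using f[of c] x that unfolding eventually_at_topological by (intro exI[of _ "{x \<in> S. c < f x}"]) auto
    show "eventually (\<lambda>y. f y < c) (at x)" if "f x < c" for c
      using less[of c] x that unfolding eventually_at_topological by (intro exI[of _ "{x \<in> S. f x < c}"]) auto
  qed
  then show ?thesis
    unfolding continuous_on_eq_continuous_at[OF S] isCont_def by blast
qed

context balayage_space
begin

abbreviation fineT :: "'a topology" where "fineT \<equiv> fine_topology W"

text \<open>Members of W \<inter> C(X) stripped of the type \<open>ereal\<close>, so that
  differences and Bochner integrals become available.\<close>

definition Wc :: "('a \<Rightarrow> real) set"
  where "Wc = {w. continuous_on UNIV w \<and> (\<lambda>x. ereal (w x)) \<in> W}"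

text \<open>P(X), with the vanishing of p / w at infinity cleared of the division. As
  \<open>e\<close> is arbitrary, a weak inequality is enough.\<close>

definition pots :: "('a \<Rightarrow> real) set"
  where "pots = {p \<in> Wc. \<exists>w\<in>Wc. (\<forall>x. 0 < w x) \<and>
    (\<forall>e>0. \<exists>K. compact K \<and> (\<forall>x. x \<notin> K \<longrightarrow> p x \<le> e * w x))}"

definition pot_diffs :: "('a \<Rightarrow> real) set"
  where "pot_diffs = {f. \<exists>a\<in>pots. \<exists>b\<in>pots. f = (\<lambda>x. a x - b x)}"

lemma Wc_cont: "w \<in> Wc \<Longrightarrow> continuous_on UNIV w"
  and Wc_W: "w \<in> Wc \<Longrightarrow> (\<lambda>x. ereal (w x)) \<in> W"
  by (auto simp: Wc_def)

lemma Wc_nonneg: "w \<in> Wc \<Longrightarrow> 0 \<le> w x"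
  using positive[OF Wc_W, of w x] by simp

lemma pots_Wc: "p \<in> pots \<Longrightarrow> p \<in> Wc"
  by (auto simp: pots_def)

lemmas pots_cont = pots_Wc[THEN Wc_cont]
  and pots_W = pots_Wc[THEN Wc_W]
  and pots_nonneg = pots_Wc[THEN Wc_nonneg]

lemma cont_real_imp_Wc:
  assumes "f \<in> W" "f \<in> cont_real UNIV"
  shows "(\<lambda>x. real_of_ereal (f x)) \<in> Wc" "ereal (real_of_ereal (f x)) = f x"
proof -
  have fin: "\<bar>f x\<bar> \<noteq> \<infinity>" for x using assms(2) by (auto simp: cont_real_def)
  have e: "ereal (real_of_ereal (f x)) = f x" for x using fin by (simp add: ereal_real)
  show "ereal (real_of_ereal (f x)) = f x" by (rule e)
  have "continuous_on UNIV f" using assms(2) by (auto simp: cont_real_def)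
  then have "continuous_on UNIV (\<lambda>x. real_of_ereal (f x))"
    using continuous_on_iff_real[of UNIV f] fin by (simp add: o_def)
  then show "(\<lambda>x. real_of_ereal (f x)) \<in> Wc"
    using assms(1) by (simp add: Wc_def e)
qed

lemma Wc_cont_real: "w \<in> Wc \<Longrightarrow> (\<lambda>x. ereal (w x)) \<in> W \<inter> cont_real UNIV"
  by (auto simp: Wc_def cont_real_def intro!: continuous_on_ereal)

lemma Wc_add: "u \<in> Wc \<Longrightarrow> v \<in> Wc \<Longrightarrow> (\<lambda>x. u x + v x) \<in> Wc"
  using cone_add[of "\<lambda>x. ereal (u x)" "\<lambda>x. ereal (v x)"]
  by (auto simp: Wc_def intro!: continuous_on_add)

lemma Wc_scale: "0 \<le> c \<Longrightarrow> u \<in> Wc \<Longrightarrow> (\<lambda>x. c * u x) \<in> Wc"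
  using cone_scale[of c "\<lambda>x. ereal (u x)"]
  by (auto simp: Wc_def intro!: continuous_on_mult continuous_on_const)

lemma pots_cont_potentials:
  assumes "p \<in> pots" shows "(\<lambda>x. ereal (p x)) \<in> cont_potentials W"
proof -
  obtain w where w: "w \<in> Wc" "\<And>x. 0 < w x"
    and van: "\<And>e. e > 0 \<Longrightarrow> \<exists>K. compact K \<and> (\<forall>x. x \<notin> K \<longrightarrow> p x \<le> e * w x)"
    using assms by (auto simp: pots_def)
  have wn: "w x \<noteq> 0" for x using w(2)[of x] by simp
  have eq: "ereal (p x) / ereal (w x) = ereal (p x / w x)" for x
    using wn by simp
  have "continuous_on UNIV (\<lambda>x. ereal (p x / w x))"
    using pots_cont[OF assms] Wc_cont[OF w(1)] wn by (intro continuous_on_divide continuous_on_ereal) auto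
  moreover have "\<exists>K. compact K \<and> K \<subseteq> UNIV \<and> (\<forall>x\<in>UNIV - K. \<bar>ereal (p x / w x)\<bar> < ereal e)"
    if "e > 0" for e
  proof -
    \<comment> \<open>Halving \<open>e\<close> turns the weak bound of \<open>pots\<close> into the
      strict one of \<open>cont_real_vanishing\<close>.\<close>
    obtain K where K: "compact K" "\<And>x. x \<notin> K \<Longrightarrow> p x \<le> e / 2 * w x"
      using van[of "e/2"] \<open>e > 0\<close> by auto
    have "\<bar>ereal (p x / w x)\<bar> < ereal e" if "x \<notin> K" for x
    proof -
      have "p x \<le> e / 2 * w x" using K(2) that by simp
      also have "\<dots> < e * w x" using \<open>e > 0\<close> w(2)[of x] by simp
      finally have "p x / w x < e" using w(2)[of x] by (simp add: field_simps)
      moreover have "0 \<le> p x / w x" using pots_nonneg[OF assms] w(2)[of x] by (simp add: less_imp_le)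
      ultimately show ?thesis by simp
    qed
    then show ?thesis using K(1) by blast
  qed
  ultimately show ?thesis
    using Wc_cont_real[OF pots_Wc[OF assms]] Wc_cont_real[OF w(1)] w(2) wn
    unfolding cont_potentials_def cont_real_vanishing_def
    by (auto intro!: bexI[of _ "\<lambda>x. ereal (w x)"] simp: cont_real_def)
qed

lemma pots_majorized:
  assumes "p \<in> pots" "r \<in> Wc" "\<And>x. r x \<le> p x" shows "r \<in> pots"
proof -
  obtain w where w: "w \<in> Wc" "\<forall>x. 0 < w x"
    "\<And>e. e > 0 \<Longrightarrow> \<exists>K. compact K \<and> (\<forall>x. x \<notin> K \<longrightarrow> p x \<le> e * w x)"
    using assms(1) by (auto simp: pots_def)
  have "\<exists>K. compact K \<and> (\<forall>x. x \<notin> K \<longrightarrow> r x \<le> e * w x)" if "e > 0" for e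
    using w(3)[OF that] order_trans[OF assms(3)] by meson
  then show ?thesis using w(1,2) assms(2) unfolding pots_def by blast
qed

lemma pots_add:
  assumes "p \<in> pots" "q \<in> pots" shows "(\<lambda>x. p x + q x) \<in> pots"
proof -
  obtain w where w: "w \<in> Wc" "\<And>x. 0 < w x"
    "\<And>e. e > 0 \<Longrightarrow> \<exists>K. compact K \<and> (\<forall>x. x \<notin> K \<longrightarrow> p x \<le> e * w x)"
    using assms(1) by (auto simp: pots_def)
  obtain v where v: "v \<in> Wc" "\<And>x. 0 < v x"
    "\<And>e. e > 0 \<Longrightarrow> \<exists>K. compact K \<and> (\<forall>x. x \<notin> K \<longrightarrow> q x \<le> e * v x)"
    using assms(2) by (auto simp: pots_def)
  have "\<exists>K. compact K \<and> (\<forall>x. x \<notin> K \<longrightarrow> p x + q x \<le> e * (w x + v x))" if e: "e > 0" for e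
  proof -
    obtain K L where "compact K" "\<And>x. x \<notin> K \<Longrightarrow> p x \<le> e * w x"
      "compact L" "\<And>x. x \<notin> L \<Longrightarrow> q x \<le> e * v x"
      using w(3)[OF e] v(3)[OF e] by blast
    then show ?thesis
      by (intro exI[of _ "K \<union> L"]) (auto simp: distrib_left intro!: add_mono)
  qed
  then show ?thesis
    using w(1,2) v(1,2) assms[THEN pots_Wc] Wc_add[of w v] Wc_add[of p q] unfolding pots_def
    by (auto intro!: bexI[of _ "\<lambda>x. w x + v x"] add_pos_pos)
qed

lemma pots_scale:
  assumes "0 \<le> c" "p \<in> pots" shows "(\<lambda>x. c * p x) \<in> pots"
proof -
  obtain w where w: "w \<in> Wc" "\<And>x. 0 < w x"
    "\<And>e. e > 0 \<Longrightarrow> \<exists>K. compact K \<and> (\<forall>x. x \<notin> K \<longrightarrow> p x \<le> e * w x)"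
    using assms(2) by (auto simp: pots_def)
  have "\<exists>K. compact K \<and> (\<forall>x. x \<notin> K \<longrightarrow> c * p x \<le> e * w x)" if e: "e > 0" for e
  proof (cases "c = 0")
    case True
    then show ?thesis using e w(2) by (auto simp: less_imp_le intro!: exI[of _ "{}"])
  next
    case False
    then have "e / c > 0" using assms(1) e by simp
    then obtain K where K: "compact K" "\<And>x. x \<notin> K \<Longrightarrow> p x \<le> e / c * w x" using w(3) by blast
    moreover have "c * p x \<le> e * w x" if "x \<notin> K" for x
      using mult_left_mono[OF K(2)[OF that] assms(1)] False by simp
    ultimately show ?thesis by blast
  qed
  then show ?thesis
    using w(1,2) Wc_scale[OF assms(1) pots_Wc[OF assms(2)]] unfolding pots_def by blast
qed

lemma ex_pos_pot: "\<exists>u\<in>pots. \<forall>x. 0 < u x"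
proof -
  obtain u v where u: "u \<in> W" "u \<in> cont_real UNIV" "\<And>x. 0 < u x"
    and v: "v \<in> W" "v \<in> cont_real UNIV" "\<And>x. 0 < v x"
    and uv: "(\<lambda>x. u x / v x) \<in> cont_real_vanishing UNIV"
    using B0_T by blast
  define u' v' where "u' = (\<lambda>x. real_of_ereal (u x))" and "v' = (\<lambda>x. real_of_ereal (v x))"
  have e: "u x = ereal (u' x)" "v x = ereal (v' x)" for x
    using cont_real_imp_Wc(2)[OF u(1,2), of x] cont_real_imp_Wc(2)[OF v(1,2), of x]
    by (simp_all add: u'_def v'_def)
  have "u' \<in> Wc" "v' \<in> Wc"
    using cont_real_imp_Wc(1)[OF u(1,2)] cont_real_imp_Wc(1)[OF v(1,2)] by (simp_all add: u'_def v'_def)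
  moreover have pos: "0 < u' x" "0 < v' x" for x using u(3)[of x] v(3)[of x] by (simp_all add: e)
  moreover have "\<exists>K. compact K \<and> (\<forall>x. x \<notin> K \<longrightarrow> u' x \<le> c * v' x)" if "c > 0" for c
  proof -
    obtain K where "compact K" and K: "\<And>x. x \<notin> K \<Longrightarrow> \<bar>u x / v x\<bar> < ereal c"
      using uv \<open>c > 0\<close> unfolding cont_real_vanishing_def by (auto dest!: spec[of _ c])
    moreover have "u' x \<le> c * v' x" if "x \<notin> K" for x
    proof -
      have "u' x / v' x < c" using K[OF that] pos[of x] by (simp add: e)
      then show ?thesis using pos(2)[of x] by (simp add: field_simps)
    qed
    ultimately show ?thesis by blast
  qed
  ultimately show ?thesis unfolding pots_def by blast
qed

lemma zero_W: "(\<lambda>x. 0) \<in> W"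
proof -
  obtain u where "u \<in> W" using B0_T by blast
  from cone_scale[OF order_refl this] show ?thesis by (simp add: zero_ereal_def[symmetric])
qed

lemma zero_pots: "(\<lambda>x. 0) \<in> pots"
proof -
  obtain u where "u \<in> pots" using ex_pos_pot by blast
  from pots_scale[OF order_refl this] show ?thesis by simp
qed

section \<open>Fine topology\<close>

lemma fine_open_vimage: "w \<in> W \<Longrightarrow> open G \<Longrightarrow> openin fineT (w -` G)"
  by (auto simp: fine_topology_def intro!: topology_generated_by_Basis)

lemma topspace_fine [simp]: "topspace fineT = UNIV"
  using openin_subset[OF fine_open_vimage[OF zero_W open_UNIV]] by auto

lemma fine_open_greater: "w \<in> W \<Longrightarrow> openin fineT {x. c < w x}"
  using fine_open_vimage[of w "{c<..}"] by (simp add: vimage_def)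

lemma fine_open_less: "w \<in> W \<Longrightarrow> openin fineT {x. w x < c}"
  using fine_open_vimage[of w "{..<c}"] by (simp add: vimage_def)

lemma Wc_fine_cont: assumes "w \<in> Wc" shows "continuous_map fineT euclideanreal w"
  unfolding continuous_map_def
proof (intro conjI allI impI)
  fix G :: "real set" assume "openin euclidean G"
  then have "open (ereal ` G)" by (simp add: open_ereal)
  from fine_open_vimage[OF Wc_W[OF assms] this]
  have "openin fineT ((\<lambda>x. ereal (w x)) -` ereal ` G)" .
  also have "(\<lambda>x. ereal (w x)) -` ereal ` G = {x \<in> topspace fineT. w x \<in> G}" by auto
  finally show "openin fineT {x \<in> topspace fineT. w x \<in> G}" .
qed auto

lemma fine_open_less_fun:
  assumes "u \<in> W" "continuous_map fineT euclideanreal f"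
  shows "openin fineT {x. u x < ereal (f x)}"
proof -
  have "{x. u x < ereal (f x)} = (\<Union>q. {x. u x < ereal q} \<inter> {x \<in> topspace fineT. f x \<in> {q<..}})"
    (is "?L = ?R")
  proof
    show "?L \<subseteq> ?R" using ereal_dense2 by fastforce
    show "?R \<subseteq> ?L" by (auto intro: less_trans)
  qed
  moreover have "openin fineT {x \<in> topspace fineT. f x \<in> {q<..}}" for q
    using openin_continuous_map_preimage[OF assms(2), of "{q<..}"] by simp
  ultimately show ?thesis
    using fine_open_less[OF assms(1)] by (auto intro!: openin_Union openin_Int)
qed

text \<open>The form in which (B2) is applied throughout: the regularized infimum stays above every
  finely lower semicontinuous minorant, so a member of W fits between \<open>m\<close> and the whole
  family.\<close>

lemma fine_regularization:
  assumes "V \<subseteq> W" "lower_semicontinuous fineT m" "\<And>v x. v \<in> V \<Longrightarrow> m x \<le> v x"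
  shows "\<exists>u\<in>W. (\<forall>x. m x \<le> u x) \<and> (\<forall>v\<in>V. \<forall>x. u x \<le> v x)"
proof (intro bexI conjI ballI allI)
  let ?g = "\<lambda>x. INF v\<in>V. v x"
  let ?u = "lsc_regularization fineT ?g"
  show "?u \<in> W" by (rule B2[OF assms(1)])
  have "m \<le> ?g" using assms(3) by (auto simp: le_fun_def intro: INF_greatest)
  then show "m x \<le> ?u x" for x
    using lsc_regularization_greatest(3)[OF assms(2)] by (auto simp: le_fun_def)
  show "?u x \<le> v x" if "v \<in> V" for v x
    using order_trans[OF le_funD[OF lsc_regularization_greatest(2)[of fineT ?g], of x] INF_lower[OF that]] .
qed

text \<open>The minimum is itself finely lower semicontinuous, so taken as the minorant
  \<open>m\<close> it coincides with the regularized infimum of the two functions.\<close>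

lemma min_W:
  assumes "u \<in> W" "v \<in> W" shows "(\<lambda>x. min (u x) (v x)) \<in> W"
proof -
  let ?m = "\<lambda>x. min (u x) (v x)"
  have "lower_semicontinuous fineT ?m"
    unfolding lower_semicontinuous_def
    using openin_Int[OF fine_open_greater[OF assms(1)] fine_open_greater[OF assms(2)]]
    by (auto simp: Collect_conj_eq)
  then have "\<exists>w\<in>W. (\<forall>x. ?m x \<le> w x) \<and> (\<forall>f\<in>{u, v}. \<forall>x. w x \<le> f x)"
    by (intro fine_regularization) (use assms in auto)
  then obtain w where w: "w \<in> W" "\<And>x. ?m x \<le> w x" "\<And>f x. f \<in> {u, v} \<Longrightarrow> w x \<le> f x"
    by blast
  have "w x = ?m x" for x
    using w(2)[of x] w(3)[of u x] w(3)[of v x] by (intro antisym) auto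
  then have "w = ?m" by (rule ext)
  with w(1) show ?thesis by (simp only:)
qed

lemma Wc_min: "u \<in> Wc \<Longrightarrow> v \<in> Wc \<Longrightarrow> (\<lambda>x. min (u x) (v x)) \<in> Wc"
  using min_W[of "\<lambda>x. ereal (u x)" "\<lambda>x. ereal (v x)"]
  by (auto simp: Wc_def intro!: continuous_on_min)

lemma pots_min1: "u \<in> pots \<Longrightarrow> v \<in> Wc \<Longrightarrow> (\<lambda>x. min (u x) (v x)) \<in> pots"
  by (rule pots_majorized[of u]) (auto intro: Wc_min pots_Wc)

lemma W_lsc: assumes "w \<in> W" shows "open {x. c < w x}"
proof -
  have "{x. c < w x} = (\<Union>v\<in>{v \<in> W \<inter> cont_real UNIV. v \<le> w}. {x. c < v x})"
    by (subst B0_C[OF assms]) (auto simp: less_SUP_iff)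
  moreover have "open {x. c < v x}" if "v \<in> cont_real UNIV" for v
    using that by (auto simp: cont_real_def intro!: open_Collect_less continuous_on_const)
  ultimately show ?thesis by auto
qed

section \<open>Differences of potentials\<close>

lemma pot_diffsI: "a \<in> pots \<Longrightarrow> b \<in> pots \<Longrightarrow> (\<lambda>x. a x - b x) \<in> pot_diffs"
  by (auto simp: pot_diffs_def)

lemma pots_diffs: "a \<in> pots \<Longrightarrow> a \<in> pot_diffs"
  using pot_diffsI[OF _ zero_pots] by simp

lemma pot_diffs_cont: "f \<in> pot_diffs \<Longrightarrow> continuous_on UNIV f"
  unfolding pot_diffs_def using continuous_on_diff pots_cont by blast

lemma pot_diffs_minus: assumes "f \<in> pot_diffs" shows "(\<lambda>x. - f x) \<in> pot_diffs"
proof -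
  obtain a b where "a \<in> pots" "b \<in> pots" "f = (\<lambda>x. a x - b x)" using assms by (auto simp: pot_diffs_def)
  then show ?thesis using pot_diffsI[of b a] by simp
qed

lemma pot_diffs_add: assumes "f \<in> pot_diffs" "g \<in> pot_diffs" shows "(\<lambda>x. f x + g x) \<in> pot_diffs"
proof -
  obtain a b c d where *: "a \<in> pots" "b \<in> pots" "f = (\<lambda>x. a x - b x)"
    "c \<in> pots" "d \<in> pots" "g = (\<lambda>x. c x - d x)" using assms by (auto simp: pot_diffs_def)
  have eq: "(\<lambda>x. f x + g x) = (\<lambda>x. (a x + c x) - (b x + d x))" by (auto simp: *(3,6))
  show ?thesis unfolding eq by (intro pot_diffsI pots_add *)
qed

lemma pot_diffs_diff: "f \<in> pot_diffs \<Longrightarrow> g \<in> pot_diffs \<Longrightarrow> (\<lambda>x. f x - g x) \<in> pot_diffs"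
  using pot_diffs_add[OF _ pot_diffs_minus, of f g] by simp

lemma pot_diffs_scale: assumes "f \<in> pot_diffs" shows "(\<lambda>x. c * f x) \<in> pot_diffs"
proof -
  obtain a b where *: "a \<in> pots" "b \<in> pots" "f = (\<lambda>x. a x - b x)" using assms by (auto simp: pot_diffs_def)
  have pos: "(\<lambda>x. c * f x) \<in> pot_diffs" if "0 \<le> c" for c
    using pot_diffsI[OF pots_scale[OF that *(1)] pots_scale[OF that *(2)]] * by (simp add: algebra_simps)
  show ?thesis
    using pos[of c] pot_diffs_minus[OF pos[of "-c"]] by (cases "0 \<le> c") auto
qed

text \<open>Adding b + d to both arguments reduces this to a minimum of two potentials. Together
  with closure under negation it makes \<open>pot_diffs\<close> a vector lattice.\<close>

lemma pot_diffs_min: assumes "f \<in> pot_diffs" "g \<in> pot_diffs" shows "(\<lambda>x. min (f x) (g x)) \<in> pot_diffs"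
proof -
  obtain a b c d where *: "a \<in> pots" "b \<in> pots" "f = (\<lambda>x. a x - b x)"
    "c \<in> pots" "d \<in> pots" "g = (\<lambda>x. c x - d x)" using assms by (auto simp: pot_diffs_def)
  have eq: "(\<lambda>x. min (f x) (g x)) = (\<lambda>x. min (a x + d x) (c x + b x) - (b x + d x))"
    by (auto simp: *(3,6) min_def)
  show ?thesis unfolding eq by (intro pot_diffsI pots_add pots_min1 pots_Wc *)
qed

lemma pot_diffs_max: assumes "f \<in> pot_diffs" "g \<in> pot_diffs" shows "(\<lambda>x. max (f x) (g x)) \<in> pot_diffs"
proof -
  have eq: "(\<lambda>x. max (f x) (g x)) = (\<lambda>x. - min (- f x) (- g x))"
    by (rule ext) linarith
  show ?thesis unfolding eq by (intro pot_diffs_minus pot_diffs_min assms)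
qed

lemma pot_diffs_Min:
  assumes "finite I" "I \<noteq> {}" "\<And>i. i \<in> I \<Longrightarrow> f i \<in> pot_diffs"
  shows "\<exists>g\<in>pot_diffs. (\<forall>i\<in>I. \<forall>x. g x \<le> f i x) \<and> (\<forall>x. \<exists>i\<in>I. g x = f i x)"
  using assms
proof (induction rule: finite_ne_induct)
  case (singleton i)
  then show ?case by auto
next
  case (insert i I)
  then obtain g where g: "g \<in> pot_diffs" "\<forall>i\<in>I. \<forall>x. g x \<le> f i x" "\<forall>x. \<exists>i\<in>I. g x = f i x" by auto
  show ?case
    using g insert.prems by (intro bexI[of _ "\<lambda>x. min (f i x) (g x)"] pot_diffs_min)
      (auto simp: min_def intro: order_trans)
qed

text \<open>Mokobodzki: by (B3), \<open>a \<le> r + b\<close> splits \<open>a\<close> as \<open>p' + p''\<close> with \<open>p'' \<le> b\<close>, so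
  \<open>p' \<ge> a - b\<close> and minimality gives \<open>p' = r\<close>.  As \<open>r\<close> and \<open>a - r\<close> are both lower semicontinuous,
  \<open>r\<close> is continuous.\<close>

lemma ex_reduced:
  assumes "a \<in> pots" "b \<in> pots"
  obtains r where "r \<in> pots" "\<And>x. r x \<le> a x" "\<And>x. a x - b x \<le> r x"
    "\<And>w x. w \<in> W \<Longrightarrow> (\<And>y. ereal (a y - b y) \<le> w y) \<Longrightarrow> ereal (r x) \<le> w x"
proof -
  let ?V = "{w \<in> W. \<forall>y. ereal (a y - b y) \<le> w y}"
  have "continuous_map fineT euclideanreal (\<lambda>x. a x - b x)"
    by (intro continuous_map_diff Wc_fine_cont pots_Wc assms)
  then have op: "openin fineT {x. c < a x - b x}" for c
    using openin_continuous_map_preimage[of fineT euclideanreal "\<lambda>x. a x - b x" "{c<..}"] by simp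
  have "openin fineT {x. c < ereal (a x - b x)}" for c
    using op openin_topspace[of fineT] by (cases c) auto
  then have "lower_semicontinuous fineT (\<lambda>x. ereal (a x - b x))"
    by (simp add: lower_semicontinuous_def)
  then have "\<exists>r\<in>W. (\<forall>x. ereal (a x - b x) \<le> r x) \<and> (\<forall>w\<in>?V. \<forall>x. r x \<le> w x)"
    by (intro fine_regularization) auto
  then obtain r where r: "r \<in> W" "\<And>x. ereal (a x - b x) \<le> r x" "\<And>w x. w \<in> ?V \<Longrightarrow> r x \<le> w x"
    by blast
  have "(\<lambda>x. ereal (a x)) \<in> ?V" using assms pots_nonneg by (auto simp: pots_W)
  then have ra: "r x \<le> ereal (a x)" for x using r(3)[of _ x] by blast
  have "\<exists>u'\<in>W. \<exists>u''\<in>W. (\<forall>x. ereal (a x) = u' x + u'' x) \<and> u' \<le> r \<and> u'' \<le> (\<lambda>x. ereal (b x))"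
  proof (rule B3)
    show "ereal (a x) \<le> r x + ereal (b x)" for x
      using r(2)[of x] by (cases "r x") auto
  qed (use assms r(1) pots_W in auto)
  then obtain p' p'' where p: "p' \<in> W" "p'' \<in> W" "\<And>x. ereal (a x) = p' x + p'' x"
    "\<And>x. p' x \<le> r x" "\<And>x. p'' x \<le> ereal (b x)" by (auto simp: le_fun_def)
  have fin: "\<bar>p' x\<bar> \<noteq> \<infinity>" "\<bar>p'' x\<bar> \<noteq> \<infinity>" for x
    using p(3)[of x] positive[OF p(1), of x] positive[OF p(2), of x] by auto
  have "ereal (a y - b y) \<le> p' y" for y
    using p(3)[of y] p(5)[of y] fin[of y] by (cases "p' y"; cases "p'' y") auto
  then have "r x \<le> p' x" for x using r(3)[of p' x] p(1) by blast
  then have rp: "r x = p' x" for x using p(4)[of x] by (auto intro: antisym)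
  define r' where "r' x = real_of_ereal (r x)" for x
  have rr: "r x = ereal (r' x)" for x using fin(1)[of x] by (auto simp: r'_def rp ereal_real)
  define q where "q x = real_of_ereal (p'' x)" for x
  have qq: "p'' x = ereal (q x)" for x using fin(2)[of x] by (auto simp: q_def ereal_real)
  have arq: "a x = r' x + q x" for x using p(3)[of x] by (simp add: rp[symmetric] rr qq)
  have "continuous_on UNIV r'"
  proof (rule continuous_on_if_lsc_split[OF open_UNIV pots_cont[OF assms(1)]])
    show "open {x \<in> UNIV. c < r' x}" for c
      using W_lsc[OF r(1), of "ereal c"] by (simp add: rr)
    show "open {x \<in> UNIV. c < a x - r' x}" for c
      using W_lsc[OF p(2), of "ereal c"] by (simp add: qq arq)
  qed
  moreover have "(\<lambda>x. ereal (r' x)) \<in> W" using r(1) rr by (simp add: rr[symmetric])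
  ultimately have "r' \<in> Wc" by (simp add: Wc_def)
  then have "r' \<in> pots" by (rule pots_majorized[OF assms(1)]) (use ra in \<open>simp add: rr\<close>)
  then show ?thesis
    using ra r(2,3) by (intro that[of r']) (auto simp: rr)
qed

section \<open>Separation of points, bumps and cutoffs made of potentials\<close>

lemma relatively_compact_nbhd:
  assumes "open N" "(x::'a) \<in> N"
  obtains V where "open V" "x \<in> V" "compact (closure V)" "closure V \<subseteq> N"
proof -
  obtain u v where uv: "openin (top_of_set UNIV) u" "compact v" "x \<in> u" "u \<subseteq> v" "v \<subseteq> N"
    using locally_compact assms unfolding locally_def by (metis openin_open_eq openin_subtopology_self open_UNIV subtopology_UNIV open_openin)
  have "closed v" using uv(2) by (rule compact_imp_closed)
  then have "closure u \<subseteq> v" using uv(4) by (rule closure_minimal[rotated])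
  moreover have "compact (closure u)"
    using compact_Int_closed[OF uv(2) closed_closure[of u]]
    unfolding Int_absorb1[OF \<open>closure u \<subseteq> v\<close>] .
  moreover have "open u" using uv(1) by simp
  ultimately show ?thesis using uv(3,5) by (intro that[of u]) auto
qed

text \<open>Otherwise all potentials have the same ratio of values at \<open>x\<close> and
  \<open>y\<close>. Truncation carries this ratio over to \<open>Wc\<close>, axiom (C) carries it to
  all of W, and (S) is violated.\<close>

lemma ex_diff_separating:
  assumes "x \<noteq> y"
  obtains f where "f \<in> pot_diffs" "f x = 1" "f y = -1"
proof -
  obtain u where u: "u \<in> pots" "\<And>x. 0 < u x" using ex_pos_pot by blast
  have "\<exists>p\<in>pots. p x * u y \<noteq> u x * p y"
  proof (rule ccontr)
    assume neg: "\<not> ?thesis"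
    define c where "c = u x / u y"
    have c: "c > 0" using u(2) by (simp add: c_def)
    have pc: "p x = c * p y" if "p \<in> pots" for p
      using neg that u(2)[of y] by (auto simp: c_def field_simps)
    have wc: "w x = c * w y" if "w \<in> Wc" for w
    proof -
      \<comment> \<open>\<open>n\<close> is so large that truncating \<open>w\<close> at
        \<open>n * u\<close> changes it neither at \<open>x\<close> nor at \<open>y\<close>.\<close>
      obtain n where n: "n \<ge> 0" "w x \<le> n * u x" "w y \<le> n * u y"
      proof
        let ?n = "max 0 (max (w x / u x) (w y / u y))"
        show "?n \<ge> 0" by simp
        have "w x / u x \<le> ?n" "w y / u y \<le> ?n" by auto
        then show "w x \<le> ?n * u x" "w y \<le> ?n * u y"
          using u(2)[of x] u(2)[of y] by (simp_all only: pos_divide_le_eq)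
      qed
      have "(\<lambda>z. min (n * u z) (w z)) \<in> pots"
        by (intro pots_min1 pots_scale n u that)
      from pc[OF this] n show ?thesis by simp
    qed
    have vc: "v x = ereal c * v y" if v: "v \<in> W" for v
    proof (rule antisym)
      have le: "w x = ereal c * w y" "w \<le> v \<Longrightarrow> w z \<le> v z" if w: "w \<in> W \<inter> cont_real UNIV" for w z
      proof -
        have "w \<in> W" "w \<in> cont_real UNIV" using w by auto
        from wc[OF cont_real_imp_Wc(1)[OF this]] cont_real_imp_Wc(2)[OF this]
        show "w x = ereal c * w y" by (metis times_ereal.simps(1))
      qed (auto simp: le_fun_def)
      show "v x \<le> ereal c * v y"
      proof (subst B0_C[OF v, of x], rule SUP_least)
        fix w assume w: "w \<in> {w \<in> W \<inter> cont_real UNIV. w \<le> v}"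
        then have "w x = ereal c * w y" using le(1) by blast
        also have "\<dots> \<le> ereal c * v y" using w c by (intro ereal_mult_left_mono) (auto simp: le_fun_def)
        finally show "w x \<le> ereal c * v y" .
      qed
      have "v y \<le> ereal (1/c) * v x"
      proof (subst B0_C[OF v, of y], rule SUP_least)
        fix w assume w: "w \<in> {w \<in> W \<inter> cont_real UNIV. w \<le> v}"
        then have "w x = ereal c * w y" using le(1) by blast
        then have "w y = ereal (1/c) * w x" using c by (simp add: mult.assoc[symmetric] one_ereal_def[symmetric])
        also have "\<dots> \<le> ereal (1/c) * v x" using w c by (intro ereal_mult_left_mono) (auto simp: le_fun_def)
        finally show "w y \<le> ereal (1/c) * v x" .
      qed
      then have "ereal c * v y \<le> ereal c * (ereal (1/c) * v x)" using c by (intro ereal_mult_left_mono) auto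
      also have "\<dots> = v x" using c by (simp add: mult.assoc[symmetric] one_ereal_def[symmetric])
      finally show "ereal c * v y \<le> v x" .
    qed
    then show False using B0_S[OF assms c] by blast
  qed
  then obtain p where p: "p \<in> pots" "p x * u y \<noteq> u x * p y" by blast
  define D where "D = p x * u y - u x * p y"
  have D: "D \<noteq> 0" using p by (simp add: D_def)
  \<comment> \<open>Cramer's rule for the combination of \<open>p\<close> and \<open>u\<close> with
    value 1 at \<open>x\<close> and -1 at \<open>y\<close>; \<open>D\<close> is the
    determinant.\<close>
  let ?f = "\<lambda>z. (u y + u x) / D * p z + - ((p y + p x) / D) * u z"
  have "?f \<in> pot_diffs" by (intro pot_diffs_add pot_diffs_scale pots_diffs p u)
  moreover have "?f x = 1" "?f y = -1"
    using D by (simp_all add: field_simps) (simp_all add: D_def algebra_simps)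
  ultimately show ?thesis by (rule that)
qed

text \<open>A potential is small against \<open>w\<close> at infinity, so subtracting from
  \<open>u\<close> its truncation at \<open>e * w\<close> leaves a function that vanishes off a
  compact set \<open>K\<close>. On the compact rest \<open>K - N\<close>, finitely many separating
  differences, all equal to 1 at \<open>x\<close>, have a negative minimum. The minimum of the two
  functions is the bump.\<close>

lemma ex_diff_bump:
  assumes N: "open N" "x \<in> N"
  obtains f where "f \<in> pot_diffs" "0 < f x" "\<And>y. y \<notin> N \<Longrightarrow> f y \<le> 0"
proof -
  obtain u where u: "u \<in> pots" "\<And>x. 0 < u x" using ex_pos_pot by blast
  then obtain w where w: "w \<in> Wc" "\<And>x. 0 < w x"
    and van: "\<And>e. e > 0 \<Longrightarrow> \<exists>K. compact K \<and> (\<forall>x. x \<notin> K \<longrightarrow> u x \<le> e * w x)"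
    by (auto simp: pots_def)
  \<comment> \<open>Half the ratio of \<open>u\<close> and \<open>w\<close> at \<open>x\<close>, so
    that \<open>f0\<close> is positive there.\<close>
  define e where "e = u x / (2 * w x)"
  have e: "e > 0" using u(2) w(2) by (simp add: e_def)
  have ex: "e * w x < u x" using u(2)[of x] w(2)[of x] by (simp add: e_def)
  obtain K where K: "compact K" "\<And>y. y \<notin> K \<Longrightarrow> u y \<le> e * w y" using van[OF e] by blast
  define f0 where "f0 = (\<lambda>y. u y - min (u y) (e * w y))"
  have f0: "f0 \<in> pot_diffs" unfolding f0_def
    by (intro pot_diffsI pots_min1 u Wc_scale w less_imp_le[OF e])
  have f0x: "0 < f0 x" using ex by (simp add: f0_def)
  have f0K: "f0 y = 0" if "y \<notin> K" for y using K(2)[OF that] by (simp add: f0_def)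
  have "\<forall>y\<in>K - N. \<exists>f\<in>pot_diffs. f x = 1 \<and> f y = -1"
    using ex_diff_separating[of x] N(2) by (metis DiffD2)
  then obtain F where F: "\<And>y. y \<in> K - N \<Longrightarrow> F y \<in> pot_diffs \<and> F y x = 1 \<and> F y y = -1" by metis
  have cpt: "compact (K - N)" using K(1) N(1) by (rule compact_diff)
  have op: "open {z. F y z < 0}" if "y \<in> K - N" for y
    using F[OF that] by (intro open_Collect_less continuous_on_const pot_diffs_cont) auto
  obtain C where C: "C \<subseteq> K - N" "finite C" "K - N \<subseteq> (\<Union>y\<in>C. {z. F y z < 0})"
    using compactE_image[OF cpt, of "K - N" "\<lambda>y. {z. F y z < 0}"] op F by force
  show ?thesis
  proof (cases "C = {}")
    case True
    then have "K \<subseteq> N" using C(3) by auto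
    then have "f0 y \<le> 0" if "y \<notin> N" for y using f0K[of y] that by (metis subsetD order_refl)
    then show ?thesis using f0 f0x by (intro that[of f0]) auto
  next
    case False
    obtain g where g: "g \<in> pot_diffs" "\<And>i z. i \<in> C \<Longrightarrow> g z \<le> F i z" "\<And>z. \<exists>i\<in>C. g z = F i z"
      using pot_diffs_Min[OF C(2) False, of F] F C(1) by blast
    have "g x = 1" using g(3)[of x] F C(1) by force
    moreover have "g y < 0" if y: "y \<in> K - N" for y
    proof -
      obtain i where "i \<in> C" "F i y < 0" using C(3) y by blast
      then show ?thesis using g(2)[of i y] by simp
    qed
    ultimately show ?thesis
      using f0x f0K by (intro that[OF pot_diffs_min[OF f0 g(1)]]) (auto simp: min_le_iff_disj intro: less_imp_le eq_refl)
  qed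
qed

text \<open>The fine topology is generated by W alone. It refines the given topology because the
  sets where a bump a - b is positive are finely open.\<close>

lemma open_fine_open: assumes "open N" shows "openin fineT N"
proof (subst openin_subopen, intro ballI)
  fix x assume "x \<in> N"
  then obtain f where f: "f \<in> pot_diffs" "0 < f x" "\<And>y. y \<notin> N \<Longrightarrow> f y \<le> 0"
    using ex_diff_bump assms by metis
  obtain a b where ab: "a \<in> pots" "b \<in> pots" "f = (\<lambda>x. a x - b x)" using f(1) by (auto simp: pot_diffs_def)
  have "{y. ereal (b y) < ereal (a y)} \<subseteq> N" using f(3) unfolding ab(3) by (force simp: not_le)
  moreover have "openin fineT {y. ereal (b y) < ereal (a y)}"
    by (rule fine_open_less_fun[OF pots_W Wc_fine_cont[OF pots_Wc]]) (rule ab)+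
  ultimately show "\<exists>T. openin fineT T \<and> x \<in> T \<and> T \<subseteq> N" using f(2) ab(3) by auto
qed

text \<open>A Urysohn function inside \<open>pot_diffs\<close>: the maximum \<open>g\<close> of
  finitely many bumps is positive on \<open>K\<close> and at most 0 off \<open>G\<close>, a multiple
  of it dominates \<open>p\<close> on the compact set \<open>K\<close>, and truncation between 0 and
  \<open>p\<close> yields the cutoff.\<close>

lemma ex_diff_cutoff:
  assumes K: "compact K" "K \<subseteq> G" "open G" and p: "p \<in> pots"
  obtains f where "f \<in> pot_diffs" "\<And>x. 0 \<le> f x" "\<And>x. f x \<le> p x"
    "\<And>x. x \<in> K \<Longrightarrow> f x = p x" "\<And>x. x \<notin> G \<Longrightarrow> f x = 0"
proof (cases "K = {}")
  case True
  then show ?thesis using pots_nonneg[OF p] by (intro that[OF pots_diffs[OF zero_pots]]) auto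
next
  case ne: False
  have "\<forall>y\<in>K. \<exists>f\<in>pot_diffs. f y > 0 \<and> (\<forall>z. z \<notin> G \<longrightarrow> f z \<le> 0)"
    using ex_diff_bump[OF K(3)] K(2) by (metis subsetD)
  then obtain F where F: "\<And>y. y \<in> K \<Longrightarrow> F y \<in> pot_diffs \<and> F y y > 0 \<and> (\<forall>z. z \<notin> G \<longrightarrow> F y z \<le> 0)" by metis
  have op: "open {z. 0 < F y z}" if "y \<in> K" for y
    using F[OF that] by (intro open_Collect_less continuous_on_const pot_diffs_cont) auto
  obtain C where C: "C \<subseteq> K" "finite C" "K \<subseteq> (\<Union>y\<in>C. {z. 0 < F y z})"
    using compactE_image[OF K(1), of K "\<lambda>y. {z. 0 < F y z}"] op F by force
  have "C \<noteq> {}" using C ne by auto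
  have "\<And>i. i \<in> C \<Longrightarrow> (\<lambda>z. - F i z) \<in> pot_diffs" using F C(1) pot_diffs_minus by blast
  from pot_diffs_Min[OF C(2) \<open>C \<noteq> {}\<close>, of "\<lambda>i z. - F i z", OF this]
  obtain h where h: "h \<in> pot_diffs" "\<And>i z. i \<in> C \<Longrightarrow> h z \<le> - F i z" "\<And>z. \<exists>i\<in>C. h z = - F i z" by blast
  define g where "g = (\<lambda>z. - h z)"
  have g: "g \<in> pot_diffs" unfolding g_def by (rule pot_diffs_minus[OF h(1)])
  have gG: "g z \<le> 0" if "z \<notin> G" for z using h(3)[of z] F C(1) that by (force simp: g_def)
  have gK: "g z > 0" if z: "z \<in> K" for z
  proof -
    obtain i where "i \<in> C" "0 < F i z" using C(3) z by blast
    then show ?thesis using h(2)[of i z] by (simp add: g_def)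
  qed
  have "continuous_on K (\<lambda>z. p z / g z)"
    using gK continuous_on_subset[OF pots_cont[OF p] subset_UNIV] continuous_on_subset[OF pot_diffs_cont[OF g] subset_UNIV]
    by (intro continuous_on_divide) force+
  from continuous_attains_sup[OF K(1) ne this]
  obtain M0 where M0: "\<And>z. z \<in> K \<Longrightarrow> p z / g z \<le> M0" by blast
  define M where "M = max 0 M0"
  have M: "p z \<le> M * g z" if "z \<in> K" for z
  proof -
    have "p z / g z \<le> M" using M0[OF that] by (simp add: M_def)
    then show ?thesis using gK[OF that] by (simp add: pos_divide_le_eq)
  qed
  have M_nonneg: "0 \<le> M" by (simp add: M_def)
  let ?f = "\<lambda>z. max 0 (min (p z) (M * g z))"
  show ?thesis
  proof (rule that[of ?f])
    show "?f \<in> pot_diffs" by (intro pot_diffs_max pot_diffs_min pot_diffs_scale g pots_diffs zero_pots p)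
    show "?f z \<le> p z" for z using pots_nonneg[OF p, of z] by simp
    show "?f z = p z" if "z \<in> K" for z using M[OF that] pots_nonneg[OF p, of z] by simp
    show "?f z = 0" if "z \<notin> G" for z
      using mult_left_mono[OF gG[OF that] M_nonneg] by simp
  qed simp
qed

text \<open>Each level below \<open>g x\<close> is surpassed at \<open>x\<close> by a truncated bump
  that stays below \<open>g\<close>. Second countability reduces the family of these minorants to a
  sequence, and running maxima make the sequence increasing.\<close>

lemma lsc_eq_SUP_diffs:
  fixes g :: "'a \<Rightarrow> ereal"
  assumes nonneg: "\<And>x. 0 \<le> g x" and lsc: "\<And>c. open {x. ereal c < g x}"
  obtains \<phi> where "\<And>n. \<phi> n \<in> pot_diffs" "\<And>n x. 0 \<le> \<phi> n x" "incseq \<phi>"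
    "\<And>x. g x = (SUP n. ereal (\<phi> n x))"
proof -
  define \<Phi> where "\<Phi> = {f \<in> pot_diffs. \<forall>x. 0 \<le> f x \<and> ereal (f x) \<le> g x}"
  have zero: "(\<lambda>x. 0) \<in> \<Phi>" using nonneg pots_diffs[OF zero_pots] by (simp add: \<Phi>_def zero_ereal_def)
  have ex: "\<exists>f\<in>\<Phi>. c < f x" if c: "0 \<le> c" "ereal c < g x" for c x
  proof -
    obtain c1 where c1: "c < c1" "ereal c1 < g x" using c(2) ereal_dense2 by (metis ereal_less(2) less_ereal.simps(1))
    obtain u where u: "u \<in> pots" "\<And>x. 0 < u x" using ex_pos_pot by blast
    \<comment> \<open>At \<open>x\<close>, \<open>m * u\<close> takes the midpoint of
      \<open>c\<close> and \<open>c1\<close>. It thus exceeds the level to be reached, and near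
      \<open>x\<close> it stays below \<open>c1\<close>, which in turn is below
      \<open>g\<close>.\<close>
    define m where "m = (c + c1) / 2 / u x"
    have mu: "c < m * u x" "m * u x < c1" "0 \<le> m"
      using c(1) c1(1) u(2)[of x] by (auto simp: m_def field_simps)
    let ?N = "{y. m * u y < c1} \<inter> {y. ereal c1 < g y}"
    have "open ?N"
      by (intro open_Int lsc open_Collect_less continuous_on_const continuous_on_mult pots_cont u)
    moreover have "x \<in> ?N" using mu c1 by auto
    ultimately obtain f where f: "f \<in> pot_diffs" "0 < f x" "\<And>y. y \<notin> ?N \<Longrightarrow> f y \<le> 0"
      using ex_diff_bump by blast
    define k where "k = m * u x / f x"
    have k: "0 \<le> k" "k * f x = m * u x" using f(2) mu(3) less_imp_le[OF u(2)[of x]] by (auto simp: k_def)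
    let ?f = "\<lambda>y. max 0 (min (k * f y) (m * u y))"
    have "?f \<in> pot_diffs" by (intro pot_diffs_max pot_diffs_min pot_diffs_scale f u pots_diffs zero_pots)
    moreover have "ereal (?f y) \<le> g y" for y
    proof (cases "y \<in> ?N")
      case True
      then have "m * u y < c1" "ereal c1 < g y" by auto
      then have "?f y \<le> c1" using c(1) c1(1) by linarith
      then have "ereal (?f y) \<le> ereal c1" by (simp only: ereal_less_eq)
      then show ?thesis using \<open>ereal c1 < g y\<close> by order
    next
      case False
      then have "k * f y \<le> 0" using mult_left_mono[OF f(3)[OF False] k(1)] by simp
      then have "?f y = 0" by simp
      then show ?thesis using nonneg[of y] by (simp add: zero_ereal_def)
    qed
    moreover have "c < ?f x" using k(2) mu(1) by simp
    ultimately show ?thesis unfolding \<Phi>_def by (intro bexI[of _ ?f]) auto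
  qed
  \<comment> \<open>Lindelof at each level: countably many minorants have the same union of
    superlevel sets as all of them. Only rational levels are kept in \<open>E\<close>.\<close>
  have "\<exists>\<Psi>. \<Psi> \<subseteq> \<Phi> \<and> countable \<Psi> \<and> (\<Union>f\<in>\<Psi>. {y. c < f y}) = (\<Union>f\<in>\<Phi>. {y. c < f y})" for c
  proof -
    let ?F = "(\<lambda>f. {y. c < f y}) ` \<Phi>"
    have "\<And>S. S \<in> ?F \<Longrightarrow> openin (top_of_set UNIV) S"
      by (auto simp: \<Phi>_def intro!: open_Collect_less continuous_on_const pot_diffs_cont)
    then obtain F' where F': "F' \<subseteq> ?F" "countable F'" "\<Union>F' = \<Union>?F" by (rule Lindelof_openin)
    then obtain \<Psi> where "\<Psi> \<subseteq> \<Phi>" "countable \<Psi>" "F' = (\<lambda>f. {y. c < f y}) ` \<Psi>"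
      using countable_subset_image[of F' "\<lambda>f. {y. c < f y}" \<Phi>] by blast
    then show ?thesis using F'(3) by (intro exI[of _ \<Psi>]) simp
  qed
  then obtain \<Psi> where \<Psi>: "\<And>c. \<Psi> c \<subseteq> \<Phi>" "\<And>c. countable (\<Psi> c)"
    "\<And>c. (\<Union>f\<in>\<Psi> c. {y. c < f y}) = (\<Union>f\<in>\<Phi>. {y. c < f y})" by metis
  define E where "E = insert (\<lambda>x. 0) (\<Union>c\<in>\<rat>. \<Psi> c)"
  have E: "countable E" "E \<noteq> {}" "E \<subseteq> \<Phi>"
    using \<Psi>(1,2) zero countable_rat by (auto simp: E_def)
  define e where "e = from_nat_into E"
  have e: "range e = E" unfolding e_def by (rule range_from_nat_into[OF E(2,1)])
  define \<phi> where "\<phi> = rec_nat (e 0) (\<lambda>n f x. max (f x) (e (Suc n) x))"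
  have \<phi>0: "\<phi> 0 = e 0" and \<phi>S: "\<phi> (Suc n) = (\<lambda>x. max (\<phi> n x) (e (Suc n) x))" for n
    by (simp_all add: \<phi>_def)
  have e\<Phi>: "e n \<in> \<Phi>" for n using e E(3) by blast
  have \<phi>\<Phi>: "\<phi> n \<in> \<Phi>" for n
  proof (induction n)
    case 0
    then show ?case using e\<Phi> by (simp add: \<phi>0)
  next
    case (Suc n)
    then show ?case using e\<Phi>[of "Suc n"] unfolding \<Phi>_def
      by (auto simp: \<phi>S max_def intro!: pot_diffs_max[unfolded max_def])
  qed
  have le: "e n x \<le> \<phi> n x" for n x by (cases n) (auto simp: \<phi>0 \<phi>S)
  show ?thesis
  proof (rule that)
    show "\<phi> n \<in> pot_diffs" "0 \<le> \<phi> n x" for n x using \<phi>\<Phi>[of n] by (auto simp: \<Phi>_def)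
    show "incseq \<phi>" by (rule incseq_SucI) (auto simp: \<phi>S le_fun_def)
    show "g x = (SUP n. ereal (\<phi> n x))" for x
    proof (rule antisym)
      show "(SUP n. ereal (\<phi> n x)) \<le> g x" using \<phi>\<Phi> by (auto simp: \<Phi>_def intro: SUP_least)
      show "g x \<le> (SUP n. ereal (\<phi> n x))"
      proof (rule ccontr)
        assume "\<not> ?thesis"
        then have lt: "(SUP n. ereal (\<phi> n x)) < g x" by simp
        then obtain c where c: "(SUP n. ereal (\<phi> n x)) < ereal (real_of_rat c)" "ereal (real_of_rat c) < g x"
          using ereal_dense3 by blast
        have "0 \<le> ereal (\<phi> 0 x)" using \<phi>\<Phi>[of 0] by (auto simp: \<Phi>_def)
        also have "\<dots> \<le> (SUP n. ereal (\<phi> n x))" by (rule SUP_upper) simp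
        finally have "0 \<le> real_of_rat c" using c(1) by (metis ereal_less_eq(5) order.strict_implies_order order.trans)
        from ex[OF this c(2)] have "x \<in> (\<Union>f\<in>\<Psi> (real_of_rat c). {y. real_of_rat c < f y})"
          unfolding \<Psi>(3) by blast
        then obtain f where f: "f \<in> \<Psi> (real_of_rat c)" "real_of_rat c < f x" by blast
        then have "f \<in> E" by (auto simp: E_def)
        then obtain n where "f = e n" using e by blast
        then have "ereal (real_of_rat c) \<le> ereal (\<phi> n x)" using f(2) le[of n x] by simp
        also have "\<dots> \<le> (SUP n. ereal (\<phi> n x))" by (rule SUP_upper) simp
        finally show False using c(1) by simp
      qed
    qed
  qed
qed

section \<open>Least majorants in W and a membership test\<close>

definition reduced :: "('a \<Rightarrow> real) \<Rightarrow> ('a \<Rightarrow> real) \<Rightarrow> bool"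
  where "reduced f r \<longleftrightarrow> r \<in> pots \<and> (\<forall>x. f x \<le> r x) \<and>
    (\<forall>w\<in>W. (\<forall>y. ereal (f y) \<le> w y) \<longrightarrow> (\<forall>x. ereal (r x) \<le> w x))"

lemma reducedD:
  assumes "reduced f r"
  shows "r \<in> pots" "f x \<le> r x"
    "w \<in> W \<Longrightarrow> (\<And>y. ereal (f y) \<le> w y) \<Longrightarrow> ereal (r x) \<le> w x"
  using assms by (auto simp: reduced_def)

lemma ex_reduced_diff: "f \<in> pot_diffs \<Longrightarrow> \<exists>r. reduced f r"
proof -
  assume "f \<in> pot_diffs"
  then obtain a b where f: "a \<in> pots" "b \<in> pots" "f = (\<lambda>x. a x - b x)" by (auto simp: pot_diffs_def)
  show ?thesis
    by (rule ex_reduced[OF f(1,2)]) (auto simp: reduced_def f(3))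
qed

lemma reduced_mono:
  assumes "reduced f r" "reduced g q" "\<And>x. f x \<le> g x"
  shows "r x \<le> q x"
proof -
  have "ereal (r x) \<le> ereal (q x)"
    using reducedD(3)[OF assms(1) pots_W[OF reducedD(1)[OF assms(2)]]]
      order_trans[OF assms(3) reducedD(2)[OF assms(2)]] by simp
  then show ?thesis by simp
qed

text \<open>Replacing the differences that increase to \<open>g\<close> by their least majorants
  does not change the supremum, as \<open>red\<close> keeps these below \<open>g\<close>; and it
  yields members of W, as (B1) requires.\<close>

lemma SUP_reduced:
  fixes g :: "'a \<Rightarrow> ereal"
  assumes nonneg: "\<And>x. 0 \<le> g x" and lsc: "\<And>c. open {x. ereal c < g x}"
    and red: "\<forall>f\<in>pot_diffs. \<forall>r. (\<forall>y. ereal (f y) \<le> g y) \<longrightarrow> reduced f r \<longrightarrow> (\<forall>x. ereal (r x) \<le> g x)"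
  obtains r where "\<And>n. r n \<in> pots" "incseq r" "\<And>x. g x = (SUP n. ereal (r n x))"
proof -
  obtain \<phi> where \<phi>: "\<And>n. \<phi> n \<in> pot_diffs" "\<And>n x. 0 \<le> \<phi> n x" "incseq \<phi>"
    "\<And>x. g x = (SUP n. ereal (\<phi> n x))" by (rule lsc_eq_SUP_diffs[OF nonneg lsc]) blast
  obtain r where r: "\<And>n. reduced (\<phi> n) (r n)" using ex_reduced_diff[OF \<phi>(1)] by metis
  have \<phi>g: "ereal (\<phi> n x) \<le> g x" for n x unfolding \<phi>(4) by (rule SUP_upper) simp
  show ?thesis
  proof (rule that)
    show "r n \<in> pots" for n by (rule reducedD(1)[OF r])
    show "incseq r"
      using reduced_mono[OF r r] \<phi>(3) by (simp add: incseq_def le_fun_def)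
    show "g x = (SUP n. ereal (r n x))" for x
    proof (rule antisym)
      show "g x \<le> (SUP n. ereal (r n x))"
        unfolding \<phi>(4) by (rule SUP_mono) (use reducedD(2)[OF r] in auto)
      show "(SUP n. ereal (r n x)) \<le> g x"
        using red \<phi>(1) \<phi>g r by (intro SUP_least) blast
    qed
  qed
qed

text \<open>The axioms offer closure properties only. This test lets a function be recognized as a
  member of W by a minimum principle, as is done for the glued functions below.\<close>

lemma W_if_reduced:
  fixes g :: "'a \<Rightarrow> ereal"
  assumes "\<And>x. 0 \<le> g x" "\<And>c. open {x. ereal c < g x}"
    and "\<forall>f\<in>pot_diffs. \<forall>r. (\<forall>y. ereal (f y) \<le> g y) \<longrightarrow> reduced f r \<longrightarrow> (\<forall>x. ereal (r x) \<le> g x)"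
  shows "g \<in> W"
proof -
  obtain r where r: "\<And>n. r n \<in> pots" "incseq r" "\<And>x. g x = (SUP n. ereal (r n x))"
    by (rule SUP_reduced[OF assms]) (rule that)
  have W: "(\<lambda>x. SUP n. ereal (r n x)) \<in> W"
    using r(2) by (intro B1[of "\<lambda>n x. ereal (r n x)"] pots_W r) (auto simp: incseq_def le_fun_def)
  have "g = (\<lambda>x. SUP n. ereal (r n x))" by (rule ext) (rule r(3))
  from ssubst[OF this, of "\<lambda>f. f \<in> W", OF W] show ?thesis .
qed

lemma W_eq_SUP_pots:
  assumes "w \<in> W"
  obtains r where "\<And>n. r n \<in> pots" "incseq r" "\<And>x. w x = (SUP n. ereal (r n x))"
proof (rule SUP_reduced[of w])
  show "0 \<le> w x" for x by (rule positive[OF assms])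
  show "open {x. ereal c < w x}" for c by (rule W_lsc[OF assms])
  show "\<forall>f\<in>pot_diffs. \<forall>r. (\<forall>y. ereal (f y) \<le> w y) \<longrightarrow> reduced f r \<longrightarrow> (\<forall>x. ereal (r x) \<le> w x)"
    using reducedD(3)[OF _ assms] by blast
qed (rule that)

text \<open>If \<open>v \<ge> r\<close> holds where \<open>r\<close> almost touches \<open>f = a - b\<close>, then
  \<open>(1 - \<epsilon>) r + \<epsilon> min r v\<close> is still a majorant of \<open>f\<close>.\<close>

lemma reduced_le_if_le_on_contact:
  assumes f: "f = (\<lambda>x. a x - b x)" "a \<in> pots" "b \<in> pots" and r: "reduced f r"
    and e: "0 < e" "e \<le> 1" and v: "v \<in> W" "\<And>y. r y \<le> f y + e * a y \<Longrightarrow> ereal (r y) \<le> v y"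
  shows "ereal (r x) \<le> v x"
proof -
  have "ereal (r y) \<le> ereal (a y)" for y
    by (rule reducedD(3)[OF r]) (use f pots_nonneg in \<open>auto simp: pots_W\<close>)
  then have ra: "r y \<le> a y" for y by simp
  define m where "m y = real_of_ereal (min (ereal (r y)) (v y))" for y
  have em: "ereal (m y) = min (ereal (r y)) (v y)" for y
    using positive[OF v(1), of y] by (cases "v y") (auto simp: m_def min_def)
  have mr: "m y \<le> r y" for y by (metis em ereal_less_eq(3) min.cobounded1)
  have mW: "(\<lambda>y. ereal (m y)) \<in> W"
    unfolding em by (intro min_W pots_W reducedD(1)[OF r] v)
  have m_nonneg: "0 \<le> m y" for y using positive[OF mW, of y] by simp
  have "(\<lambda>y. ereal (1 - e) * ereal (r y) + ereal e * ereal (m y)) \<in> W"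
    using e by (intro cone_add cone_scale mW pots_W reducedD(1)[OF r]) auto
  then have W: "(\<lambda>y. ereal ((1 - e) * r y + e * m y)) \<in> W" by simp
  have "f y \<le> (1 - e) * r y + e * m y" for y
  proof (cases "r y \<le> f y + e * a y")
    case True
    then have "m y = r y" using v(2)[of y] em[of y] by (simp add: min_def)
    then show ?thesis using reducedD(2)[OF r, of y] by (simp add: algebra_simps)
  next
    case False
    have "e * r y \<le> e * a y" using ra[of y] e by simp
    moreover have "0 \<le> e * m y" using e m_nonneg by simp
    ultimately show ?thesis using False by (simp add: algebra_simps)
  qed
  then have "ereal (r x) \<le> ereal ((1 - e) * r x + e * m x)" using reducedD(3)[OF r W] by simp
  then have "e * r x \<le> e * m x" by (simp add: algebra_simps)
  then have "r x \<le> m x" using e by simp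
  then have "ereal (r x) \<le> ereal (m x)" by simp
  also have "\<dots> \<le> v x" unfolding em by simp
  finally show ?thesis .
qed

end

section \<open>Harmonic kernels\<close>

lemma tendsto_if_ereal_SUP:
  fixes f :: "nat \<Rightarrow> 'a \<Rightarrow> real"
  assumes "incseq f" "ereal (g x) = (SUP n. ereal (f n x))"
  shows "(\<lambda>n. f n x) \<longlonglongrightarrow> g x"
proof -
  have "incseq (\<lambda>n. ereal (f n x))" using assms(1) by (auto simp: incseq_def le_fun_def)
  from LIMSEQ_SUP[OF this] show ?thesis unfolding assms(2)[symmetric] by simp
qed

lemma nn_integral_ennreal_SUP:
  fixes f :: "nat \<Rightarrow> 'a \<Rightarrow> real"
  assumes [measurable]: "\<And>n. f n \<in> borel_measurable M"
    and inc: "incseq f" and lim: "\<And>x. (\<lambda>n. f n x) \<longlonglongrightarrow> g x"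
  shows "(\<integral>\<^sup>+x. ennreal (g x) \<partial>M) = (SUP n. \<integral>\<^sup>+x. ennreal (f n x) \<partial>M)"
proof -
  have incx: "incseq (\<lambda>n. ennreal (f n x))" for x
    using inc by (auto simp: incseq_def le_fun_def intro!: ennreal_leI)
  have "ennreal (g x) = (SUP n. ennreal (f n x))" for x
    using LIMSEQ_unique[OF tendsto_ennrealI[OF lim] LIMSEQ_SUP[OF incx]] .
  then have "(\<integral>\<^sup>+x. ennreal (g x) \<partial>M) = (\<integral>\<^sup>+x. (SUP n. ennreal (f n x)) \<partial>M)" by simp
  also have "\<dots> = (SUP n. \<integral>\<^sup>+x. ennreal (f n x) \<partial>M)"
    by (rule nn_integral_monotone_convergence_SUP)
      (use inc in \<open>auto simp: incseq_def le_fun_def intro!: ennreal_leI\<close>)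
  finally show ?thesis .
qed

locale harmonic_kernels = balayage_space W
  for W :: "('a::{t2_space, second_countable_topology} \<Rightarrow> ereal) set" +
  fixes H :: "'a set \<Rightarrow> 'a \<Rightarrow> 'a measure"
  assumes kernel: "\<And>V. open V \<Longrightarrow> is_harmonic_kernel W V (H V)"
begin

abbreviation hint :: "'a set \<Rightarrow> ('a \<Rightarrow> real) \<Rightarrow> 'a \<Rightarrow> ennreal"
  where "hint V f x \<equiv> \<integral>\<^sup>+y. ennreal (f y) \<partial>H V x"

lemma sets_H [simp, measurable_cong]: "open V \<Longrightarrow> sets (H V x) = sets borel"
  using kernel by (auto simp: is_harmonic_kernel_def borel_kernel_def)

lemma space_H [simp]: "open V \<Longrightarrow> space (H V x) = UNIV"
  using sets_eq_imp_space_eq[OF sets_H] by simp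

lemma measurable_H [simp]: "open V \<Longrightarrow> measurable (H V x) N = measurable borel N"
  by (rule measurable_cong_sets) simp_all

lemma emeasure_H_measurable:
  "open V \<Longrightarrow> A \<in> sets borel \<Longrightarrow> (\<lambda>x. emeasure (H V x) A) \<in> borel_measurable borel"
  using kernel by (auto simp: is_harmonic_kernel_def borel_kernel_def)

lemma Wc_measurable: "w \<in> Wc \<Longrightarrow> w \<in> borel_measurable borel"
  by (rule borel_measurable_continuous_onI[OF Wc_cont])

lemma pot_diffs_measurable: "f \<in> pot_diffs \<Longrightarrow> f \<in> borel_measurable borel"
  by (rule borel_measurable_continuous_onI[OF pot_diffs_cont])

lemma nn_integral_H_measurable:
  assumes V: "open V" and "f \<in> borel_measurable borel"
  shows "(\<lambda>x. \<integral>\<^sup>+y. f y \<partial>H V x) \<in> borel_measurable borel"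
  using assms(2)
proof (induction rule: borel_measurable_induct)
  case (cong f g)
  then have "f = g" by (auto simp: fun_eq_iff)
  with cong show ?case by simp
next
  case (set A)
  then show ?case using emeasure_H_measurable[OF V] by (simp add: V nn_integral_indicator)
next
  case (mult u c)
  then show ?case by (simp add: V nn_integral_cmult)
next
  case (add u v)
  then show ?case by (simp add: V nn_integral_add)
next
  case (seq U)
  have "(\<integral>\<^sup>+y. (SUP i. U i) y \<partial>H V x) = (SUP i. \<integral>\<^sup>+y. U i y \<partial>H V x)" for x
    using nn_integral_monotone_convergence_SUP[of U "H V x"] seq V by (simp add: image_image)
  then show ?case using seq by simp
qed

lemma hint_eq_INF:
  assumes "open V" "p \<in> pots"
  shows "enn2ereal (hint V p x) = (INF w\<in>{w \<in> W. \<forall>y\<in>- V. ereal (p y) \<le> w y}. w x)"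
proof -
  have "has_numerical_integral (H V x) (\<lambda>y. ereal (p y)) (INF w\<in>{w \<in> W. \<forall>y\<in>- V. ereal (p y) \<le> w y}. w x)"
    using kernel[OF assms(1)] pots_cont_potentials[OF assms(2)] by (auto simp: is_harmonic_kernel_def)
  moreover have "e2ennreal (- ereal (p y)) = 0" for y
    using pots_nonneg[OF assms(2), of y] by (intro e2ennreal_neg) simp
  ultimately show ?thesis
    by (simp add: has_numerical_integral_def ennreal.abs_eq[symmetric] e2ennreal_ereal zero_ennreal.rep_eq)
qed

lemma hint_le:
  assumes "open V" "p \<in> pots" "w \<in> W" "\<And>y. y \<notin> V \<Longrightarrow> ereal (p y) \<le> w y"
  shows "enn2ereal (hint V p x) \<le> w x"
  unfolding hint_eq_INF[OF assms(1,2)] using assms(3,4) by (auto intro!: INF_lower)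

lemma le_hint:
  assumes "open V" "p \<in> pots"
    and "\<And>w. w \<in> W \<Longrightarrow> (\<And>y. y \<notin> V \<Longrightarrow> ereal (p y) \<le> w y) \<Longrightarrow> c \<le> w x"
  shows "c \<le> enn2ereal (hint V p x)"
  unfolding hint_eq_INF[OF assms(1,2)] using assms(3) by (auto intro!: INF_greatest)

lemma le_hint_real:
  assumes "open V" "p \<in> pots"
    and "\<And>w. w \<in> W \<Longrightarrow> (\<And>y. y \<notin> V \<Longrightarrow> ereal (p y) \<le> w y) \<Longrightarrow> ereal c \<le> w x"
  shows "ennreal c \<le> hint V p x"
proof (cases "0 \<le> c")
  case True
  have "ereal c \<le> enn2ereal (hint V p x)" by (rule le_hint[OF assms(1,2)]) (rule assms(3))
  then show ?thesis using True by (simp add: less_eq_ennreal.rep_eq enn2ereal_ennreal)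
qed (simp add: ennreal_neg)

lemma hint_le_real:
  assumes "open V" "p \<in> pots" "w \<in> Wc" "\<And>y. y \<notin> V \<Longrightarrow> p y \<le> w y"
  shows "hint V p x \<le> ennreal (w x)"
  using hint_le[OF assms(1,2) Wc_W[OF assms(3)]] assms(4) Wc_nonneg[OF assms(3)]
  by (simp add: less_eq_ennreal.rep_eq enn2ereal_ennreal)

text \<open>The infimum formula speaks of potentials, and \<open>s\<close> need not be one. It is
  applied to potentials increasing to \<open>s\<close>, for each of which \<open>s\<close> is a
  competitor.\<close>

lemma hint_Wc_le:
  assumes V: "open V" and s: "s \<in> Wc" shows "hint V s x \<le> ennreal (s x)"
proof -
  obtain r where r: "\<And>n. r n \<in> pots" "incseq r" "\<And>x. ereal (s x) = (SUP n. ereal (r n x))"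
    by (rule W_eq_SUP_pots[OF Wc_W[OF s]]) (rule that)
  have lim: "(\<lambda>n. r n y) \<longlonglongrightarrow> s y" for y by (rule tendsto_if_ereal_SUP[OF r(2,3)])
  have "r n y \<le> s y" for n y
    using incseq_le[OF _ lim[of y]] r(2) by (auto simp: incseq_def le_fun_def)
  then have "hint V (r n) x \<le> ennreal (s x)" for n
    by (intro hint_le_real[OF V r(1) s])
  moreover have "hint V s x = (SUP n. hint V (r n) x)"
    by (rule nn_integral_ennreal_SUP[OF _ r(2) lim]) (simp add: V Wc_measurable pots_Wc r(1))
  ultimately show ?thesis by (simp add: SUP_le_iff)
qed

lemma hint_finite: "open V \<Longrightarrow> s \<in> Wc \<Longrightarrow> hint V s x < \<infinity>"
  using hint_Wc_le[of V s x] by (metis ennreal_less_top infinity_ennreal_def order.strict_trans1)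

lemma hint_cong_outside:
  assumes "open V" "a \<in> pots" "b \<in> pots" "\<And>y. y \<notin> V \<Longrightarrow> a y = b y"
  shows "hint V a x = hint V b x"
  unfolding enn2ereal_inject[symmetric] hint_eq_INF[OF assms(1,2)] hint_eq_INF[OF assms(1,3)]
  using assms(4) by (intro INF_cong) auto

text \<open>The infimum defining \<open>H V\<close> sees a potential only off \<open>V\<close>, so
  potentials that agree there have equal integrals. The function equal to \<open>u\<close> on
  \<open>V\<close> and to 0 elsewhere is an increasing limit of differences a - b with a = b off
  \<open>V\<close>, hence has integral 0.\<close>

lemma AE_H_outside:
  assumes V: "open V" shows "AE y in H V x. y \<notin> V"
proof -
  obtain u where u: "u \<in> pots" "\<And>x. 0 < u x" using ex_pos_pot by blast
  define g where "g y = (if y \<in> V then u y else 0)" for y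
  have "open {y. ereal c < ereal (g y)}" for c
  proof (cases "c < 0")
    case True
    then have "{y. ereal c < ereal (g y)} = UNIV" using less_imp_le[OF u(2)] by (auto simp: g_def intro: less_le_trans)
    then show ?thesis by simp
  next
    case False
    then have "{y. ereal c < ereal (g y)} = V \<inter> {y. c < u y}" by (auto simp: g_def)
    then show ?thesis using V by (auto intro!: open_Int open_Collect_less continuous_on_const pots_cont u)
  qed
  then obtain \<phi> where \<phi>: "\<And>n. \<phi> n \<in> pot_diffs" "\<And>n x. 0 \<le> \<phi> n x" "incseq \<phi>"
    "\<And>y. ereal (g y) = (SUP n. ereal (\<phi> n y))"
    by (rule lsc_eq_SUP_diffs[rotated]) (auto simp: g_def less_imp_le u(2) intro: that)
  have "hint V (\<phi> n) x = 0" for n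
  proof -
    obtain a b where ab: "a \<in> pots" "b \<in> pots" "\<phi> n = (\<lambda>x. a x - b x)" using \<phi>(1)[of n] by (auto simp: pot_diffs_def)
    have "a y = b y" if "y \<notin> V" for y
    proof -
      have "ereal (\<phi> n y) \<le> ereal (g y)" unfolding \<phi>(4) by (rule SUP_upper) simp
      then show ?thesis using \<phi>(2)[of n y] that by (simp add: g_def ab(3))
    qed
    then have eq: "hint V a x = hint V b x" by (rule hint_cong_outside[OF V ab(1,2)])
    have "hint V a x = (\<integral>\<^sup>+y. ennreal (\<phi> n y) + ennreal (b y) \<partial>H V x)"
    proof (rule nn_integral_cong)
      fix y show "ennreal (a y) = ennreal (\<phi> n y) + ennreal (b y)"
        using \<phi>(2)[of n y] pots_nonneg[OF ab(2), of y] by (simp add: ennreal_plus[symmetric] ab(3) del: ennreal_plus)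
    qed
    also have "\<dots> = hint V (\<phi> n) x + hint V b x"
      using V pot_diffs_measurable[OF \<phi>(1)] Wc_measurable[OF pots_Wc[OF ab(2)]] by (intro nn_integral_add) auto
    finally have "hint V b x + 0 = hint V b x + hint V (\<phi> n) x" by (simp add: eq add.commute)
    then show ?thesis
      using hint_finite[OF V pots_Wc[OF ab(2)], of x] unfolding ennreal_add_left_cancel by auto
  qed
  moreover have lim: "(\<lambda>n. \<phi> n y) \<longlonglongrightarrow> g y" for y
    by (rule tendsto_if_ereal_SUP[OF \<phi>(3,4)])
  moreover have "hint V g x = (SUP n. hint V (\<phi> n) x)"
    by (rule nn_integral_ennreal_SUP[OF _ \<phi>(3) lim]) (simp add: V pot_diffs_measurable \<phi>(1))
  ultimately have "hint V g x = 0" by simp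
  moreover have [measurable]: "g \<in> borel_measurable borel"
    unfolding g_def using Wc_measurable[OF pots_Wc[OF u(1)]] V by (intro measurable_If_set) auto
  ultimately have "AE y in H V x. ennreal (g y) = 0"
    using nn_integral_0_iff_AE[of "\<lambda>y. ennreal (g y)" "H V x"] V by simp
  then show ?thesis
  proof eventually_elim
    case (elim y)
    then show ?case using u(2)[of y] by (auto simp: g_def ennreal_eq_0_iff split: if_splits)
  qed
qed

section \<open>Superharmonic functions and monotone limits\<close>

text \<open>\<open>D\<close> ranges over all open subsets of \<open>V\<close>, not only those with
  compact closure in \<open>V\<close>, because the noncontact sets in \<open>glue_W\<close> come
  without compactness.\<close>

definition superharmonic :: "'a set \<Rightarrow> ('a \<Rightarrow> real) \<Rightarrow> bool"
  where "superharmonic V h \<longleftrightarrow> h \<in> borel_measurable borel \<and> (\<forall>x. 0 \<le> h x) \<and>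
    (\<forall>D x. open D \<longrightarrow> D \<subseteq> V \<longrightarrow> x \<in> D \<longrightarrow> hint D h x \<le> ennreal (h x))"

text \<open>A minimum principle verifies the membership test. Let \<open>r\<close> be the least
  majorant of a difference \<open>f\<close> below the glued function. On the open set
  \<open>D\<close> in \<open>V\<close> where \<open>r\<close> exceeds \<open>f\<close> by more than
  \<open>e * a\<close>, \<open>r\<close> is at most its own average with respect to
  \<open>H D\<close>. Off \<open>D\<close> it is at most h + t + e * a, whose average on
  \<open>D\<close> does not exceed its value. Letting \<open>e\<close> tend to 0 gives
  \<open>r\<close> at most h + t on \<open>V\<close>.\<close>

lemma glue_W:
  assumes V: "open V" and h: "superharmonic V h" "continuous_on V h"
    and t: "t \<in> Wc" and w: "w \<in> Wc" and wt: "\<And>y. y \<notin> V \<Longrightarrow> w y \<le> t y"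
  shows "(\<lambda>x. ereal (if x \<in> V then min (w x) (h x + t x) else w x)) \<in> W"
proof (rule W_if_reduced)
  let ?g = "\<lambda>x. if x \<in> V then min (w x) (h x + t x) else w x"
  have h_nonneg: "0 \<le> h x" and h_meas: "h \<in> borel_measurable borel" for x
    using h(1) by (auto simp: superharmonic_def)
  show "0 \<le> ereal (?g x)" for x
    using h_nonneg[of x] Wc_nonneg[OF t, of x] Wc_nonneg[OF w, of x] by simp
  have ht: "continuous_on V (\<lambda>x. h x + t x)"
    by (intro continuous_on_add h continuous_on_subset[OF Wc_cont[OF t]]) simp
  show "open {x. ereal c < ereal (?g x)}" for c
  proof -
    \<comment> \<open>The continuity of \<open>h\<close> is known on \<open>V\<close> only. The set
      where \<open>min (w x) (t x)\<close> exceeds \<open>c\<close> takes care of the boundary: off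
      \<open>V\<close> it is the set where \<open>w\<close> exceeds \<open>c\<close>, and on
      \<open>V\<close> it lies in the set where h + t does.\<close>
    have eq: "{x. ereal c < ereal (?g x)} =
        {x. c < w x} \<inter> ((\<lambda>x. h x + t x) -` {c<..} \<inter> V \<union> {x. c < min (w x) (t x)})"
      using wt h_nonneg by (auto intro: less_le_trans add_increasing)
    have *: "open ((\<lambda>x. h x + t x) -` {c<..} \<inter> V)"
      using continuous_on_open_vimage[OF V, of "\<lambda>x. h x + t x"] ht by (simp add: open_greaterThan)
    have **: "open {x. c < w x}" "open {x. c < min (w x) (t x)}"
      by (intro open_Collect_less continuous_on_const continuous_on_min Wc_cont w t)+
    show ?thesis unfolding eq by (intro open_Int[OF **(1)] open_Un[OF * **(2)])
  qed
  show "\<forall>f\<in>pot_diffs. \<forall>r. (\<forall>y. ereal (f y) \<le> ereal (?g y)) \<longrightarrow> reduced f r \<longrightarrow> (\<forall>x. ereal (r x) \<le> ereal (?g x))"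
  proof (intro ballI allI impI)
    fix f r x
    assume f: "f \<in> pot_diffs" and fg: "\<forall>y. ereal (f y) \<le> ereal (?g y)" and r: "reduced f r"
    obtain a b where ab: "f = (\<lambda>x. a x - b x)" "a \<in> pots" "b \<in> pots" using f by (auto simp: pot_diffs_def)
    have fw: "f y \<le> w y" for y using fg[rule_format, of y] by (auto split: if_splits)
    have fht: "f y \<le> h y + t y" if "y \<in> V" for y using fg[rule_format, of y] that by auto
    have rw: "r y \<le> w y" for y using reducedD(3)[OF r Wc_W[OF w]] fw by simp
    have rP: "r \<in> pots" by (rule reducedD(1)[OF r])
    have "r x \<le> h x + t x" if x: "x \<in> V"
    proof -
      have e: "r x \<le> h x + t x + e * a x" if e: "0 < e" "e \<le> 1" for e
      proof (cases "r x \<le> f x + e * a x")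
        case True
        then show ?thesis using fht[OF x] by simp
      next
        case False
        define D where "D = V \<inter> {y. f y + e * a y < r y}"
        have "open D"
          unfolding D_def by (intro open_Int V open_Collect_less continuous_on_add continuous_on_mult
              continuous_on_const pot_diffs_cont[OF f] pots_cont[OF ab(2)] pots_cont[OF rP])
        then have D: "open D" "D \<subseteq> V" "x \<in> D" using False x by (auto simp: D_def)
        have "ennreal (r x) \<le> hint D r x"
        proof (rule le_hint_real[OF D(1) rP])
          fix v assume v: "v \<in> W" "\<And>y. y \<notin> D \<Longrightarrow> ereal (r y) \<le> v y"
          show "ereal (r x) \<le> v x"
            by (rule reduced_le_if_le_on_contact[OF ab r e v(1)]) (auto intro!: v(2) simp: D_def)
        qed
        also have "\<dots> \<le> (\<integral>\<^sup>+y. ennreal (h y) + ennreal (t y + e * a y) \<partial>H D x)"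
        proof (rule nn_integral_mono_AE, use AE_H_outside[OF D(1), of x] in eventually_elim)
          fix y assume y: "y \<notin> D"
          have ea: "0 \<le> e * a y" using e pots_nonneg[OF ab(2), of y] by simp
          have "r y \<le> h y + (t y + e * a y)"
            using y fht[of y] rw[of y] wt[of y] h_nonneg[of y] ea by (cases "y \<in> V") (auto simp: D_def)
          then show "ennreal (r y) \<le> ennreal (h y) + ennreal (t y + e * a y)"
            using h_nonneg[of y] Wc_nonneg[OF t, of y] ea
            by (simp add: ennreal_plus[symmetric] ennreal_leI del: ennreal_plus)
        qed
        also have "\<dots> = hint D h x + hint D (\<lambda>y. t y + e * a y) x"
          using D(1) h_meas Wc_measurable[OF t] Wc_measurable[OF pots_Wc[OF ab(2)]]
          by (intro nn_integral_add) auto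
        also have "\<dots> \<le> ennreal (h x) + ennreal (t x + e * a x)"
        proof (rule add_mono)
          show "hint D h x \<le> ennreal (h x)" using h(1) D by (auto simp: superharmonic_def)
          show "hint D (\<lambda>y. t y + e * a y) x \<le> ennreal (t x + e * a x)"
            using e by (intro hint_Wc_le D Wc_add Wc_scale t pots_Wc ab) auto
        qed
        also have "\<dots> = ennreal (h x + (t x + e * a x))"
          using h_nonneg[of x] Wc_nonneg[OF t, of x] e pots_nonneg[OF ab(2), of x] by (intro ennreal_plus[symmetric]) auto
        finally have "r x \<le> h x + (t x + e * a x)"
          using h_nonneg[of x] Wc_nonneg[OF t, of x] e pots_nonneg[OF ab(2), of x]
          by (subst (asm) ennreal_le_iff) (auto intro!: add_nonneg_nonneg)
        then show ?thesis by simp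
      qed
      have "((\<lambda>e. h x + t x + e * a x) \<longlongrightarrow> h x + t x + 0 * a x) (at_right 0)"
        by (intro tendsto_intros)
      moreover have "eventually (\<lambda>e. r x \<le> h x + t x + e * a x) (at_right 0)"
        using e by (intro eventually_at_rightI[of 0 1]) auto
      ultimately show ?thesis using tendsto_lowerbound[of _ _ "at_right (0::real)" "r x"] by force
    qed
    then show "ereal (r x) \<le> ereal (?g x)" using rw[of x] by simp
  qed
qed

end

lemma ennreal_add_cancel_le:
  fixes a b c :: ennreal
  assumes "a + b \<le> c + b" "b < \<infinity>" shows "a \<le> c"
  using assms by (auto simp: add.commute[of _ b] ennreal_add_left_cancel_le)

context harmonic_kernels
begin

lemma superharmonicD:
  assumes "superharmonic V h"
  shows "h \<in> borel_measurable borel" "0 \<le> h x"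
    "open D \<Longrightarrow> D \<subseteq> V \<Longrightarrow> x \<in> D \<Longrightarrow> hint D h x \<le> ennreal (h x)"
  using assms by (auto simp: superharmonic_def)

lemma Wc_superharmonic: "s \<in> Wc \<Longrightarrow> superharmonic V s"
  by (auto simp: superharmonic_def Wc_measurable Wc_nonneg hint_Wc_le)

lemma superharmonic_diff:
  assumes s: "s \<in> Wc" and h: "h \<in> borel_measurable borel" "\<And>x. 0 \<le> h x" "\<And>x. h x \<le> s x"
    and sub: "\<And>D x. open D \<Longrightarrow> D \<subseteq> V \<Longrightarrow> x \<in> D \<Longrightarrow> ennreal (h x) \<le> hint D h x"
  shows "superharmonic V (\<lambda>x. s x - h x)"
  unfolding superharmonic_def
proof (intro conjI allI impI)
  show "(\<lambda>x. s x - h x) \<in> borel_measurable borel"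
    by (intro borel_measurable_diff Wc_measurable s h)
  show "0 \<le> s x - h x" for x using h(3)[of x] by simp
  fix D x assume D: "open D" "D \<subseteq> V" "x \<in> D"
  have "hint D (\<lambda>x. s x - h x) x + ennreal (h x) \<le> hint D (\<lambda>x. s x - h x) x + hint D h x"
    by (intro add_left_mono sub D)
  also have "\<dots> = (\<integral>\<^sup>+y. ennreal (s y - h y) + ennreal (h y) \<partial>H D x)"
    using D(1) h Wc_measurable[OF s] by (intro nn_integral_add[symmetric]) auto
  also have "\<dots> = hint D s x"
    using h(2,3) by (intro nn_integral_cong) (simp add: ennreal_plus[symmetric] del: ennreal_plus)
  also have "\<dots> \<le> ennreal (s x)" by (rule hint_Wc_le[OF D(1) s])
  also have "\<dots> = ennreal (s x - h x) + ennreal (h x)"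
    using h(2,3)[of x] by (simp add: ennreal_plus[symmetric] del: ennreal_plus)
  finally show "hint D (\<lambda>x. s x - h x) x \<le> ennreal (s x - h x)"
    by (rule ennreal_add_cancel_le) simp
qed

text \<open>Bauer's convergence property.  Near a point of \<open>V\<close>, \<open>h n + t\<close> and \<open>c - h n + t\<close> coincide
  with members of \<open>W\<close>.  The first increase to a member \<open>u\<close> of \<open>W\<close>, so the limit of the second is
  \<open>c + 2 t - u\<close>, which is finely continuous; by (B2) it is lower semicontinuous.\<close>

lemma continuous_on_monotone_limit:
  assumes V: "open V" and c: "c \<in> Wc"
    and h: "\<And>n. superharmonic V (h n)" "\<And>n. superharmonic V (\<lambda>x. c x - h n x)" "\<And>n. continuous_on V (h n)"
    and inc: "incseq h" and lim: "\<And>x. (\<lambda>n. h n x) \<longlonglongrightarrow> h' x"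
  shows "continuous_on V h'"
proof -
  have h0: "0 \<le> h n x" and hc: "h n x \<le> c x" for n x
    using superharmonicD(2)[OF h(1), of n x] superharmonicD(2)[OF h(2), of x n] by auto
  have hh': "h n x \<le> h' x" for n x
    using incseq_le[OF _ lim[of x]] inc by (auto simp: incseq_def le_fun_def)
  have h'c: "h' x \<le> c x" for x using LIMSEQ_le_const2[OF lim[of x]] hc by blast
  have "\<exists>N. open N \<and> x \<in> N \<and> continuous_on N h'" if x: "x \<in> V" for x
  proof -
    obtain f where f: "f \<in> pot_diffs" "0 < f x" "\<And>y. y \<notin> V \<Longrightarrow> f y \<le> 0"
      by (rule ex_diff_bump[OF V x]) (rule that)
    obtain a b where ab: "a \<in> pots" "b \<in> pots" "f = (\<lambda>x. a x - b x)" using f(1) by (auto simp: pot_diffs_def)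
    \<comment> \<open>The summand 1 makes w - t = M * f exceed \<open>c\<close> at \<open>x\<close>,
      so \<open>x\<close> lies in \<open>N\<close>. On \<open>N\<close> the minimum in
      \<open>G k\<close> is k + t as soon as k is at most \<open>c\<close>.\<close>
    define M where "M = (c x + 1) / f x"
    have M: "0 \<le> M" "M * f x = c x + 1" using f(2) Wc_nonneg[OF c, of x] by (auto simp: M_def)
    define w t where "w = (\<lambda>y. M * a y)" and "t = (\<lambda>y. M * b y)"
    have w: "w \<in> Wc" and t: "t \<in> Wc" unfolding w_def t_def by (intro Wc_scale M pots_Wc ab)+
    have wt: "w y - t y = M * f y" for y by (simp add: w_def t_def ab(3) algebra_simps)
    have wt_out: "w y \<le> t y" if "y \<notin> V" for y
      using wt[of y] mult_left_mono[OF f(3)[OF that] M(1)] by simp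
    define N where "N = V \<inter> {y. c y < w y - t y}"
    have "open N"
      unfolding N_def by (intro open_Int V open_Collect_less continuous_on_diff Wc_cont c w t)
    then have N: "open N" "x \<in> N" using x M(2) wt[of x] by (auto simp: N_def)
    define G where "G h y = (if y \<in> V then min (w y) (h y + t y) else w y)" for h y
    have G_W: "(\<lambda>y. ereal (G k y)) \<in> W" if "superharmonic V k" "continuous_on V k" for k
      unfolding G_def by (rule glue_W[OF V that t w wt_out])
    have G_N: "G k y = k y + t y" if "y \<in> N" "k y \<le> c y" for k y
      using that by (auto simp: G_def N_def)
    have G0: "0 \<le> G k y" if "0 \<le> k y" for k y
      using that Wc_nonneg[OF w, of y] Wc_nonneg[OF t, of y] by (auto simp: G_def)
    define u where "u y = (SUP n. ereal (G (h n) y))" for y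
    have incG: "incseq (\<lambda>n y. ereal (G (h n) y))"
      using inc unfolding incseq_def le_fun_def by (auto simp: G_def intro: min.coboundedI2)
    have u: "u \<in> W"
      unfolding u_def by (rule B1[OF G_W[OF h(1,3)] incG])
    have uN: "u y = ereal (h' y + t y)" if y: "y \<in> N" for y
    proof -
      have "incseq (\<lambda>n. ereal (G (h n) y))" using incG by (auto simp: incseq_def le_fun_def)
      then have 1: "(\<lambda>n. ereal (G (h n) y)) \<longlonglongrightarrow> u y" unfolding u_def by (rule LIMSEQ_SUP)
      have "(\<lambda>n. ereal (h n y + t y)) \<longlonglongrightarrow> ereal (h' y + t y)" by (intro tendsto_intros lim)
      then have 2: "(\<lambda>n. ereal (G (h n) y)) \<longlonglongrightarrow> ereal (h' y + t y)"
        by (simp add: G_N[OF y] hc)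
      show ?thesis by (rule LIMSEQ_unique[OF 1 2])
    qed
    \<comment> \<open>(B2) calls for a minorant on all of X, so the limit is continued by 0 outside
      \<open>N\<close>. On \<open>N\<close> its superlevel sets are sets where \<open>u\<close> lies
      below a finely continuous function. They are finely open although \<open>h'\<close> itself is
      so far only known to be lower semicontinuous there.\<close>
    define m where "m y = (if y \<in> N then ereal (c y - h' y + t y) else 0)" for y
    have m0: "0 \<le> m y" for y using h'c[of y] Wc_nonneg[OF t, of y] by (simp add: m_def)
    have ct: "continuous_map fineT euclideanreal (\<lambda>y. c y + 2 * t y - e)" for e
      by (intro continuous_map_diff continuous_map_add Wc_fine_cont c Wc_scale t continuous_map_const[THEN iffD2]) auto
    have "openin fineT {y. e < m y}" for e
    proof (cases e)
      case (real r)
      show ?thesis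
      proof (cases "r < 0")
        case True
        then have "{y. e < m y} = UNIV" using m0 real by (auto intro: less_le_trans[of _ 0])
        then show ?thesis using openin_topspace[of fineT] by simp
      next
        case False
        then have "{y. e < m y} = N \<inter> {y. u y < ereal (c y + 2 * t y - r)}"
          using real uN by (auto simp: m_def split: if_splits)
        then show ?thesis
          using openin_Int[OF open_fine_open[OF N(1)] fine_open_less_fun[OF u ct[of r]]] by simp
      qed
    next
      case PInf
      then show ?thesis by simp
    next
      case MInf
      have "{y. e < m y} = UNIV" using m0 MInf by (auto intro: less_le_trans[of _ 0])
      then show ?thesis using openin_topspace[of fineT] by simp
    qed
    then have "lower_semicontinuous fineT m" by (simp add: lower_semicontinuous_def)
    moreover have "m y \<le> ereal (G (\<lambda>x. c x - h n x) y)" for n y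
    proof (cases "y \<in> N")
      case True
      then show ?thesis using hh'[of n y] h0[of n y] by (simp add: m_def G_N)
    next
      case False
      then show ?thesis using G0[of "\<lambda>x. c x - h n x" y] hc[of n y] by (simp add: m_def)
    qed
    ultimately have "\<exists>v\<in>W. (\<forall>y. m y \<le> v y) \<and>
        (\<forall>g\<in>range (\<lambda>n y. ereal (G (\<lambda>x. c x - h n x) y)). \<forall>y. v y \<le> g y)"
      by (intro fine_regularization) (auto intro!: G_W h continuous_on_diff continuous_on_subset[OF Wc_cont[OF c]])
    then obtain v where v: "v \<in> W" "\<And>y. m y \<le> v y" "\<And>n y. v y \<le> ereal (G (\<lambda>x. c x - h n x) y)"
      by auto
    have vN: "v y = ereal (c y - h' y + t y)" if y: "y \<in> N" for y
    proof (rule antisym)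
      have 1: "(\<lambda>n. ereal (c y - h n y + t y)) \<longlonglongrightarrow> ereal (c y - h' y + t y)"
        by (intro tendsto_intros lim)
      have 2: "v y \<le> ereal (c y - h n y + t y)" for n
        using v(3)[of y n] G_N[OF y, of "\<lambda>x. c x - h n x"] h0[of n y] by simp
      show "v y \<le> ereal (c y - h' y + t y)" by (rule LIMSEQ_le_const[OF 1]) (use 2 in blast)
      show "ereal (c y - h' y + t y) \<le> v y" using v(2)[of y] y by (simp add: m_def)
    qed
    have "continuous_on N (\<lambda>y. h' y + t y)"
    proof (rule continuous_on_if_lsc_split[OF N(1)])
      show "continuous_on N (\<lambda>y. c y + 2 * t y)"
        by (intro continuous_on_add continuous_on_mult continuous_on_const continuous_on_subset[OF Wc_cont] c t) auto
      have "{y \<in> N. e < h' y + t y} = N \<inter> {y. ereal e < u y}" for e using uN by auto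
      then show "open {y \<in> N. e < h' y + t y}" for e using open_Int[OF N(1) W_lsc[OF u]] by (simp only:)
      have "{y \<in> N. e < c y + 2 * t y - (h' y + t y)} = N \<inter> {y. ereal e < v y}" for e using vN by auto
      then show "open {y \<in> N. e < c y + 2 * t y - (h' y + t y)}" for e using open_Int[OF N(1) W_lsc[OF v(1)]] by (simp only:)
    qed
    from continuous_on_diff[OF this continuous_on_subset[OF Wc_cont[OF t] subset_UNIV]]
    have "continuous_on N h'" by simp
    then show ?thesis using N by auto
  qed
  then have "isCont h' x" if "x \<in> V" for x
    using that continuous_on_eq_continuous_at by blast
  then show ?thesis by (simp add: continuous_at_imp_continuous_on)
qed

end

section \<open>Harmonic averages of potentials: continuity and consistency\<close>

lemma (in balayage_space) compact_exhaustion: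
  assumes V: "open (V::'a set)"
  obtains K :: "nat \<Rightarrow> 'a set" where "\<And>n. compact (K n)" "\<And>n. K n \<subseteq> V" "incseq K"
    "\<And>L. compact L \<Longrightarrow> L \<subseteq> V \<Longrightarrow> \<exists>n. L \<subseteq> K n"
proof -
  obtain B :: "'a set set" where B: "countable B" "topological_basis B"
    using ex_countable_basis by blast
  define C where "C = insert {} {b \<in> B. compact (closure b) \<and> closure b \<subseteq> V}"
  have C: "countable C" "C \<noteq> {}" using B(1) by (auto simp: C_def)
  define e where "e = from_nat_into C"
  have e: "range e = C" unfolding e_def by (rule range_from_nat_into[OF C(2,1)])
  have "e n \<in> C" for n using e by blast
  then have "e n = {} \<or> e n \<in> B \<and> compact (closure (e n)) \<and> closure (e n) \<subseteq> V" for n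
    unfolding C_def by blast
  then have eC: "compact (closure (e n))" "closure (e n) \<subseteq> V" "open (e n)" for n
    using topological_basis_open[OF B(2), of "e n"] by (metis compact_empty closure_empty empty_subsetI open_empty)+
  show ?thesis
  proof (rule that[of "\<lambda>n. \<Union>i\<le>n. closure (e i)"])
    show "compact (\<Union>i\<le>n. closure (e i))" for n using eC by (intro compact_UN) auto
    show "(\<Union>i\<le>n. closure (e i)) \<subseteq> V" for n using eC by auto
    show "incseq (\<lambda>n. \<Union>i\<le>n. closure (e i))" by (force simp: incseq_def)
    fix L assume L: "compact L" "L \<subseteq> V"
    have "L \<subseteq> (\<Union>i\<in>UNIV. e i)"
    proof
      fix x assume "x \<in> L"
      then obtain N where N: "open N" "x \<in> N" "compact (closure N)" "closure N \<subseteq> V"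
        using relatively_compact_nbhd[OF V] L by blast
      obtain b where b: "b \<in> B" "x \<in> b" "b \<subseteq> N" using topological_basisE[OF B(2) N(1,2)] by blast
      have "closure b \<subseteq> closure N" using b(3) by (rule closure_mono)
      then have "compact (closure b)" using N(3) compact_Int_closed[OF N(3) closed_closure[of b]]
        by (simp add: Int_absorb1)
      then have "b \<in> C" using b N \<open>closure b \<subseteq> closure N\<close> by (auto simp: C_def)
      then show "x \<in> (\<Union>i\<in>UNIV. e i)" using e b(2) by blast
    qed
    then obtain I where I: "finite I" "L \<subseteq> (\<Union>i\<in>I. e i)"
      using compactE_image[OF L(1), of UNIV e] eC(3) by metis
    obtain n where n: "\<And>i. i \<in> I \<Longrightarrow> i \<le> n" using I(1) finite_nat_set_iff_bounded_le[of I] by auto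
    have "(\<Union>i\<in>I. e i) \<subseteq> (\<Union>i\<le>n. closure (e i))"
      by (intro UN_mono closure_subset) (auto dest: n)
    with I(2) have "L \<subseteq> (\<Union>i\<le>n. closure (e i))" by (rule order_trans)
    then show "\<exists>n. L \<subseteq> (\<Union>i\<le>n. closure (e i))" by blast
  qed
qed

lemma (in balayage_space) open_less_fun:
  assumes "w \<in> W" "continuous_on UNIV f"
  shows "open {y. ereal (f y) < w y}"
proof -
  have eq: "{y. ereal (f y) < w y} = (\<Union>q. {y. f y < q} \<inter> {y. ereal q < w y})"
  proof (intro set_eqI iffI)
    fix y assume "y \<in> {y. ereal (f y) < w y}"
    then obtain q where "ereal (f y) < ereal q" "ereal q < w y" using ereal_dense2 by blast
    then show "y \<in> (\<Union>q. {y. f y < q} \<inter> {y. ereal q < w y})" by auto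
  next
    fix y assume "y \<in> (\<Union>q. {y. f y < q} \<inter> {y. ereal q < w y})"
    then obtain q where "ereal (f y) < ereal q" "ereal q < w y" by auto
    then have "ereal (f y) < w y" by (rule less_trans)
    then show "y \<in> {y. ereal (f y) < w y}" by simp
  qed
  show ?thesis
    unfolding eq by (intro open_UN ballI open_Int W_lsc assms open_Collect_less continuous_on_const)
qed

context harmonic_kernels
begin

lemma ennreal_enn2real_hint: "open V \<Longrightarrow> s \<in> Wc \<Longrightarrow> ennreal (enn2real (hint V s x)) = hint V s x"
  using hint_finite[of V s x] by simp

text \<open>\<open>w n\<close> is the least majorant of \<open>p\<close> minus a cutoff of
  \<open>p\<close>, a difference that vanishes on \<open>K n\<close> and equals \<open>p\<close> off
  \<open>V\<close>. Hence a member of W that dominates \<open>w n\<close> off \<open>K n\<close>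
  dominates it everywhere. The averages of \<open>p\<close> lie below each \<open>w n\<close>
  because \<open>w n\<close> is a competitor; conversely every competitor, slightly enlarged,
  finally lies above \<open>w n\<close>.\<close>

lemma hint_eq_decreasing_limit:
  assumes V: "open V" and p: "p \<in> pots"
  obtains w K where "\<And>n. w n \<in> pots" "decseq w" "\<And>n x. w n x \<le> p x" "\<And>n x. x \<notin> V \<Longrightarrow> w n x = p x"
    "\<And>n. \<forall>v\<in>W. (\<forall>y. y \<notin> K n \<longrightarrow> ereal (w n y) \<le> v y) \<longrightarrow> (\<forall>x. ereal (w n x) \<le> v x)"
    "\<And>x. (\<lambda>n. w n x) \<longlonglongrightarrow> enn2real (hint V p x)"
    "incseq K" "\<And>L. compact L \<Longrightarrow> L \<subseteq> V \<Longrightarrow> \<exists>n. L \<subseteq> K n"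
proof -
  obtain K where K: "\<And>n. compact (K n)" "\<And>n. K n \<subseteq> V" "incseq K"
    "\<And>L. compact L \<Longrightarrow> L \<subseteq> V \<Longrightarrow> \<exists>n. L \<subseteq> K n"
    by (rule compact_exhaustion[OF V]) (rule that)
  have "\<exists>f\<in>pot_diffs. (\<forall>x. 0 \<le> f x \<and> f x \<le> p x \<and> (x \<in> K n \<longrightarrow> f x = p x) \<and> (x \<notin> V \<longrightarrow> f x = 0))" for n
    using ex_diff_cutoff[OF K(1,2) V p, of n] by metis
  then obtain \<psi> where \<psi>: "\<And>n. \<psi> n \<in> pot_diffs"
    "\<And>n x. 0 \<le> \<psi> n x \<and> \<psi> n x \<le> p x \<and> (x \<in> K n \<longrightarrow> \<psi> n x = p x) \<and> (x \<notin> V \<longrightarrow> \<psi> n x = 0)"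
    by metis
  define \<Psi> where "\<Psi> = rec_nat (\<psi> 0) (\<lambda>n f x. max (f x) (\<psi> (Suc n) x))"
  have \<Psi>0: "\<Psi> 0 = \<psi> 0" and \<Psi>S: "\<Psi> (Suc n) = (\<lambda>x. max (\<Psi> n x) (\<psi> (Suc n) x))" for n
    by (simp_all add: \<Psi>_def)
  have \<Psi>: "\<Psi> n \<in> pot_diffs" for n
    by (induction n) (auto simp: \<Psi>0 \<Psi>S intro: \<psi> pot_diffs_max)
  have \<Psi>': "0 \<le> \<Psi> n x \<and> \<Psi> n x \<le> p x \<and> (x \<in> K n \<longrightarrow> \<Psi> n x = p x) \<and> (x \<notin> V \<longrightarrow> \<Psi> n x = 0)" for n x
  proof (induction n)
    case 0
    show ?case using \<psi>(2)[where n=0 and x=x] by (simp add: \<Psi>0)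
  next
    case (Suc n)
    then show ?case using \<psi>(2)[where n="Suc n" and x=x] by (auto simp: \<Psi>S)
  qed
  have inc: "\<Psi> m x \<le> \<Psi> n x" if "m \<le> n" for m n x
    using that by (rule lift_Suc_mono_le[rotated]) (simp add: \<Psi>S)
  define \<phi> where "\<phi> n = (\<lambda>x. p x - \<Psi> n x)" for n
  have "\<phi> n \<in> pot_diffs" for n unfolding \<phi>_def by (intro pot_diffs_diff pots_diffs p \<Psi>)
  then have "\<forall>n. \<exists>r. reduced (\<phi> n) r" by (blast intro: ex_reduced_diff)
  then obtain w where w: "\<And>n. reduced (\<phi> n) (w n)" by metis
  have wP: "w n \<in> pots" for n by (rule reducedD(1)[OF w])
  have wp: "w n x \<le> p x" for n x
    using reducedD(3)[OF w pots_W[OF p], of n x] \<Psi>' by (simp add: \<phi>_def)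
  have out: "w n x = p x" if "x \<notin> V" for n x
    using reducedD(2)[OF w, of n x] wp[of n x] \<Psi>'[of n x] that by (simp add: \<phi>_def)
  have dec: "w n x \<le> w m x" if "m \<le> n" for m n x
    by (rule reduced_mono[OF w w]) (use inc[OF that] in \<open>simp add: \<phi>_def\<close>)
  have \<phi>K: "\<phi> n x = 0" if "x \<in> K n" for n x using \<Psi>'[of n x] that by (simp add: \<phi>_def)
  have carried: "ereal (w n x) \<le> v x" if v: "v \<in> W" "\<And>y. y \<notin> K n \<Longrightarrow> ereal (w n y) \<le> v y" for n v x
  proof (rule reducedD(3)[OF w v(1)])
    show "ereal (\<phi> n y) \<le> v y" for y
    proof (cases "y \<in> K n")
      case True
      then show ?thesis using positive[OF v(1), of y] by (simp add: \<phi>K zero_ereal_def)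
    next
      case False
      have "ereal (\<phi> n y) \<le> ereal (w n y)" using reducedD(2)[OF w, of n y] by simp
      then show ?thesis using v(2)[OF False] by order
    qed
  qed
  define k where "k x = enn2real (hint V p x)" for x
  have ek: "ennreal (k x) = hint V p x" for x
    unfolding k_def by (rule ennreal_enn2real_hint[OF V pots_Wc[OF p]])
  have k0: "0 \<le> k x" for x by (simp add: k_def)
  have "(\<lambda>n. w n x) \<longlonglongrightarrow> k x" for x
  proof -
    have kw: "k x \<le> w n x" for n
    proof -
      have "hint V p x \<le> ennreal (w n x)"
        by (rule hint_le_real[OF V p pots_Wc[OF wP]]) (simp add: out)
      then show ?thesis using pots_nonneg[OF wP, of n x] by (simp add: ek[symmetric])
    qed
    have "decseq (\<lambda>n. w n x)" using dec by (simp add: decseq_def)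
    then obtain l where l: "(\<lambda>n. w n x) \<longlonglongrightarrow> l" "\<And>n. l \<le> w n x"
      using decseq_convergent[of "\<lambda>n. w n x" "k x"] kw by metis
    have "k x \<le> l" using LIMSEQ_le_const[OF l(1)] kw by blast
    moreover have "ennreal l \<le> hint V p x"
    proof (rule le_hint_real[OF V p])
      fix v assume v: "v \<in> W" "\<And>y. y \<notin> V \<Longrightarrow> ereal (p y) \<le> v y"
      obtain q where q: "q \<in> Wc" "\<And>x. 0 < q x"
        "\<And>e. e > 0 \<Longrightarrow> \<exists>K. compact K \<and> (\<forall>x. x \<notin> K \<longrightarrow> p x \<le> e * q x)"
        using p by (auto simp: pots_def)
      \<comment> \<open>The enlarged competitor exceeds \<open>p\<close> strictly off
        \<open>V\<close>, where the competitor already dominates \<open>p\<close>, and off a compact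
        set, because p / q vanishes at infinity. What remains is a compact subset of
        \<open>V\<close>, so it is contained in some \<open>K n\<close> and \<open>carried\<close>
        applies.\<close>
      have le: "ereal l \<le> v x + ereal (e * q x)" if e: "e > 0" for e
      proof -
        have vq: "(\<lambda>y. v y + ereal (e * q y)) \<in> W"
          using e by (intro cone_add v Wc_W Wc_scale q) simp
        let ?G = "{y. ereal (p y) < v y + ereal (e * q y)}"
        have G: "open ?G" by (rule open_less_fun[OF vq pots_cont[OF p]])
        obtain C where C: "compact C" "\<And>y. y \<notin> C \<Longrightarrow> p y \<le> e / 2 * q y"
          using q(3)[of "e / 2"] e by auto
        have inG: "y \<in> ?G" if "ereal (p y) < ereal (e * q y) \<or> ereal (p y) \<le> v y" for y
          using that positive[OF v(1), of y] mult_pos_pos[OF e q(2)[of y]] by (cases "v y") auto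
        have "y \<in> C" if y: "y \<in> - ?G" for y
        proof (rule ccontr)
          assume "y \<notin> C"
          then have "p y \<le> e / 2 * q y" by (rule C(2))
          also have "\<dots> < e * q y" using e q(2)[of y] by simp
          finally show False using inG[of y] y by simp
        qed
        then have "- ?G \<subseteq> C" by (rule subsetI)
        then have "compact (- ?G)"
          using compact_Int_closed[OF C(1) closed_Compl[OF G]] by (simp only: Int_absorb1)
        moreover have "- ?G \<subseteq> V" using inG v(2) by blast
        ultimately obtain n where n: "- ?G \<subseteq> K n" using K(4) by blast
        have "ereal (w n x) \<le> v x + ereal (e * q x)"
        proof (rule carried[OF vq])
          fix y assume "y \<notin> K n"
          then have "ereal (p y) < v y + ereal (e * q y)" using n by auto
          moreover have "ereal (w n y) \<le> ereal (p y)" using wp by simp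
          ultimately show "ereal (w n y) \<le> v y + ereal (e * q y)" by order
        qed
        moreover have "ereal l \<le> ereal (w n x)" using l(2) by simp
        ultimately show ?thesis by order
      qed
      show "ereal l \<le> v x"
      proof (cases "v x")
        case (real r)
        have "l \<le> r + e" if "e > 0" for e
          using le[of "e / q x"] q(2)[of x] that real by simp
        then have "l \<le> r" by (rule field_le_epsilon)
        then show ?thesis using real by simp
      next
        case MInf
        then show ?thesis using positive[OF v(1), of x] by simp
      qed simp
    qed
    then have "l \<le> k x" using k0[of x] by (simp add: ek[symmetric])
    ultimately show ?thesis using l(1) by simp
  qed
  moreover have "decseq w" by (intro decseq_SucI le_funI dec) simp
  moreover have "\<forall>v\<in>W. (\<forall>y. y \<notin> K n \<longrightarrow> ereal (w n y) \<le> v y) \<longrightarrow> (\<forall>x. ereal (w n x) \<le> v x)" for n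
    using carried by blast
  ultimately show ?thesis
    using that[of w K, OF wP _ wp out _ _ K(3,4)] unfolding k_def by blast
qed

text \<open>Consistency: a competitor for \<open>w n\<close> off \<open>D\<close> is one for
  \<open>p\<close> off \<open>V\<close>, which bounds the iterated average from below, and averages
  of \<open>w n\<close> do not exceed \<open>w n\<close>, which bounds it from above. Continuity:
  locally and for large \<open>n\<close>, both \<open>w n\<close> and p - w n are superharmonic, and
  the latter increases, so the convergence property applies.\<close>

lemma
  assumes V: "open V" and p: "p \<in> pots"
  shows hint_pots_continuous: "continuous_on V (\<lambda>x. enn2real (hint V p x))"
    and hint_hint_pots: "open D \<Longrightarrow> D \<subseteq> V \<Longrightarrow> hint D (\<lambda>y. enn2real (hint V p y)) x = hint V p x"
proof -
  obtain w K where w: "\<And>n. w n \<in> pots" "decseq w" "\<And>n x. w n x \<le> p x" "\<And>n x. x \<notin> V \<Longrightarrow> w n x = p x"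
    and carried: "\<And>n. \<forall>v\<in>W. (\<forall>y. y \<notin> K n \<longrightarrow> ereal (w n y) \<le> v y) \<longrightarrow> (\<forall>x. ereal (w n x) \<le> v x)"
    and lim: "\<And>x. (\<lambda>n. w n x) \<longlonglongrightarrow> enn2real (hint V p x)"
    and K: "incseq K" "\<And>L. compact L \<Longrightarrow> L \<subseteq> V \<Longrightarrow> \<exists>n. L \<subseteq> K n"
    by (rule hint_eq_decreasing_limit[OF V p]) (rule that)
  define k where "k x = enn2real (hint V p x)" for x
  have ek: "ennreal (k x) = hint V p x" for x
    unfolding k_def by (rule ennreal_enn2real_hint[OF V pots_Wc[OF p]])
  have k0: "0 \<le> k x" for x by (simp add: k_def)
  note lim = lim[folded k_def]
  show "hint D (\<lambda>y. enn2real (hint V p y)) x = hint V p x" if D: "open D" "D \<subseteq> V"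
  proof -
    have limD: "(\<lambda>n. hint D (w n) x) \<longlonglongrightarrow> hint D k x"
    proof (rule nn_integral_dominated_convergence[where w="\<lambda>y. ennreal (p y)"])
      show "(\<lambda>y. ennreal (k y)) \<in> borel_measurable (H D x)"
        unfolding ek using nn_integral_H_measurable[OF V, of "\<lambda>y. ennreal (p y)"] Wc_measurable[OF pots_Wc[OF p]] D(1)
        by simp
      show "AE y in H D x. (\<lambda>n. ennreal (w n y)) \<longlonglongrightarrow> ennreal (k y)"
        by (intro AE_I2 tendsto_ennrealI lim)
    qed (use D(1) w(1,3) p hint_finite[OF D(1) pots_Wc[OF p]] in \<open>auto intro!: AE_I2 ennreal_leI measurable_compose[OF Wc_measurable measurable_ennreal] pots_Wc\<close>)
    have "hint V p x \<le> hint D (w n) x" for n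
      unfolding ek[symmetric]
    proof (rule le_hint_real[OF D(1) w(1)])
      fix v assume v: "v \<in> W" "\<And>y. y \<notin> D \<Longrightarrow> ereal (w n y) \<le> v y"
      have "enn2ereal (hint V p x) \<le> v x"
        by (rule hint_le[OF V p v(1)]) (use v(2) w(4)[of _ n] D(2) in \<open>metis subsetD\<close>)
      then show "ereal (k x) \<le> v x" unfolding ek[symmetric] by (simp add: enn2ereal_ennreal k0)
    qed
    then have "hint V p x \<le> hint D k x" using LIMSEQ_le_const[OF limD] by blast
    moreover have "hint D k x \<le> ennreal (k x)"
      by (rule LIMSEQ_le[OF limD tendsto_ennrealI[OF lim]])
        (use hint_Wc_le[OF D(1) pots_Wc[OF w(1)]] in blast)
    ultimately have "hint D k x = hint V p x" unfolding ek by (intro antisym)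
    then show ?thesis unfolding k_def .
  qed
  have "\<exists>N. open N \<and> x \<in> N \<and> continuous_on N k" if x: "x \<in> V" for x
  proof -
    obtain N where N: "open N" "x \<in> N" "compact (closure N)" "closure N \<subseteq> V"
      by (rule relatively_compact_nbhd[OF V x]) (rule that)
    obtain m where m: "closure N \<subseteq> K m" using K(2) N(3,4) by blast
    \<comment> \<open>The shift by \<open>m\<close> puts \<open>N\<close> inside
      \<open>K (n + m)\<close> for every \<open>n\<close>, so that \<open>carried\<close> bounds
      \<open>w (n + m)\<close> by its averages over open subsets of \<open>N\<close>.\<close>
    define h where "h n = (\<lambda>x. p x - w (n + m) x)" for n
    have "superharmonic N (h n)" for n
      unfolding h_def
    proof (rule superharmonic_diff[OF pots_Wc[OF p] Wc_measurable[OF pots_Wc[OF w(1)]] pots_nonneg[OF w(1)] w(3)])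
      fix D y assume D: "open D" "D \<subseteq> N" "y \<in> D"
      show "ennreal (w (n + m) y) \<le> hint D (w (n + m)) y"
      proof (rule le_hint_real[OF D(1) w(1)])
        fix v assume v: "v \<in> W" "\<And>y. y \<notin> D \<Longrightarrow> ereal (w (n + m) y) \<le> v y"
        have "D \<subseteq> K (n + m)" using D(2) closure_subset[of N] m incseqD[OF K(1), of m "n + m"] by auto
        then show "ereal (w (n + m) y) \<le> v y" using v carried[of "n + m"] by blast
      qed
    qed
    moreover have "superharmonic N (\<lambda>x. p x - h n x)" for n
      unfolding h_def by (simp add: Wc_superharmonic pots_Wc w(1))
    moreover have "continuous_on N (h n)" for n
      unfolding h_def by (intro continuous_on_diff continuous_on_subset[OF pots_cont] p w(1)) auto
    moreover have "incseq h"
      unfolding h_def by (intro incseq_SucI le_funI diff_left_mono le_funD[OF decseqD[OF w(2)]]) simp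
    moreover have "(\<lambda>n. h n y) \<longlonglongrightarrow> p y - k y" for y
      unfolding h_def by (intro tendsto_intros LIMSEQ_ignore_initial_segment lim)
    ultimately have "continuous_on N (\<lambda>y. p y - k y)"
      by (rule continuous_on_monotone_limit[OF N(1) pots_Wc[OF p]])
    from continuous_on_diff[OF continuous_on_subset[OF pots_cont[OF p] subset_UNIV] this]
    have "continuous_on N k" by simp
    then show ?thesis using N by auto
  qed
  then have "isCont k x" if "x \<in> V" for x
    using that continuous_on_eq_continuous_at by blast
  then show "continuous_on V (\<lambda>x. enn2real (hint V p x))"
    by (simp add: continuous_at_imp_continuous_on k_def[symmetric])
qed

section \<open>Continuity of harmonic averages of Borel functions dominated by
  \<open>s\<close>\<close>

definition resolutive :: "'a set \<Rightarrow> ('a \<Rightarrow> real) \<Rightarrow> bool"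
  where "resolutive V f \<longleftrightarrow> f \<in> borel_measurable borel \<and> (\<forall>x. 0 \<le> f x) \<and> (\<forall>x. hint V f x < \<infinity>) \<and>
    continuous_on V (\<lambda>x. enn2real (hint V f x)) \<and>
    (\<forall>D x. open D \<longrightarrow> D \<subseteq> V \<longrightarrow> hint D (\<lambda>y. enn2real (hint V f y)) x = hint V f x)"

lemma resolutiveD:
  assumes "resolutive V f"
  shows "f \<in> borel_measurable borel" "0 \<le> f x" "hint V f x < \<infinity>"
    "continuous_on V (\<lambda>x. enn2real (hint V f x))"
    "open D \<Longrightarrow> D \<subseteq> V \<Longrightarrow> hint D (\<lambda>y. enn2real (hint V f y)) x = hint V f x"
    "ennreal (enn2real (hint V f x)) = hint V f x"
  using assms by (auto simp: resolutive_def)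

lemma hint_measurable:
  "open V \<Longrightarrow> f \<in> borel_measurable borel \<Longrightarrow> (\<lambda>x. enn2real (hint V f x)) \<in> borel_measurable borel"
  by (intro borel_measurable_enn2real nn_integral_H_measurable measurable_compose[OF _ measurable_ennreal])

lemma hint_add:
  assumes "open V" "f \<in> borel_measurable borel" "g \<in> borel_measurable borel" "\<And>x. 0 \<le> f x" "\<And>x. 0 \<le> g x"
  shows "hint V (\<lambda>y. f y + g y) x = hint V f x + hint V g x"
proof -
  have "hint V (\<lambda>y. f y + g y) x = (\<integral>\<^sup>+y. ennreal (f y) + ennreal (g y) \<partial>H V x)"
    using assms(4,5) by (intro nn_integral_cong) (simp add: ennreal_plus)
  also have "\<dots> = hint V f x + hint V g x"
    using assms(1-3) by (intro nn_integral_add) auto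
  finally show ?thesis .
qed

lemma resolutive_pots:
  assumes "open V" "p \<in> pots" shows "resolutive V p"
  unfolding resolutive_def
  using hint_pots_continuous[OF assms] hint_hint_pots[OF assms] hint_finite[OF assms(1) pots_Wc[OF assms(2)]]
    Wc_measurable[OF pots_Wc[OF assms(2)]] pots_nonneg[OF assms(2)] by blast

lemma resolutive_add:
  assumes V: "open V" and f: "resolutive V f" and g: "resolutive V g"
  shows "resolutive V (\<lambda>x. f x + g x)"
proof -
  note fD = resolutiveD[OF f] and gD = resolutiveD[OF g]
  have add: "hint V (\<lambda>y. f y + g y) x = hint V f x + hint V g x" for x
    by (rule hint_add[OF V fD(1) gD(1) fD(2) gD(2)])
  then have eq: "enn2real (hint V (\<lambda>y. f y + g y) x) = enn2real (hint V f x) + enn2real (hint V g x)" for x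
    using fD(3)[of x] gD(3)[of x] by (simp add: enn2real_plus)
  have "hint D (\<lambda>y. enn2real (hint V f y) + enn2real (hint V g y)) x = hint V f x + hint V g x"
    if D: "open D" "D \<subseteq> V" for D x
    using hint_add[OF D(1) hint_measurable[OF V fD(1)] hint_measurable[OF V gD(1)], of x] fD(5)[OF D] gD(5)[OF D]
    by simp
  then show ?thesis
    unfolding resolutive_def eq unfolding add
    using fD(1-4) gD(1-4) by (auto intro!: borel_measurable_add continuous_on_add add_nonneg_nonneg)
qed

lemma resolutive_diff:
  assumes V: "open V" and f: "resolutive V f" and g: "resolutive V g" and le: "\<And>x. g x \<le> f x"
  shows "resolutive V (\<lambda>x. f x - g x)"
proof -
  note fD = resolutiveD[OF f] and gD = resolutiveD[OF g]
  have meas: "(\<lambda>x. f x - g x) \<in> borel_measurable borel" using fD(1) gD(1) by simp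
  have add: "hint V f x = hint V (\<lambda>y. f y - g y) x + hint V g x" for x
    using hint_add[OF V meas gD(1), of x] le gD(2) by simp
  then have fin: "hint V (\<lambda>y. f y - g y) x < \<infinity>" for x using fD(3)[of x] by simp
  have plus: "enn2real (hint V f x) = enn2real (hint V (\<lambda>y. f y - g y) x) + enn2real (hint V g x)" for x
    using fin[of x] gD(3)[of x] by (simp add: add enn2real_plus)
  have "hint D (\<lambda>y. enn2real (hint V (\<lambda>y. f y - g y) y)) x = hint V (\<lambda>y. f y - g y) x"
    if D: "open D" "D \<subseteq> V" for D x
  proof -
    have "hint D (\<lambda>y. enn2real (hint V f y)) x =
        hint D (\<lambda>y. enn2real (hint V (\<lambda>y. f y - g y) y)) x + hint D (\<lambda>y. enn2real (hint V g y)) x"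
      unfolding plus by (rule hint_add[OF D(1) hint_measurable[OF V meas] hint_measurable[OF V gD(1)]]) auto
    then have "hint V g x + hint V (\<lambda>y. f y - g y) x =
        hint V g x + hint D (\<lambda>y. enn2real (hint V (\<lambda>y. f y - g y) y)) x"
      unfolding fD(5)[OF D] gD(5)[OF D] by (simp only: add add.commute)
    then show ?thesis using gD(3)[of x] unfolding ennreal_add_left_cancel by auto
  qed
  moreover have "continuous_on V (\<lambda>x. enn2real (hint V f x) - enn2real (hint V g x))"
    by (intro continuous_on_diff fD gD)
  ultimately show ?thesis
    unfolding resolutive_def using meas le fin by (simp add: plus)
qed

text \<open>The consistency clause of \<open>resolutive\<close> is carried along for this step. It
  gives the averages \<open>I n\<close> the mean value property on open subsets of \<open>V\<close>,
  so that \<open>I n\<close> and s - I n are both superharmonic and the increasing limit is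
  continuous.\<close>

lemma resolutive_limit:
  assumes V: "open V" and s: "s \<in> Wc" and f: "\<And>n. resolutive V (f n)" and fs: "\<And>n x. f n x \<le> s x"
    and inc: "incseq f" and lim: "\<And>x. (\<lambda>n. f n x) \<longlonglongrightarrow> f' x"
  shows "resolutive V f'"
proof -
  note fD = resolutiveD[OF f]
  have f'0: "0 \<le> f' x" for x using LIMSEQ_le_const[OF lim[of x]] fD(2) by blast
  have f's: "f' x \<le> s x" for x using LIMSEQ_le_const2[OF lim[of x]] fs by blast
  have meas: "f' \<in> borel_measurable borel" by (rule borel_measurable_LIMSEQ_real[OF lim fD(1)])
  define I where "I n x = enn2real (hint V (f n) x)" for n x
  define I' where "I' x = enn2real (hint V f' x)" for x
  have hs: "hint V g x \<le> ennreal (s x)" if "\<And>y. g y \<le> s y" for g x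
    by (rule order_trans[OF nn_integral_mono hint_Wc_le[OF V s]]) (auto intro: ennreal_leI that)
  have fin: "hint V f' x < \<infinity>" for x using hs[OF f's, of x] by (auto intro: le_less_trans)
  have eI: "ennreal (I n x) = hint V (f n) x" for n x unfolding I_def by (rule fD(6))
  have eI': "ennreal (I' x) = hint V f' x" for x unfolding I'_def using fin[of x] by simp
  have I0: "0 \<le> I n x" for n x by (simp add: I_def)
  have Is: "I n x \<le> s x" for n x
    using hs[of "f n", OF fs, of x] Wc_nonneg[OF s, of x] by (simp add: eI[symmetric])
  have incI: "incseq I"
  proof (intro incseq_SucI le_funI)
    fix n x
    have "hint V (f n) x \<le> hint V (f (Suc n)) x"
      using incseq_SucD[OF inc, of n] by (intro nn_integral_mono ennreal_leI) (auto simp: le_fun_def)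
    then show "I n x \<le> I (Suc n) x" using I0 by (simp add: eI[symmetric])
  qed
  have SUPI: "hint V f' x = (SUP n. ennreal (I n x))" for x
    unfolding eI by (rule nn_integral_ennreal_SUP[OF _ inc lim]) (use V fD(1) in simp)
  have limI: "(\<lambda>n. I n x) \<longlonglongrightarrow> I' x" for x
  proof -
    have "incseq (\<lambda>n. ennreal (I n x))" using incI by (auto simp: incseq_def le_fun_def intro!: ennreal_leI)
    from LIMSEQ_SUP[OF this] have "(\<lambda>n. ennreal (I n x)) \<longlonglongrightarrow> ennreal (I' x)"
      unfolding eI' SUPI .
    then show ?thesis using I0 by (subst (asm) tendsto_ennreal_iff) (auto simp: I'_def)
  qed
  have harm: "hint D (I n) x = ennreal (I n x)" if "open D" "D \<subseteq> V" for D n x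
    using fD(5)[OF that, of x n] unfolding eI[symmetric] by (simp add: I_def)
  have measI: "I n \<in> borel_measurable borel" for n unfolding I_def by (rule hint_measurable[OF V fD(1)])
  have "continuous_on V I'"
  proof (rule continuous_on_monotone_limit[OF V s _ _ _ incI limI])
    show "superharmonic V (I n)" for n
      using measI I0 harm by (auto simp: superharmonic_def)
    show "superharmonic V (\<lambda>x. s x - I n x)" for n
      by (rule superharmonic_diff[OF s measI I0 Is]) (simp add: harm)
    show "continuous_on V (I n)" for n unfolding I_def by (rule fD(4))
  qed
  moreover have "hint D I' x = hint V f' x" if D: "open D" "D \<subseteq> V" for D x
  proof -
    have "hint D I' x = (SUP n. hint D (I n) x)"
      by (rule nn_integral_ennreal_SUP[OF _ incI limI]) (use D measI in simp)
    then show ?thesis by (simp add: harm[OF D] SUPI)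
  qed
  ultimately show ?thesis
    unfolding resolutive_def using meas f'0 fin by (simp add: I'_def[symmetric])
qed

lemma indicator_eq_SUP_diffs:
  assumes G: "open G" and s: "s \<in> Wc"
  obtains \<phi> where "\<And>n. \<phi> n \<in> pot_diffs" "\<And>n x. 0 \<le> \<phi> n x" "incseq \<phi>"
    "\<And>y. ereal (indicator G y * s y) = (SUP n. ereal (\<phi> n y))"
proof -
  have s0: "0 \<le> s x" for x by (rule Wc_nonneg[OF s])
  have lsc: "open {x. ereal c < ereal (indicator G x * s x)}" for c
  proof (cases "c < 0")
    case True
    then have "{x. ereal c < ereal (indicator G x * s x)} = UNIV"
      using s0 by (auto simp: indicator_def intro: less_le_trans)
    then show ?thesis by simp
  next
    case False
    then have "{x. ereal c < ereal (indicator G x * s x)} = G \<inter> {x. c < s x}"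
      by (auto simp: indicator_def split: if_splits)
    moreover have "open {x. c < s x}" by (intro open_Collect_less continuous_on_const Wc_cont s)
    ultimately show ?thesis using open_Int[OF G] by simp
  qed
  have nonneg: "0 \<le> ereal (indicator G x * s x)" for x by (simp add: s0)
  show ?thesis by (rule lsc_eq_SUP_diffs[OF nonneg lsc]) (rule that)
qed

text \<open>A Dynkin argument starting from open sets, for which the function is an increasing limit
  of nonnegative differences of potentials. The weight \<open>s\<close> takes the place of the
  constant 1, about whose integrability nothing is known.\<close>

lemma resolutive_indicator:
  assumes V: "open V" and s: "s \<in> Wc" and A: "A \<in> sets borel"
  shows "resolutive V (\<lambda>x. indicator A x * s x)"
proof -
  have s0: "0 \<le> s x" for x by (rule Wc_nonneg[OF s])
  have ind_le: "indicator A x * s x \<le> s x" for A x using s0[of x] by (simp add: indicator_def)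
  have op: "resolutive V (\<lambda>x. indicator G x * s x)" if G: "open G" for G
  proof -
    obtain \<phi> where \<phi>: "\<And>n. \<phi> n \<in> pot_diffs" "\<And>n x. 0 \<le> \<phi> n x" "incseq \<phi>"
      "\<And>y. ereal (indicator G y * s y) = (SUP n. ereal (\<phi> n y))"
      by (rule indicator_eq_SUP_diffs[OF G s]) (rule that)
    have lim: "(\<lambda>n. \<phi> n y) \<longlonglongrightarrow> indicator G y * s y" for y by (rule tendsto_if_ereal_SUP[OF \<phi>(3,4)])
    show ?thesis
    proof (rule resolutive_limit[OF V s _ _ \<phi>(3) lim])
      fix n
      obtain a b where ab: "a \<in> pots" "b \<in> pots" "\<phi> n = (\<lambda>x. a x - b x)" using \<phi>(1)[of n] by (auto simp: pot_diffs_def)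
      show "resolutive V (\<phi> n)"
        unfolding ab(3) using \<phi>(2)[of n] by (intro resolutive_diff resolutive_pots V ab) (simp add: ab(3))
      show "\<phi> n x \<le> s x" for x
        using incseq_le[OF _ lim[of x], of n] \<phi>(3) ind_le[of G x] by (auto simp: incseq_def le_fun_def intro: order_trans)
    qed
  qed
  have "A \<in> sigma_sets UNIV {G::'a set. open G}" using A by (simp add: borel_def)
  then show ?thesis
  proof (induction rule: sigma_sets_induct_disjoint[rotated 2, consumes 1, case_names basic empty compl union int pow])
    case (basic G)
    then show ?case using op by simp
  next
    case empty
    show ?case using op[OF open_empty] .
  next
    case (compl A)
    have "resolutive V (\<lambda>x. indicator UNIV x * s x - indicator A x * s x)"
      by (rule resolutive_diff[OF V op[OF open_UNIV] compl(2)]) (use ind_le in simp)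
    moreover have "(\<lambda>x. indicator UNIV x * s x - indicator A x * s x) = (\<lambda>x. indicator (UNIV - A) x * s x)"
      by (auto simp: indicator_def)
    ultimately show ?case by simp
  next
    case (union A)
    let ?f = "\<lambda>n x. indicator (\<Union>i<n. A i) x * s x"
    show ?case
    proof (rule resolutive_limit[OF V s, of ?f])
      show "resolutive V (?f n)" for n
      proof (induction n)
        case 0
        show ?case using op[OF open_empty] by simp
      next
        case (Suc n)
        have "A i \<inter> A n = {}" if "i < n" for i
          using disjoint_family_onD[OF union(1), of i n] that by simp
        then have "indicator (\<Union>i<Suc n. A i) x = (indicator (\<Union>i<n. A i) x + indicator (A n) x :: real)" for x
          by (auto simp: indicator_def less_Suc_eq split: if_splits)
        then have "?f (Suc n) = (\<lambda>x. ?f n x + indicator (A n) x * s x)"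
          by (simp add: fun_eq_iff distrib_right)
        then show ?case using resolutive_add[OF V Suc union(3)[of n]] by simp
      qed
      show "?f n x \<le> s x" for n x by (rule ind_le)
      show "incseq ?f"
        using s0 by (auto simp: incseq_def le_fun_def indicator_def)
      show "(\<lambda>n. ?f n x) \<longlonglongrightarrow> indicator (\<Union>i. A i) x * s x" for x
        by (intro tendsto_mult tendsto_const LIMSEQ_indicator_UN)
    qed
  qed (auto simp: Int_stable_def)
qed

section \<open>Bounded harmonic functions\<close>

text \<open>Integrability is not a clause: for \<open>s\<close> in \<open>Wc\<close> it follows from
  the bound.\<close>

definition bounded_harmonic :: "'a set \<Rightarrow> ('a \<Rightarrow> real) \<Rightarrow> ('a \<Rightarrow> real) \<Rightarrow> bool"
  where "bounded_harmonic U s f \<longleftrightarrow> f \<in> borel_measurable borel \<and> continuous_on U f \<and> (\<forall>x. \<bar>f x\<bar> \<le> s x) \<and>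
    (\<forall>V\<in>rel_compact_open U. \<forall>x. (\<integral>y. f y \<partial>H V x) = f x)"

lemma bounded_harmonicD:
  assumes "bounded_harmonic U s f"
  shows "f \<in> borel_measurable borel" "continuous_on U f" "\<bar>f x\<bar> \<le> s x"
    "V \<in> rel_compact_open U \<Longrightarrow> (\<integral>y. f y \<partial>H V x) = f x"
  using assms unfolding bounded_harmonic_def by blast+

lemma integrable_Wc:
  assumes "open V" "s \<in> Wc" shows "integrable (H V x) s"
  using assms hint_finite[OF assms] Wc_nonneg[OF assms(2)]
  by (intro integrableI_nonneg) (auto intro: Wc_measurable)

lemma integrable_if_le_Wc:
  assumes "open V" "s \<in> Wc" "f \<in> borel_measurable borel" "\<And>y. \<bar>f y\<bar> \<le> s y"
  shows "integrable (H V x) f"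
  by (rule Bochner_Integration.integrable_bound[OF integrable_Wc[OF assms(1,2), of x]])
    (use assms in \<open>auto intro!: AE_I2 order_trans[OF assms(4)]\<close>)

lemma integral_Wc_le:
  assumes "open V" "s \<in> Wc" shows "(\<integral>y. s y \<partial>H V x) \<le> s x"
proof -
  have "ennreal (\<integral>y. s y \<partial>H V x) = hint V s x"
    using integrable_Wc[OF assms] Wc_nonneg[OF assms(2)] by (intro nn_integral_eq_integral[symmetric]) auto
  then have "ennreal (\<integral>y. s y \<partial>H V x) \<le> ennreal (s x)" using hint_Wc_le[OF assms, of x] by simp
  then show ?thesis using Wc_nonneg[OF assms(2), of x] by simp
qed

lemma integral_eq_hint:
  assumes "open V" "s \<in> Wc" "f \<in> borel_measurable borel" "\<And>y. 0 \<le> f y" "\<And>y. f y \<le> s y"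
  shows "ennreal (\<integral>y. f y \<partial>H V x) = hint V f x" "enn2real (hint V f x) = (\<integral>y. f y \<partial>H V x)"
proof -
  have "integrable (H V x) f" using assms by (intro integrable_if_le_Wc[of V s]) auto
  then show eq: "ennreal (\<integral>y. f y \<partial>H V x) = hint V f x"
    using assms(4) by (intro nn_integral_eq_integral[symmetric]) auto
  show "enn2real (hint V f x) = (\<integral>y. f y \<partial>H V x)"
    unfolding eq[symmetric] using assms(4) by (simp add: Bochner_Integration.integral_nonneg)
qed

lemma ind_Wc:
  assumes "s \<in> Wc" "A \<in> sets borel"
  shows "(\<lambda>y. indicator A y * s y) \<in> borel_measurable borel"
    "0 \<le> indicator A y * s y" "indicator A y * s y \<le> s y" "\<bar>indicator A y * s y\<bar> \<le> s y"
  using assms Wc_nonneg[OF assms(1), of y] Wc_measurable[OF assms(1)] by (auto simp: indicator_def)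

lemma integrable_ind_Wc:
  assumes "open V" "s \<in> Wc" "A \<in> sets borel"
  shows "integrable (H V x) (\<lambda>y. indicator A y * s y)"
  using assms by (intro integrable_if_le_Wc[of V s] ind_Wc)

lemma continuous_on_integral_indicator:
  assumes "open V" "s \<in> Wc" "A \<in> sets borel"
  shows "continuous_on V (\<lambda>x. \<integral>y. indicator A y * s y \<partial>H V x)"
  using resolutiveD(4)[OF resolutive_indicator[OF assms]]
  by (simp add: integral_eq_hint(2)[OF assms(1,2) ind_Wc(1-3)[OF assms(2,3)]])

text \<open>A set that is null for \<open>N z\<close> at a dense sequence of points is null at every
  point of \<open>V\<close>, as its measure depends continuously on \<open>z\<close>; so one measure
  \<open>M\<close> dominates all of them. The value of \<open>f n\<close> at \<open>z\<close> is the
  integral of f n / s against \<open>N z\<close>. Weak compactness of these quotients, tested with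
  the densities of the \<open>N z\<close>, gives one subsequence for all points.\<close>

lemma ex_pointwise_convergent_subsequence:
  assumes V: "V \<in> rel_compact_open U" and s: "s \<in> Wc" and f: "\<And>n. bounded_harmonic U s (f n)"
  obtains r where "strict_mono (r :: nat \<Rightarrow> nat)" "\<And>z. z \<in> V \<Longrightarrow> convergent (\<lambda>n. f (r n) z)"
proof (cases "V = {}")
  case True
  then show ?thesis using that[of id] by (simp add: strict_mono_id)
next
  case ne: False
  have oV: "open V" using V by (simp add: rel_compact_open_def)
  note fD = bounded_harmonicD[OF f]
  define N where "N z = density (H V z) (\<lambda>y. ennreal (s y))" for z
  have sets_N [simp]: "sets (N z) = sets borel" for z using oV by (simp add: N_def)
  have emN: "emeasure (N z) A = ennreal (\<integral>y. indicator A y * s y \<partial>H V z)" if A: "A \<in> sets borel" for z A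
  proof -
    have "emeasure (N z) A = (\<integral>\<^sup>+y. ennreal (s y) * indicator A y \<partial>H V z)"
      unfolding N_def using A oV Wc_measurable[OF s] by (intro emeasure_density) auto
    also have "\<dots> = hint V (\<lambda>y. indicator A y * s y) z"
      by (intro nn_integral_cong) (auto simp: indicator_def)
    also have "\<dots> = ennreal (\<integral>y. indicator A y * s y \<partial>H V z)"
      by (rule integral_eq_hint(1)[symmetric, OF oV s ind_Wc(1-3)[OF s A]])
    finally show ?thesis .
  qed
  have finN: "finite_measure (N z)" for z
    using emN[of UNIV z] oV by (intro finite_measureI) (simp add: N_def)
  obtain D :: "'a set" where D: "countable D" "\<And>G. open G \<Longrightarrow> G \<noteq> {} \<Longrightarrow> \<exists>d\<in>D. d \<in> G"
    by (rule countable_dense_setE) (rule that)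
  have "D \<inter> V \<noteq> {}" using D(2)[OF oV ne] by blast
  define d where "d = from_nat_into (D \<inter> V)"
  have d: "range d = D \<inter> V"
    unfolding d_def by (rule range_from_nat_into[OF \<open>D \<inter> V \<noteq> {}\<close>]) (use D(1) in auto)
  obtain M where M: "finite_measure M" "sets M = sets (borel :: 'a measure)"
    "\<And>A k. A \<in> sets M \<Longrightarrow> emeasure M A = 0 \<Longrightarrow> emeasure (N (d k)) A = 0"
    by (rule ex_dominating_finite_measure[of "\<lambda>k. N (d k)" borel]) (auto intro: finN that)
  have ac: "absolutely_continuous M (N z)" if z: "z \<in> V" for z
    unfolding absolutely_continuous_def
  proof (intro subsetI null_setsI)
    fix A assume A: "A \<in> null_sets M"
    then have A': "A \<in> sets borel" using M(2) by auto
    let ?I = "\<lambda>z. \<integral>y. indicator A y * s y \<partial>H V z"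
    have I0: "0 \<le> ?I z" for z by (intro Bochner_Integration.integral_nonneg ind_Wc s A')
    have cont: "continuous_on V ?I" by (rule continuous_on_integral_indicator[OF oV s A'])
    have Id: "?I (d k) = 0" for k
      using M(3)[of A k] A emN[OF A', of "d k"] I0[of "d k"] by (auto simp: null_sets_def ennreal_eq_0_iff)
    have "?I z = 0"
    proof (rule ccontr)
      assume "?I z \<noteq> 0"
      then have "z \<in> ?I -` {0<..} \<inter> V" using I0[of z] z by simp
      moreover have "open (?I -` {0<..} \<inter> V)"
        using continuous_on_open_vimage[OF oV, of ?I] cont by (simp add: open_greaterThan)
      ultimately obtain x where x: "x \<in> D" "x \<in> ?I -` {0<..} \<inter> V" using D(2) by blast
      then have "x \<in> range d" using d by blast
      then obtain k where "x = d k" by blast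
      then show False using x(2) Id[of k] by simp
    qed
    then show "emeasure (N z) A = 0" using emN[OF A'] by simp
    show "A \<in> sets (N z)" using A' by simp
  qed
  \<comment> \<open>Where \<open>s\<close> is 0, so is \<open>f n\<close>, and the quotient is 0 by
    convention; hence \<open>gs\<close> holds at every point.\<close>
  define g where "g n y = f n y / s y" for n y
  have gs: "g n y * s y = f n y" for n y using fD(3)[of n y] by (auto simp: g_def)
  have g1: "\<bar>g n y\<bar> \<le> 1" for n y
    using fD(3)[of n y] Wc_nonneg[OF s, of y] by (auto simp: g_def abs_divide divide_le_eq_1)
  have gm: "g n \<in> borel_measurable borel" for n
    unfolding g_def by (intro borel_measurable_divide fD(1) Wc_measurable s)
  then have gM: "g n \<in> borel_measurable M" for n using measurable_cong_sets[OF M(2) refl] by blast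
  obtain r where r: "strict_mono (r :: nat \<Rightarrow> nat)"
    "\<And>k. integrable M k \<Longrightarrow> convergent (\<lambda>n. \<integral>x. k x * g (r n) x \<partial>M)"
    by (rule ex_weakly_convergent_subsequence[OF M(1,2) gM g1]) (rule that)
  have "convergent (\<lambda>n. f (r n) z)" if z: "z \<in> V" for z
  proof -
    have "convergent (\<lambda>n. \<integral>y. g (r n) y \<partial>N z)"
      by (rule convergent_integral_absolutely_continuous[OF M(1) finN _ ac[OF z] gM r(2)]) (simp add: M(2))
    moreover have "(\<integral>y. g n y \<partial>N z) = f n z" for n
    proof -
      have "(\<integral>y. g n y \<partial>N z) = (\<integral>y. s y * g n y \<partial>H V z)"
        unfolding N_def using oV gm Wc_measurable[OF s] Wc_nonneg[OF s] by (intro integral_real_density) auto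
      then show ?thesis using fD(4)[OF V, of z n] gs by (simp add: mult.commute)
    qed
    ultimately show ?thesis by simp
  qed
  then show ?thesis using that r(1) by blast
qed

text \<open>The exit condition at \<open>x\<close> concerns potentials only. This replaces the part
  of \<open>s\<close> on \<open>G\<close> by a difference of potentials with almost the full value
  at \<open>x\<close>.\<close>

lemma ex_potential_diff_close:
  assumes "open G" "x \<in> G" "s \<in> Wc" "0 < e"
  obtains a b where "a \<in> pots" "b \<in> pots" "\<And>y. a y - b y \<le> indicator G y * s y" "s x - e < a x - b x"
proof -
  obtain \<phi> where \<phi>: "\<And>n. \<phi> n \<in> pot_diffs" "\<And>n x. 0 \<le> \<phi> n x" "incseq \<phi>"
    "\<And>y. ereal (indicator G y * s y) = (SUP n. ereal (\<phi> n y))"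
    by (rule indicator_eq_SUP_diffs[OF assms(1,3)]) (rule that)
  have lim: "(\<lambda>n. \<phi> n y) \<longlonglongrightarrow> indicator G y * s y" for y by (rule tendsto_if_ereal_SUP[OF \<phi>(3,4)])
  have le: "\<phi> n y \<le> indicator G y * s y" for n y
    using incseq_le[OF _ lim[of y], of n] \<phi>(3) by (auto simp: incseq_def le_fun_def)
  have "\<exists>n. s x - e < \<phi> n x"
    using order_tendstoD(1)[OF lim[of x], of "s x - e"] assms(2,4) by (auto simp: eventually_sequentially)
  then obtain n where n: "s x - e < \<phi> n x" by blast
  obtain a b where "a \<in> pots" "b \<in> pots" "\<phi> n = (\<lambda>x. a x - b x)" using \<phi>(1)[of n] by (auto simp: pot_diffs_def)
  then show ?thesis using that[of a b] le[of n] n by simp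
qed

section \<open>The two cases at a point: exit nearby or fine isolation\<close>

lemma AE_integral_eq_outside:
  assumes V: "open V" and f: "f \<in> borel_measurable borel" and g: "g \<in> borel_measurable borel"
    and eq: "\<And>y. y \<notin> V \<Longrightarrow> f y = g y"
  shows "(\<integral>y. f y \<partial>H V x) = (\<integral>y. g y \<partial>H V x)"
  using V f g AE_H_outside[OF V, of x] by (intro integral_cong_AE) (auto elim!: eventually_mono intro: eq)

text \<open>If arbitrarily small neighbourhoods of \<open>x\<close> have exit distributions almost concentrated near
  \<open>x\<close>, the far part of the harmonic measure is negligible; the near part is controlled by a pointwise
  convergent subsequence.\<close>

lemma equicontinuous_if_exit_near:
  assumes U: "open U" and U1: "U1 \<in> rel_compact_open U" "x \<in> U1" and s: "s \<in> Wc"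
    and near: "\<And>p e. p \<in> pots \<Longrightarrow> 0 < e \<Longrightarrow>
      \<exists>V. open V \<and> x \<in> V \<and> V \<subseteq> U1 \<and> p x - e \<le> (\<integral>y. p y \<partial>H V x)"
    and \<delta>: "0 < \<delta>"
  shows "\<exists>N. open N \<and> x \<in> N \<and> N \<subseteq> U \<and> (\<forall>y\<in>N. \<forall>f. bounded_harmonic U s f \<longrightarrow> \<bar>f y - f x\<bar> < \<delta>)"
proof (rule ccontr)
  assume neg: "\<not> ?thesis"
  have oU1: "open U1" and U1U: "U1 \<subseteq> U" and cU1: "compact (closure U1)" "closure U1 \<subseteq> U"
    using U1(1) closure_subset[of U1] by (auto simp: rel_compact_open_def)
  \<comment> \<open>Comparing \<open>g m\<close> with \<open>g n\<close> costs \<open>9 * e\<close>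
    at each of two points, and the continuity of \<open>g n\<close> at \<open>x\<close> costs
    another \<open>e\<close>.\<close>
  define e where "e = \<delta> / 19"
  have e: "0 < e" using \<delta> by (simp add: e_def)
  obtain a b where ab: "a \<in> pots" "b \<in> pots" "\<And>y. a y - b y \<le> indicator U1 y * s y" "s x - e < a x - b x"
    by (rule ex_potential_diff_close[OF oU1 U1(2) s e]) (rule that)
  obtain V where V: "open V" "x \<in> V" "V \<subseteq> U1" and aV: "a x - e \<le> (\<integral>y. a y \<partial>H V x)"
    using near[OF ab(1) e] by blast
  have "closure V \<subseteq> closure U1" using V(3) by (rule closure_mono)
  then have VU: "V \<in> rel_compact_open U"
    using V(1) cU1 compact_Int_closed[OF cU1(1) closed_closure[of V]]
    unfolding rel_compact_open_def by (auto simp: Int_absorb1)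
  have U1b: "- U1 \<in> sets borel" using oU1 by simp
  have 1: "integrable (H V y) s" "integrable (H V y) a" "integrable (H V y) b" for y
    by (intro integrable_Wc V s pots_Wc ab)+
  \<comment> \<open>The part of the average of \<open>s\<close> that lies outside \<open>U1\<close>.
    There a - b is at most 0, and averages of \<open>s\<close> and \<open>b\<close> do not exceed
    their values, so \<open>q x\<close> is controlled by the loss of \<open>a\<close> under
    averaging.\<close>
  define q where "q y = (\<integral>z. indicator (- U1) z * s z \<partial>H V y)" for y
  have "q x + (\<integral>y. a y \<partial>H V x) = (\<integral>y. indicator (- U1) y * s y + a y \<partial>H V x)"
    unfolding q_def by (intro Bochner_Integration.integral_add[symmetric] integrable_ind_Wc V s U1b 1)
  also have "\<dots> \<le> (\<integral>y. s y + b y \<partial>H V x)"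
  proof (intro integral_mono Bochner_Integration.integrable_add integrable_ind_Wc V s U1b 1)
    show "indicator (- U1) y * s y + a y \<le> s y + b y" for y
      using ab(3)[of y] by (cases "y \<in> U1") auto
  qed
  also have "\<dots> = (\<integral>y. s y \<partial>H V x) + (\<integral>y. b y \<partial>H V x)" by (intro Bochner_Integration.integral_add 1)
  also have "\<dots> \<le> s x + b x" by (intro add_mono integral_Wc_le V s pots_Wc ab)
  finally have qx: "q x < 3 * e" using aV ab(4) e by simp
  have cont_q: "continuous_on V q"
    unfolding q_def by (rule continuous_on_integral_indicator[OF V(1) s U1b])
  obtain A :: "nat \<Rightarrow> 'a set" where A: "\<And>i. open (A i)" "\<And>i. x \<in> A i"
    "\<And>S. open S \<Longrightarrow> x \<in> S \<Longrightarrow> eventually (\<lambda>i. A i \<subseteq> S) sequentially"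
    by (rule countable_basis_at_decseq[of x]) (rule that)
  have "\<exists>y f. y \<in> A n \<inter> V \<and> bounded_harmonic U s f \<and> \<delta> \<le> \<bar>f y - f x\<bar>" for n
  proof (rule ccontr)
    assume "\<not> ?thesis"
    then have "\<forall>y\<in>A n \<inter> V. \<forall>f. bounded_harmonic U s f \<longrightarrow> \<bar>f y - f x\<bar> < \<delta>" by (meson not_le)
    moreover have "open (A n \<inter> V)" "x \<in> A n \<inter> V" "A n \<inter> V \<subseteq> U" using A V U1U by auto
    ultimately show False using neg by blast
  qed
  then obtain y f where yf: "\<And>n. y n \<in> A n \<inter> V" "\<And>n. bounded_harmonic U s (f n)"
    "\<And>n. \<delta> \<le> \<bar>f n (y n) - f n x\<bar>" by metis
  \<comment> \<open>Convergence is wanted on \<open>U1\<close> and not just on \<open>V\<close>,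
    because \<open>H V\<close> charges only the complement of \<open>V\<close>; all but the small
    part \<open>q\<close> of its mass, weighted with \<open>s\<close>, lies in
    \<open>U1\<close>.\<close>
  obtain r where r: "strict_mono (r :: nat \<Rightarrow> nat)" "\<And>z. z \<in> U1 \<Longrightarrow> convergent (\<lambda>n. f (r n) z)"
    by (rule ex_pointwise_convergent_subsequence[OF U1(1) s yf(2)]) (rule that)
  define g where "g n = f (r n)" for n
  have gh: "bounded_harmonic U s (g n)" for n unfolding g_def by (rule yf(2))
  note gD = bounded_harmonicD[OF gh]
  \<comment> \<open>\<open>s\<close> is less than s x + 1 on the neighbourhood chosen below, so
    \<open>c * s\<close> is at most \<open>e\<close> there.\<close>
  define c where "c = e / (s x + 1)"
  have c: "0 < c" "c * (s x + 1) = e" using e Wc_nonneg[OF s, of x] by (auto simp: c_def)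
  \<comment> \<open>In the manner of Egorov: the points of \<open>U1\<close> where two members of
    the tail from \<open>n\<close> on differ by more than \<open>c * s\<close>. Pointwise
    convergence and domination by \<open>s\<close> make the weighted mass of \<open>B n\<close> at
    \<open>x\<close> tend to 0, and \<open>cont_qB\<close> spreads the smallness to nearby
    points.\<close>
  define B where "B n = (\<Union>m\<in>{n..}. \<Union>k\<in>{n..}. {z \<in> U1. c * s z < \<bar>g m z - g k z\<bar>})" for n
  have B_meas: "B n \<in> sets borel" for n
  proof -
    have [measurable]: "g m \<in> borel_measurable borel" "s \<in> borel_measurable borel" "U1 \<in> sets borel" for m
      using gD(1) Wc_measurable[OF s] oU1 by auto
    show ?thesis unfolding B_def by measurable
  qed
  have B_tendsto: "(\<lambda>n. \<integral>z. indicator (B n) z * s z \<partial>H V x) \<longlonglongrightarrow> (\<integral>z. 0 \<partial>H V x)"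
  proof (rule integral_dominated_convergence[where w=s])
    show "AE z in H V x. (\<lambda>n. indicator (B n) z * s z) \<longlonglongrightarrow> 0"
    proof (rule AE_I2)
      fix z
      have "eventually (\<lambda>n. z \<notin> B n \<or> s z = 0) sequentially"
      proof (cases "z \<in> U1 \<and> s z \<noteq> 0")
        case True
        then have "0 < c * s z" using c Wc_nonneg[OF s, of z] by simp
        moreover have "Cauchy (\<lambda>n. g n z)" using r(2) True by (auto simp: g_def intro: convergent_Cauchy)
        ultimately obtain n where n: "\<And>m k. n \<le> m \<Longrightarrow> n \<le> k \<Longrightarrow> dist (g m z) (g k z) < c * s z"
          using metric_CauchyD by blast
        have "z \<notin> B n'" if "n \<le> n'" for n'
        proof
          assume "z \<in> B n'"
          then obtain m k where "n' \<le> m" "n' \<le> k" "c * s z < \<bar>g m z - g k z\<bar>" by (auto simp: B_def)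
          with n[of m k] that show False by (simp add: dist_real_def)
        qed
        then show ?thesis unfolding eventually_sequentially by blast
      qed (auto simp: B_def)
      then show "(\<lambda>n. indicator (B n) z * s z) \<longlonglongrightarrow> 0"
        by (rule tendsto_eventually[OF eventually_mono]) auto
    qed
    show "AE z in H V x. norm (indicator (B n) z * s z) \<le> s z" for n
      using Wc_nonneg[OF s] by (intro AE_I2) (simp add: indicator_def)
  qed (use V(1) B_meas Wc_measurable[OF s] 1(1) in \<open>auto intro!: borel_measurable_times borel_measurable_indicator\<close>)
  then have "eventually (\<lambda>n. (\<integral>z. indicator (B n) z * s z \<partial>H V x) < e) sequentially"
    using order_tendstoD(2)[OF B_tendsto, of e] e by simp
  then obtain n where n: "(\<integral>z. indicator (B n) z * s z \<partial>H V x) < e" by (auto simp: eventually_sequentially)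
  define qB where "qB y = (\<integral>z. indicator (B n) z * s z \<partial>H V y)" for y
  have cont_qB: "continuous_on V qB"
    unfolding qB_def by (rule continuous_on_integral_indicator[OF V(1) s B_meas])
  define N where "N = (q -` {..<3 * e} \<inter> V) \<inter> (qB -` {..<e} \<inter> V) \<inter> {y. s y < s x + 1}"
  have N: "open N" "x \<in> N"
  proof -
    have *: "open (q -` {..<3 * e} \<inter> V)" "open (qB -` {..<e} \<inter> V)"
      using continuous_on_open_vimage[OF V(1), of q] continuous_on_open_vimage[OF V(1), of qB] cont_q cont_qB
      by (simp_all add: open_lessThan)
    have "open {y. s y < s x + 1}"
      by (intro open_Collect_less continuous_on_const Wc_cont s)
    then show "open N" unfolding N_def by (intro open_Int[OF open_Int[OF *]])
    show "x \<in> N" using qx n V(2) by (simp add: N_def qB_def)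
  qed
  \<comment> \<open>The constant 9 is made up of 2 from \<open>B n\<close>, 1 from the points of
    \<open>U1\<close> outside \<open>B n\<close>, and 2 * 3 from the complement of
    \<open>U1\<close>.\<close>
  have close: "\<bar>g m z - g n z\<bar> < 9 * e" if m: "n \<le> m" and z: "z \<in> N" for m z
  proof -
    have int: "integrable (H V z) (g k)" for k by (rule integrable_if_le_Wc[OF V(1) s gD(1,3)])
    have ind: "integrable (H V z) (\<lambda>y. indicator (B n) y * s y)" "integrable (H V z) (\<lambda>y. indicator (- U1) y * s y)"
      by (intro integrable_ind_Wc V s B_meas U1b)+
    have "\<bar>g m z - g n z\<bar> = \<bar>\<integral>y. g m y - g n y \<partial>H V z\<bar>"
      using int gD(4)[OF VU, of z] by simp
    also have "\<dots> \<le> (\<integral>y. \<bar>g m y - g n y\<bar> \<partial>H V z)" by (rule integral_abs_bound)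
    also have "\<dots> \<le> (\<integral>y. 2 * (indicator (B n) y * s y) + (c * s y + 2 * (indicator (- U1) y * s y)) \<partial>H V z)"
    proof (rule integral_mono)
      show "integrable (H V z) (\<lambda>y. \<bar>g m y - g n y\<bar>)" using int by simp
      show "integrable (H V z) (\<lambda>y. 2 * (indicator (B n) y * s y) + (c * s y + 2 * (indicator (- U1) y * s y)))"
        using ind 1(1) by simp
      fix y
      have 2: "\<bar>g m y - g n y\<bar> \<le> 2 * s y" using gD(3)[of m y] gD(3)[of n y] by linarith
      have cs: "0 \<le> c * s y" using c(1) Wc_nonneg[OF s, of y] by simp
      show "\<bar>g m y - g n y\<bar> \<le> 2 * (indicator (B n) y * s y) + (c * s y + 2 * (indicator (- U1) y * s y))"
      proof (cases "y \<in> U1 \<and> y \<notin> B n")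
        case True
        then have "\<bar>g m y - g n y\<bar> \<le> c * s y" using m unfolding B_def by (auto simp: not_less)
        then show ?thesis using True by simp
      next
        case False
        then show ?thesis using 2 cs Wc_nonneg[OF s, of y] by (auto simp: indicator_def)
      qed
    qed
    also have "\<dots> = 2 * qB z + (c * (\<integral>y. s y \<partial>H V z) + 2 * q z)"
      unfolding q_def qB_def using ind 1(1) by simp
    also have "\<dots> \<le> 2 * qB z + (c * s z + 2 * q z)"
      using c(1) integral_Wc_le[OF V(1) s, of z] by (intro add_left_mono add_right_mono mult_left_mono) auto
    also have "c * s z \<le> e" using c z mult_left_mono[of "s z" "s x + 1" c] by (simp add: N_def)
    finally show ?thesis using z by (simp add: N_def)
  qed
  have "x \<in> U" using U1(2) U1U by auto
  have "eventually (\<lambda>i. A i \<subseteq> N) sequentially" by (rule A(3)[OF N])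
  moreover have "eventually (\<lambda>i. A i \<subseteq> g n -` ball (g n x) e \<inter> U) sequentially"
  proof (rule A(3))
    show "open (g n -` ball (g n x) e \<inter> U)"
      using continuous_on_open_vimage[OF U, of "g n"] gD(2) by simp
    show "x \<in> g n -` ball (g n x) e \<inter> U" using e \<open>x \<in> U\<close> by simp
  qed
  ultimately have "eventually (\<lambda>i. A i \<subseteq> N \<and> A i \<subseteq> g n -` ball (g n x) e \<inter> U) sequentially"
    by (rule eventually_conj)
  then obtain i0 where i0: "\<And>i. i0 \<le> i \<Longrightarrow> A i \<subseteq> N \<and> A i \<subseteq> g n -` ball (g n x) e \<inter> U"
    by (auto simp: eventually_sequentially)
  \<comment> \<open>Late enough for the comparison with \<open>g n\<close> and, because
    \<open>r m\<close> is at least \<open>m\<close>, for the point \<open>y (r m)\<close> to be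
    close to \<open>x\<close>.\<close>
  define m where "m = max n i0"
  have "i0 \<le> r m" using seq_suble[OF r(1), of m] by (simp add: m_def)
  then have "y (r m) \<in> N" "y (r m) \<in> g n -` ball (g n x) e" using i0 yf(1)[of "r m"] by blast+
  then have y: "y (r m) \<in> N" "\<bar>g n (y (r m)) - g n x\<bar> < e"
    by (auto simp: dist_real_def abs_minus_commute)
  have "\<bar>g m (y (r m)) - g m x\<bar> < 19 * e"
    using close[OF _ y(1), of m] close[OF _ N(2), of m] y(2) unfolding m_def by linarith
  then show False using yf(3)[of "r m"] by (simp add: g_def e_def)
qed

text \<open>Least majorants \<open>w n\<close> of \<open>p\<close> minus ever narrower cutoffs at
  \<open>x\<close> increase to a member of W. It equals \<open>p\<close> away from \<open>x\<close>,
  since each other point leaves the \<open>A n\<close>, but at \<open>x\<close> it stays below p x -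
  e, since \<open>w n\<close> is bounded there by an average of \<open>p\<close>. A finely
  continuous comparison therefore singles out the point \<open>x\<close>.\<close>

lemma finely_isolated_if_exit_far:
  assumes U1: "open U1" "x \<in> U1" and p: "p \<in> pots" and e: "0 < e"
    and far: "\<And>V. open V \<Longrightarrow> x \<in> V \<Longrightarrow> V \<subseteq> U1 \<Longrightarrow> (\<integral>y. p y \<partial>H V x) < p x - e"
  shows "openin fineT {x}"
proof -
  obtain A :: "nat \<Rightarrow> 'a set" where A: "\<And>i. open (A i)" "\<And>i. x \<in> A i"
    "\<And>S. open S \<Longrightarrow> x \<in> S \<Longrightarrow> eventually (\<lambda>i. A i \<subseteq> S) sequentially"
    by (rule countable_basis_at_decseq[of x]) (rule that)
  have "\<exists>f V. f \<in> pot_diffs \<and> open V \<and> x \<in> V \<and> V \<subseteq> U1 \<and>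
      (\<forall>y. 0 \<le> f y \<and> f y \<le> p y \<and> (y \<in> V \<longrightarrow> f y = p y) \<and> (y \<notin> A n \<longrightarrow> f y = 0))" for n
  proof -
    have AU: "open (A n \<inter> U1)" "x \<in> A n \<inter> U1" using A U1 by auto
    obtain V where V: "open V" "x \<in> V" "compact (closure V)" "closure V \<subseteq> A n \<inter> U1"
      by (rule relatively_compact_nbhd[OF AU]) (rule that)
    obtain f where f: "f \<in> pot_diffs" "\<And>y. 0 \<le> f y" "\<And>y. f y \<le> p y"
      "\<And>y. y \<in> closure V \<Longrightarrow> f y = p y" "\<And>y. y \<notin> A n \<inter> U1 \<Longrightarrow> f y = 0"
      by (rule ex_diff_cutoff[OF V(3,4) AU(1) p]) (rule that)
    have "V \<subseteq> U1" using V(4) closure_subset[of V] by auto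
    then show ?thesis using f V(1,2) closure_subset[of V] by (intro exI[of _ f] exI[of _ V]) auto
  qed
  then obtain f V where f: "\<And>n. f n \<in> pot_diffs" and V: "\<And>n. open (V n)" "\<And>n. x \<in> V n" "\<And>n. V n \<subseteq> U1"
    and fp: "\<And>n y. 0 \<le> f n y \<and> f n y \<le> p y \<and> (y \<in> V n \<longrightarrow> f n y = p y) \<and> (y \<notin> A n \<longrightarrow> f n y = 0)"
    by metis
  \<comment> \<open>Running minima of the cutoffs make the \<open>w n\<close> increase. Each
    \<open>F n\<close> still equals \<open>p\<close> on some neighbourhood \<open>G n\<close> of
    \<open>x\<close>, to which \<open>far\<close> is applied.\<close>
  define F where "F = rec_nat (f 0) (\<lambda>n g y. min (g y) (f (Suc n) y))"
  have F0: "F 0 = f 0" and FS: "F (Suc n) = (\<lambda>y. min (F n y) (f (Suc n) y))" for n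
    by (simp_all add: F_def)
  have F: "F n \<in> pot_diffs" for n by (induction n) (auto simp: F0 FS intro: f pot_diffs_min)
  have F_bounds: "0 \<le> F n y \<and> F n y \<le> p y \<and> (y \<notin> A n \<longrightarrow> F n y = 0)" for n y
  proof (induction n)
    case 0
    show ?case using fp[where n=0 and y=y] by (simp add: F0)
  next
    case (Suc n)
    then show ?case using fp[where n="Suc n" and y=y] by (auto simp: FS)
  qed
  have "\<exists>G. open G \<and> x \<in> G \<and> G \<subseteq> U1 \<and> (\<forall>y\<in>G. F n y = p y)" for n
  proof (induction n)
    case 0
    show ?case using V fp[where n=0] by (intro exI[of _ "V 0"]) (simp add: F0)
  next
    case (Suc n)
    then obtain G where "open G" "x \<in> G" "G \<subseteq> U1" "\<forall>y\<in>G. F n y = p y" by blast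
    then show ?case using V fp[where n="Suc n"] by (intro exI[of _ "G \<inter> V (Suc n)"]) (auto simp: FS)
  qed
  then obtain G where G: "\<And>n. open (G n)" "\<And>n. x \<in> G n" "\<And>n. G n \<subseteq> U1" "\<And>n y. y \<in> G n \<Longrightarrow> F n y = p y"
    by metis
  have "\<forall>n. \<exists>w. reduced (\<lambda>y. p y - F n y) w"
    by (intro allI ex_reduced_diff pot_diffs_diff pots_diffs p F)
  then obtain w where w: "\<And>n. reduced (\<lambda>y. p y - F n y) (w n)" by metis
  have wP: "w n \<in> pots" for n by (rule reducedD(1)[OF w])
  have wp: "w n y \<le> p y" for n y
    using reducedD(3)[OF w pots_W[OF p], of n y] F_bounds by simp
  have w_out: "w n y = p y" if "y \<notin> A n" for n y
    using reducedD(2)[OF w, of y n] wp[of n y] F_bounds[of n y] that by simp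
  have wx: "w n x \<le> p x - e" for n
  proof -
    have "ennreal (w n x) \<le> hint (G n) p x"
    proof (rule le_hint_real[OF G(1) p])
      fix v assume v: "v \<in> W" "\<And>y. y \<notin> G n \<Longrightarrow> ereal (p y) \<le> v y"
      show "ereal (w n x) \<le> v x"
      proof (rule reducedD(3)[OF w v(1)])
        show "ereal (p y - F n y) \<le> v y" for y
        proof (cases "y \<in> G n")
          case True
          then show ?thesis using positive[OF v(1), of y] G(4) by (simp add: zero_ereal_def)
        next
          case False
          have "ereal (p y - F n y) \<le> ereal (p y)" using F_bounds[of n y] by simp
          then show ?thesis using v(2)[OF False] by order
        qed
      qed
    qed
    also have "\<dots> = ennreal (\<integral>y. p y \<partial>H (G n) x)"
      by (rule integral_eq_hint(1)[symmetric, OF G(1) pots_Wc[OF p] Wc_measurable[OF pots_Wc[OF p]] pots_nonneg[OF p] order_refl])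
    finally have "w n x \<le> (\<integral>y. p y \<partial>H (G n) x)"
      using Bochner_Integration.integral_nonneg[of "H (G n) x" p] pots_nonneg[OF p] by simp
    then show ?thesis using far[OF G(1-3), of n] by simp
  qed
  have "incseq (\<lambda>n y. ereal (w n y))"
  proof (intro incseq_SucI le_funI)
    fix n y
    have "w n y \<le> w (Suc n) y" by (rule reduced_mono[OF w w]) (simp add: FS)
    then show "ereal (w n y) \<le> ereal (w (Suc n) y)" by simp
  qed
  then have r: "(\<lambda>y. SUP n. ereal (w n y)) \<in> W" by (intro B1 pots_W wP)
  have "{x} = {y. (SUP n. ereal (w n y)) < ereal (p y - e / 2)}"
  proof (intro set_eqI iffI)
    fix y assume "y \<in> {x}"
    then have "(SUP n. ereal (w n y)) \<le> ereal (p y - e)" using wx by (auto intro: SUP_least)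
    also have "\<dots> < ereal (p y - e / 2)" using e by simp
    finally show "y \<in> {y. (SUP n. ereal (w n y)) < ereal (p y - e / 2)}" by simp
  next
    fix y assume y: "y \<in> {y. (SUP n. ereal (w n y)) < ereal (p y - e / 2)}"
    show "y \<in> {x}"
    proof (rule ccontr)
      assume "y \<notin> {x}"
      then have "eventually (\<lambda>i. A i \<subseteq> - {y}) sequentially" by (intro A(3)) auto
      then obtain n where "y \<notin> A n" by (auto simp: eventually_sequentially)
      then have "ereal (p y) = ereal (w n y)" by (simp add: w_out)
      also have "\<dots> \<le> (SUP n. ereal (w n y))" by (rule SUP_upper) simp
      also have "\<dots> < ereal (p y - e / 2)" using y by simp
      finally show False using e by simp
    qed
  qed
  moreover have "openin fineT {y. (SUP n. ereal (w n y)) < ereal (p y - e / 2)}"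
    by (rule fine_open_less_fun[OF r])
      (intro continuous_map_diff Wc_fine_cont pots_Wc p continuous_map_const[THEN iffD2]; simp)
  ultimately show ?thesis by simp
qed

text \<open>If \<open>x\<close> is finely isolated, the harmonic measures of \<open>U1 - {x}\<close> at \<open>y\<close> concentrate at \<open>x\<close> as
  \<open>y\<close> tends to \<open>x\<close>: the reduced function of a potential on \<open>{x}\<close> belongs to \<open>W\<close>, hence is lower
  semicontinuous.\<close>

lemma equicontinuous_if_finely_isolated:
  assumes U1: "U1 \<in> rel_compact_open U" "x \<in> U1" and s: "s \<in> Wc"
    and fine: "openin fineT {x}" and \<delta>: "0 < \<delta>"
  shows "\<exists>N. open N \<and> x \<in> N \<and> N \<subseteq> U \<and> (\<forall>y\<in>N. \<forall>f. bounded_harmonic U s f \<longrightarrow> \<bar>f y - f x\<bar> < \<delta>)"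
proof -
  have oU1: "open U1" and U1U: "U1 \<subseteq> U" and cU1: "compact (closure U1)" "closure U1 \<subseteq> U"
    using U1(1) closure_subset[of U1] by (auto simp: rel_compact_open_def)
  \<comment> \<open>Below, \<open>S\<close> exceeds s x - 3 e and S + T is less than s x + e, so T +
    \<bar>S - s x\<bar> is less than 7 e.\<close>
  define e where "e = \<delta> / 8"
  have e: "0 < e" using \<delta> by (simp add: e_def)
  obtain a b where ab: "a \<in> pots" "b \<in> pots" "\<And>y. a y - b y \<le> indicator U1 y * s y" "s x - e < a x - b x"
    by (rule ex_potential_diff_close[OF oU1 U1(2) s e]) (rule that)
  \<comment> \<open>Fine openness of the single point enters here: it keeps the regularization of
    the infimum from falling below \<open>a x\<close> at \<open>x\<close>, so \<open>\<rho>\<close>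
    is the reduced function of \<open>a\<close> on that point.\<close>
  have "lower_semicontinuous fineT (\<lambda>y. if y = x then ereal (a x) else 0)"
    unfolding lower_semicontinuous_def
  proof
    fix c
    have "{y \<in> topspace fineT. c < (if y = x then ereal (a x) else 0)} =
        (if c < 0 then UNIV else if c < ereal (a x) then {x} else {})"
      using pots_nonneg[OF ab(1), of x] by (auto split: if_splits intro: less_le_trans)
    then show "openin fineT {y \<in> topspace fineT. c < (if y = x then ereal (a x) else 0)}"
      using fine openin_topspace[of fineT] by simp
  qed
  then have "\<exists>\<rho>\<in>W. (\<forall>y. (if y = x then ereal (a x) else 0) \<le> \<rho> y) \<and>
      (\<forall>v\<in>{v \<in> W. ereal (a x) \<le> v x}. \<forall>y. \<rho> y \<le> v y)"
    by (intro fine_regularization) (auto simp: positive)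
  then obtain \<rho> where \<rho>: "\<rho> \<in> W" "\<And>y. (if y = x then ereal (a x) else 0) \<le> \<rho> y"
    "\<And>v y. v \<in> W \<Longrightarrow> ereal (a x) \<le> v x \<Longrightarrow> \<rho> y \<le> v y" by blast
  define V where "V = U1 - {x}"
  have V: "open V" using oU1 by (simp add: V_def open_Diff)
  have "closure V \<subseteq> closure U1" by (rule closure_mono) (simp add: V_def)
  then have VU: "V \<in> rel_compact_open U"
    using V cU1 compact_Int_closed[OF cU1(1) closed_closure[of V]]
    unfolding rel_compact_open_def by (auto simp: Int_absorb1)
  define N where "N = U1 \<inter> {y. ereal (a x - e) < \<rho> y} \<inter> {y. b y < b x + e} \<inter> {y. s y < s x + e}"
  have N: "open N" "x \<in> N" "N \<subseteq> U"
  proof -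
    show "open N"
      unfolding N_def
      by (intro open_Int oU1 W_lsc \<rho>(1) open_Collect_less continuous_on_const Wc_cont s pots_cont ab)
    have "ereal (a x - e) < ereal (a x)" using e by simp
    also have "\<dots> \<le> \<rho> x" using \<rho>(2)[of x] by simp
    finally show "x \<in> N" using U1(2) e by (simp add: N_def)
    show "N \<subseteq> U" using U1U by (auto simp: N_def)
  qed
  have "\<bar>f y - f x\<bar> < \<delta>" if y: "y \<in> N" and f: "bounded_harmonic U s f" for y f
  proof (cases "y = x")
    case True
    then show ?thesis using \<delta> by simp
  next
    case False
    note fD = bounded_harmonicD[OF f]
    have sets: "{x} \<in> sets borel" "- U1 \<in> sets borel" using oU1 by auto
    have int: "integrable (H V y) s" "integrable (H V y) a" "integrable (H V y) b"
      by (intro integrable_Wc V s pots_Wc ab)+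
    have int_ind: "integrable (H V y) (\<lambda>z. indicator {x} z * s z)" "integrable (H V y) (\<lambda>z. indicator (- U1) z * s z)"
      by (intro integrable_ind_Wc V s sets)+
    have int_f: "integrable (H V y) (\<lambda>z. indicator (- U1) z * f z)"
    proof (rule integrable_if_le_Wc[OF V s])
      show "(\<lambda>z. indicator (- U1) z * f z) \<in> borel_measurable borel"
        by (intro borel_measurable_times borel_measurable_indicator sets fD(1))
      show "\<bar>indicator (- U1) z * f z\<bar> \<le> s z" for z
        using fD(3)[of z] Wc_nonneg[OF s, of z] by (simp add: indicator_def)
    qed
    \<comment> \<open>The complement of \<open>V\<close> consists of \<open>x\<close> and the
      complement of \<open>U1\<close>; \<open>S\<close> and \<open>T\<close> are the corresponding
      parts of the average of \<open>s\<close>.\<close>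
    define S T where "S = (\<integral>z. indicator {x} z * s z \<partial>H V y)" and "T = (\<integral>z. indicator (- U1) z * s z \<partial>H V y)"
    have "S + T = (\<integral>z. indicator {x} z * s z + indicator (- U1) z * s z \<partial>H V y)"
      unfolding S_def T_def by (rule Bochner_Integration.integral_add[symmetric, OF int_ind])
    also have "\<dots> \<le> (\<integral>z. s z \<partial>H V y)"
      using U1(2) Wc_nonneg[OF s] int_ind int(1)
      by (intro integral_mono Bochner_Integration.integrable_add) (auto simp: indicator_def)
    also have "\<dots> \<le> s y" by (rule integral_Wc_le[OF V s])
    finally have ST: "S + T < s x + e" using y by (simp add: N_def)
    have "ereal (a x - e) < \<rho> y" using y by (simp add: N_def)
    \<comment> \<open>As \<open>x\<close> is not in \<open>V\<close>, every competitor in the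
      infimum for \<open>hint V a\<close> is at least \<open>a x\<close> at \<open>x\<close>, hence
      dominates \<open>\<rho>\<close>.\<close>
    also have "\<rho> y \<le> enn2ereal (hint V a y)"
      by (rule le_hint[OF V ab(1)]) (auto intro!: \<rho>(3) simp: V_def)
    also have "\<dots> = ereal (\<integral>z. a z \<partial>H V y)"
      unfolding integral_eq_hint(1)[symmetric, OF V pots_Wc[OF ab(1)] Wc_measurable[OF pots_Wc[OF ab(1)]] pots_nonneg[OF ab(1)] order_refl]
      by (simp add: enn2ereal_ennreal Bochner_Integration.integral_nonneg pots_nonneg[OF ab(1)])
    finally have a: "a x - e < (\<integral>z. a z \<partial>H V y)" by simp
    have "AE z in H V y. a z \<le> b z + indicator {x} z * s z"
      using AE_H_outside[OF V, of y]
    proof eventually_elim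
      fix z assume "z \<notin> V"
      then show "a z \<le> b z + indicator {x} z * s z"
        using ab(3)[of z] U1(2) by (cases "z = x") (auto simp: V_def)
    qed
    then have "(\<integral>z. a z \<partial>H V y) \<le> (\<integral>z. b z + indicator {x} z * s z \<partial>H V y)"
      using int int_ind by (intro integral_mono_AE Bochner_Integration.integrable_add)
    also have "\<dots> = (\<integral>z. b z \<partial>H V y) + S"
      unfolding S_def using int int_ind by (intro Bochner_Integration.integral_add)
    also have "(\<integral>z. b z \<partial>H V y) \<le> b y" by (rule integral_Wc_le[OF V pots_Wc[OF ab(2)]])
    finally have S: "s x - 3 * e < S" using a ab(4) y by (simp add: N_def)
    have S0: "0 \<le> S" and T0: "0 \<le> T"
      unfolding S_def T_def by (intro Bochner_Integration.integral_nonneg ind_Wc(2) s sets)+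
    \<comment> \<open>If \<open>s x\<close> is 0, then so is \<open>f x\<close>, and
      \<open>c * s x\<close> equals \<open>f x\<close> in this case too. On the point
      \<open>x\<close>, \<open>f\<close> can thus be replaced by \<open>c * s\<close>.\<close>
    define c where "c = f x / s x"
    have c: "c * s x = f x" "\<bar>c\<bar> \<le> 1"
      using fD(3)[of x] Wc_nonneg[OF s, of x] by (auto simp: c_def abs_divide divide_le_eq_1)
    have "f y = (\<integral>z. f z \<partial>H V y)" by (rule fD(4)[OF VU, symmetric])
    also have "\<dots> = (\<integral>z. c * (indicator {x} z * s z) + indicator (- U1) z * f z \<partial>H V y)"
    proof (rule AE_integral_eq_outside[OF V fD(1)])
      show "(\<lambda>z. c * (indicator {x} z * s z) + indicator (- U1) z * f z) \<in> borel_measurable borel"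
        using fD(1) Wc_measurable[OF s] sets by simp
      show "f z = c * (indicator {x} z * s z) + indicator (- U1) z * f z" if "z \<notin> V" for z
        using that U1(2) by (cases "z = x") (simp_all add: V_def c(1))
    qed
    also have "\<dots> = c * S + (\<integral>z. indicator (- U1) z * f z \<partial>H V y)"
      unfolding S_def using int_ind int_f by simp
    finally have fy: "f y = c * S + (\<integral>z. indicator (- U1) z * f z \<partial>H V y)" .
    have "\<bar>\<integral>z. indicator (- U1) z * f z \<partial>H V y\<bar> \<le> (\<integral>z. \<bar>indicator (- U1) z * f z\<bar> \<partial>H V y)"
      by (rule integral_abs_bound)
    also have "\<dots> \<le> T"
      unfolding T_def using fD(3) int_f int_ind
      by (intro integral_mono integrable_abs) (auto simp: indicator_def)
    finally have "\<bar>f y - c * S\<bar> \<le> T" using fy by simp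
    moreover have "\<bar>c * S - f x\<bar> \<le> \<bar>S - s x\<bar>"
    proof -
      have "\<bar>c * S - f x\<bar> = \<bar>c\<bar> * \<bar>S - s x\<bar>" unfolding c(1)[symmetric] by (simp add: abs_mult[symmetric] right_diff_distrib)
      also have "\<dots> \<le> 1 * \<bar>S - s x\<bar>" using c(2) by (intro mult_right_mono) auto
      finally show ?thesis by simp
    qed
    ultimately have "\<bar>f y - f x\<bar> \<le> T + \<bar>S - s x\<bar>" by linarith
    then have "\<bar>f y - f x\<bar> < 8 * e" using S ST S0 T0 e by linarith
    then show ?thesis by (simp add: e_def)
  qed
  then show ?thesis using N by blast
qed

lemma equicontinuous:
  assumes U: "open U" "x \<in> U" and s: "s \<in> Wc" and \<delta>: "0 < \<delta>"
  shows "\<exists>N. open N \<and> x \<in> N \<and> N \<subseteq> U \<and> (\<forall>y\<in>N. \<forall>f. bounded_harmonic U s f \<longrightarrow> \<bar>f y - f x\<bar> < \<delta>)"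
proof -
  obtain U1 where U1: "open U1" "x \<in> U1" "compact (closure U1)" "closure U1 \<subseteq> U"
    by (rule relatively_compact_nbhd[OF U]) (rule that)
  then have U1': "U1 \<in> rel_compact_open U" by (simp add: rel_compact_open_def)
  show ?thesis
  proof (cases "\<forall>p\<in>pots. \<forall>e>0. \<exists>V. open V \<and> x \<in> V \<and> V \<subseteq> U1 \<and> p x - e \<le> (\<integral>y. p y \<partial>H V x)")
    case True
    then show ?thesis by (intro equicontinuous_if_exit_near[OF U(1) U1' U1(2) s _ \<delta>]) blast
  next
    case False
    then obtain p e where "p \<in> pots" "0 < e"
      "\<And>V. open V \<Longrightarrow> x \<in> V \<Longrightarrow> V \<subseteq> U1 \<Longrightarrow> (\<integral>y. p y \<partial>H V x) < p x - e"
      by (meson not_le)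
    then have "openin fineT {x}" by (rule finely_isolated_if_exit_far[OF U1(1,2)])
    then show ?thesis by (rule equicontinuous_if_finely_isolated[OF U1' U1(2) s _ \<delta>])
  qed
qed

text \<open>Harmonicity alone makes \<open>h\<close> finite on \<open>U\<close> only. The finite
  bound \<open>s\<close> makes it real on all of X and both parts of its numerical integral finite,
  so that integral is a Bochner integral.\<close>

lemma bounded_harmonic_real_of_ereal:
  assumes h: "h \<in> harmonic_functions_bounded_by H s U" and s: "s \<in> W \<inter> cont_real UNIV"
  shows "bounded_harmonic U (\<lambda>x. real_of_ereal (s x)) (\<lambda>x. real_of_ereal (h x))"
    and "ereal (real_of_ereal (h x)) = h x"
proof -
  have s': "(\<lambda>x. real_of_ereal (s x)) \<in> Wc" "ereal (real_of_ereal (s x)) = s x" for x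
    using cont_real_imp_Wc s by auto
  have meas: "h \<in> borel_measurable borel" and cont: "h \<in> cont_real U"
    and harm: "\<And>V x. V \<in> rel_compact_open U \<Longrightarrow> has_numerical_integral (H V x) h (h x)"
    and le: "\<And>x. \<bar>h x\<bar> \<le> s x"
    using h by (auto simp: harmonic_functions_bounded_by_def harmonic_functions_def)
  have fin: "\<bar>h x\<bar> \<noteq> \<infinity>" for x using le[of x] s'(2)[of x] by auto
  define f where "f x = real_of_ereal (h x)" for x
  have hf: "h x = ereal (f x)" for x using fin[of x] by (simp add: f_def ereal_real)
  then show "ereal (real_of_ereal (h x)) = h x" by (simp add: f_def)
  have f_meas: "f \<in> borel_measurable borel" unfolding f_def using meas by simp
  have fs: "\<bar>f x\<bar> \<le> real_of_ereal (s x)" for x using le[of x] s'(2)[of x] by (metis abs_ereal.simps(1) ereal_less_eq(3) hf)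
  have "continuous_on U f"
    using continuous_on_iff_real[of U h] fin cont unfolding f_def[abs_def] by (simp add: o_def cont_real_def)
  moreover have "(\<integral>y. f y \<partial>H V x) = f x" if V: "V \<in> rel_compact_open U" for V x
  proof -
    have oV: "open V" using V by (simp add: rel_compact_open_def)
    have int: "integrable (H V x) f" by (rule integrable_if_le_Wc[OF oV s'(1) f_meas fs])
    have neg: "(\<integral>\<^sup>+y. ennreal (- f y) \<partial>H V x) < \<infinity>" and pos: "(\<integral>\<^sup>+y. ennreal (f y) \<partial>H V x) < \<infinity>"
      using int unfolding real_integrable_def by (auto simp: less_top)
    have "ereal (f x) = enn2ereal (\<integral>\<^sup>+y. ennreal (f y) \<partial>H V x) - enn2ereal (\<integral>\<^sup>+y. ennreal (- f y) \<partial>H V x)"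
      using harm[OF V, of x] by (simp add: has_numerical_integral_def hf)
    also have "\<dots> = ereal (enn2real (\<integral>\<^sup>+y. ennreal (f y) \<partial>H V x) - enn2real (\<integral>\<^sup>+y. ennreal (- f y) \<partial>H V x))"
    proof -
      have "enn2ereal z = ereal (enn2real z)" if "z < \<infinity>" for z
        using that by (cases z) (auto simp: enn2ereal_ennreal)
      then show ?thesis using neg pos by simp
    qed
    also have "\<dots> = ereal (\<integral>y. f y \<partial>H V x)" by (simp add: real_lebesgue_integral_def[OF int])
    finally show ?thesis by simp
  qed
  ultimately show "bounded_harmonic U (\<lambda>x. real_of_ereal (s x)) (\<lambda>x. real_of_ereal (h x))"
    using f_meas fs unfolding bounded_harmonic_def f_def by blast
qed

end

theorem theorem2p1:
  fixes W :: "('a::{t2_space, second_countable_topology} \<Rightarrow> ereal) set"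
    and H :: "'a set \<Rightarrow> 'a \<Rightarrow> 'a measure"
    and U :: "'a set"
    and s :: "'a \<Rightarrow> ereal"
  assumes "balayage_space W"
    and "\<And>V. open V \<Longrightarrow> is_harmonic_kernel W V (H V)"
    and "open U"
    and "s \<in> W \<inter> cont_real UNIV"
  shows "\<forall>x\<in>U. \<forall>\<delta>>0::real. \<exists>N\<subseteq>U. x \<in> interior N \<and>
    (\<forall>y\<in>N. \<forall>h\<in>harmonic_functions_bounded_by H s U. \<bar>h y - h x\<bar> < ereal \<delta>)"
proof (intro ballI allI impI)
  fix x and \<delta> :: real assume x: "x \<in> U" and \<delta>: "0 < \<delta>"
  interpret balayage_space W by (rule assms(1))
  interpret harmonic_kernels W H by unfold_locales (rule assms(2))
  have s: "(\<lambda>x. real_of_ereal (s x)) \<in> Wc" using cont_real_imp_Wc(1) assms(4) by auto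
  obtain N where N: "open N" "x \<in> N" "N \<subseteq> U"
    "\<And>y f. y \<in> N \<Longrightarrow> bounded_harmonic U (\<lambda>x. real_of_ereal (s x)) f \<Longrightarrow> \<bar>f y - f x\<bar> < \<delta>"
    using equicontinuous[OF assms(3) x s \<delta>] by blast
  have "\<bar>h y - h x\<bar> < ereal \<delta>" if y: "y \<in> N" and h: "h \<in> harmonic_functions_bounded_by H s U" for y h
  proof -
    note hr = bounded_harmonic_real_of_ereal[OF h assms(4)]
    have "\<bar>real_of_ereal (h y) - real_of_ereal (h x)\<bar> < \<delta>" by (rule N(4)[OF y hr(1)])
    then have "\<bar>ereal (real_of_ereal (h y)) - ereal (real_of_ereal (h x))\<bar> < ereal \<delta>" by simp
    then show ?thesis unfolding hr(2) .
  qed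
  then show "\<exists>N\<subseteq>U. x \<in> interior N \<and>
      (\<forall>y\<in>N. \<forall>h\<in>harmonic_functions_bounded_by H s U. \<bar>h y - h x\<bar> < ereal \<delta>)"
    using N(1-3) by (intro exI[of _ N]) (simp add: interior_open)
qed

end
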